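(* Let $d \in \mathbb{N}$. Assume that $A [0,1]^d = B^{-T} R^{-1} H [0,1]^d$, where $A, B \in \mathbb{R}^{d \times d}$ are nonsingular matrices, $R \in \mathbb{Z}^{d \times d}$ is a nonsingular integer matrix, and $H \in \mathbb{R}^{d \times d}$ is a lower triangular matrix whose diagonal entries all lie in $(0,1]$. Then there exists a set $\Gamma \subseteq B\mathbb{Z}^d$ such that $\mathcal{E}(\Gamma)$ is a Riesz basis for $L^2(A [0,1]^d)$.
   Context: For a matrix $M \in \mathbb{R}^{d\times d}$ and a set $S \subseteq \mathbb{R}^d$, $M S := \{Mx : x \in S\}$, and $M^{-T} := (M^{-1})^T$. For a discrete set $\Gamma \subseteq \mathbb{R}^d$, $\mathcal{E}(\Gamma) := \{ e^{2\pi i \gamma \cdot (\cdot)} : \gamma \in \Gamma\}$, regarded as a family of functions, indexed by $\Gamma$, on the domain under consideration. A countable family $\{f_n\}_{n \in I}$ in a separable Hilbert space $\mathcal{H}$ is a Riesz basis for $\mathcal{H}$ if its closed linear span is $\mathcal{H}$ and there are constants $0 < \alpha \le \beta < \infty$ such that $\alpha \sum_{n\in I} |c_n|^2 \le \| \sum_{n \in I} c_n f_n \|^2 \le \beta \sum_{n \in I} |c_n|^2$ for all $\{c_n\}_{n \in I} \in \ell_2(I)$. *)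

theory Defs
  imports "HOL-Analysis.Analysis"
begin

(* L^2(M) is rendered by its representatives: square-integrable functions with
   the L^2 seminorm. Functions equal almost everywhere are at distance 0, so
   none of the notions below distinguishes between representatives. *)

definition L2_space :: "'a measure \<Rightarrow> ('a \<Rightarrow> complex) set" where
  "L2_space M = {f \<in> borel_measurable M. integrable M (\<lambda>x. (cmod (f x))\<^sup>2)}"

definition L2_norm :: "'a measure \<Rightarrow> ('a \<Rightarrow> complex) \<Rightarrow> real" where
  "L2_norm M f = sqrt (LINT x|M. (cmod (f x))\<^sup>2)"

(* Unconditional convergence in L^2(M) of the sum of f n over n in I. *)
definition L2_has_sum ::
  "'a measure \<Rightarrow> ('i \<Rightarrow> 'a \<Rightarrow> complex) \<Rightarrow> ('a \<Rightarrow> complex) \<Rightarrow> 'i set \<Rightarrow> bool" where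
  "L2_has_sum M f g I \<longleftrightarrow>
     ((\<lambda>F. L2_norm M (\<lambda>x. g x - (\<Sum>n\<in>F. f n x))) \<longlongrightarrow> 0) (finite_subsets_at_top I)"

definition L2_closed_span ::
  "'a measure \<Rightarrow> ('i \<Rightarrow> 'a \<Rightarrow> complex) \<Rightarrow> 'i set \<Rightarrow> ('a \<Rightarrow> complex) set" where
  "L2_closed_span M f I = {g \<in> L2_space M. \<forall>\<epsilon>>0. \<exists>F c. finite F \<and> F \<subseteq> I \<and>
     L2_norm M (\<lambda>x. g x - (\<Sum>n\<in>F. c n * f n x)) < \<epsilon>}"

(* The norm of the sum of c n * f n presupposes convergence of the series, which
   is therefore part of the definition. *)
definition L2_Riesz_basis ::
  "'a measure \<Rightarrow> ('i \<Rightarrow> 'a \<Rightarrow> complex) \<Rightarrow> 'i set \<Rightarrow> bool" where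
  "L2_Riesz_basis M f I \<longleftrightarrow>
     countable I \<and> (\<forall>n\<in>I. f n \<in> L2_space M) \<and>
     L2_closed_span M f I = L2_space M \<and>
     (\<exists>\<alpha> \<beta>::real. 0 < \<alpha> \<and> \<alpha> \<le> \<beta> \<and>
        (\<forall>c::'i \<Rightarrow> complex. (\<lambda>n. (cmod (c n))\<^sup>2) summable_on I \<longrightarrow>
           (\<exists>g\<in>L2_space M. L2_has_sum M (\<lambda>n x. c n * f n x) g I \<and>
              \<alpha> * (\<Sum>\<^sub>\<infinity>n\<in>I. (cmod (c n))\<^sup>2) \<le> (L2_norm M g)\<^sup>2 \<and>
              (L2_norm M g)\<^sup>2 \<le> \<beta> * (\<Sum>\<^sub>\<infinity>n\<in>I. (cmod (c n))\<^sup>2))))"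

definition expfun :: "real^'n \<Rightarrow> real^'n \<Rightarrow> complex" where
  "expfun \<gamma> x = exp (2 * of_real pi * \<i> * of_real (\<gamma> \<bullet> x))"

definition int_lattice :: "(real^'n) set" where
  "int_lattice = {k. \<forall>i. k $ i \<in> \<int>}"

definition int_matrix :: "real^'n^'m \<Rightarrow> bool" where
  "int_matrix R \<longleftrightarrow> (\<forall>i j. R $ i $ j \<in> \<int>)"

definition lower_triangular :: "real^'n::{finite,linorder}^'n::{finite,linorder} \<Rightarrow> bool" where
  "lower_triangular H \<longleftrightarrow> (\<forall>i j. i < j \<longrightarrow> H $ i $ j = 0)"

end

theory Submission
  imports Defs "HOL-Probability.Infinite_Product_Measure"
begin

text \<open>Write \<open>e(t)\<close> for \<open>exp (2 pi i t)\<close> and \<open>C = B^{-T} R^{-1} H\<close>, so that the domain is \<open>C [0,1]^d\<close>.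
For an integer vector \<open>l\<close> the frequency \<open>B R^T l\<close> lies in \<open>B Z^d\<close>, because \<open>R\<close> is integral, and it
pairs with \<open>C y\<close> to \<open>l \<bullet> H y\<close>. After the substitution \<open>x = C y\<close>, which only rescales the
\<open>L^2\<close>-norm, it therefore suffices to find sets \<open>\<Gamma>_i\<close> of integers such that the functions
\<open>e(l \<bullet> H y)\<close>, with \<open>l\<close> in the product of the \<open>\<Gamma>_i\<close>, form a Riesz basis on the unit cube.

Triangularity of \<open>H\<close> makes this an iterated one-dimensional problem. The largest coordinate \<open>i\<close>
enters \<open>l \<bullet> H y\<close> only as \<open>l_i H_ii y_i\<close>, so that \<open>e(l \<bullet> H y)\<close> is \<open>e(l_i H_ii y_i)\<close> times
the function that belongs to the smaller coordinates, times a factor of modulus 1 that depends on \<open>l_i\<close> and on the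
smaller coordinates. Such a skew product of Riesz bases is again a Riesz basis
(\<open>skew_product_Riesz_basis\<close>): the twisting factors change neither the size of the coefficients nor the
spans that are involved. Induction over the coordinates gives \<open>triangular_Riesz_basis_cube\<close>.

It remains to find, for each \<open>0 < h \<le> 1\<close>, a set of integers whose exponentials form a Riesz basis for
\<open>L^2[0,h]\<close> (\<open>integer_Riesz_basis_interval\<close>). Two constructions are combined.

\<^item> If \<open>pi N h < 1\<close>, the orthogonal basis with frequencies \<open>n / h\<close> survives rounding every frequency to the
  nearest multiple of \<open>N\<close>, by the Paley-Wiener perturbation criterion (\<open>short_interval_Riesz_basis\<close>).

\<^item> If \<open>\<Gamma>\<close> serves \<open>[0,h]\<close> and contains no multiple of \<open>N\<close>, then \<open>\<Gamma>\<close> together with all multiples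
  of \<open>N\<close> serves \<open>[0,h + 1/N]\<close> (\<open>Riesz_basis_lengthen\<close>). Indeed the difference operator
  \<open>f(x + 1/N) - f(x)\<close> annihilates the frequencies in \<open>N Z\<close> and multiplies those in \<open>\<Gamma>\<close> by factors bounded
  away from 0. So it isolates the \<open>\<Gamma>\<close>-part, and the rest is a Fourier series on \<open>[0,1/N]\<close>.

For \<open>h = 1\<close> all integers serve. Otherwise choose \<open>N\<close> such that the fractional part of \<open>N h\<close> is at most \<open>1/4\<close>; the first construction handles the
length \<open>frac (N h) / N\<close>, and the second one, interleaved with translations by 1 that keep the frequencies
off \<open>N Z\<close>, adds the remaining \<open>floor (N h)\<close> pieces of length \<open>1/N\<close>.

Throughout, Riesz bases are handled in a form that mentions finite sums only: two-sided bounds for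
finite sums, and density of the span. Completeness of \<open>L^2\<close> enters once, to pass from there to the series in the
definition of a Riesz basis (\<open>L2_Riesz_basis_if_finitary\<close>).\<close>

section \<open>The seminormed space of square-integrable functions\<close>

lemma L2_spaceD:
  assumes "f \<in> L2_space M"
  shows "f \<in> borel_measurable M" "integrable M (\<lambda>x. (cmod (f x))\<^sup>2)"
  using assms by (auto simp: L2_space_def)

lemma L2_norm_nonneg [simp]: "0 \<le> L2_norm M f"
  by (simp add: L2_norm_def)

lemma L2_norm_power2: "(L2_norm M f)\<^sup>2 = (LINT x|M. (cmod (f x))\<^sup>2)"
  by (simp add: L2_norm_def)

lemma L2_space_iff:
  "f \<in> L2_space M \<longleftrightarrow> f \<in> borel_measurable M \<and> (\<integral>\<^sup>+x. (cmod (f x))\<^sup>2 \<partial>M) < \<infinity>"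
proof -
  have "integrable M (\<lambda>x. (cmod (f x))\<^sup>2) \<longleftrightarrow> (\<integral>\<^sup>+x. (cmod (f x))\<^sup>2 \<partial>M) < \<infinity>"
    if [measurable]: "f \<in> borel_measurable M"
    by (subst integrable_iff_bounded) auto
  thus ?thesis by (auto simp: L2_space_def)
qed

lemma nn_integral_L2_norm:
  assumes "f \<in> L2_space M"
  shows "(\<integral>\<^sup>+x. (cmod (f x))\<^sup>2 \<partial>M) = ennreal ((L2_norm M f)\<^sup>2)"
  using L2_spaceD[OF assms] by (simp add: L2_norm_power2 nn_integral_eq_integral)

lemma L2_normI:
  assumes "f \<in> borel_measurable M" "(\<integral>\<^sup>+x. (cmod (f x))\<^sup>2 \<partial>M) = ennreal (r\<^sup>2)" "0 \<le> r"
  shows "f \<in> L2_space M" "L2_norm M f = r"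
proof -
  show f: "f \<in> L2_space M" using assms by (simp add: L2_space_iff)
  have "(L2_norm M f)\<^sup>2 = r\<^sup>2"
    using nn_integral_L2_norm[OF f] assms(2) by simp
  thus "L2_norm M f = r" using assms(3) by (simp add: power2_eq_iff_nonneg)
qed

lemma L2_norm_leI:
  assumes "f \<in> borel_measurable M" "(\<integral>\<^sup>+x. (cmod (f x))\<^sup>2 \<partial>M) \<le> ennreal (r\<^sup>2)" "0 \<le> r"
  shows "f \<in> L2_space M" "L2_norm M f \<le> r"
proof -
  show f: "f \<in> L2_space M" using assms le_less_trans by (force simp: L2_space_iff)
  have "(L2_norm M f)\<^sup>2 \<le> r\<^sup>2"
    using nn_integral_L2_norm[OF f] assms(2) by simp
  thus "L2_norm M f \<le> r" using assms(3) by (simp add: power2_le_iff_abs_le)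
qed

lemma L2_space_zero [simp]: "(\<lambda>x. 0) \<in> L2_space M"
  by (simp add: L2_space_iff)

lemma L2_norm_zero [simp]: "L2_norm M (\<lambda>x. 0) = 0"
  by (simp add: L2_norm_def)

lemma L2_space_mult_bounded:
  assumes "f \<in> L2_space M" "w \<in> borel_measurable M" "\<And>x. cmod (w x) \<le> B"
  shows "(\<lambda>x. w x * f x) \<in> L2_space M" "L2_norm M (\<lambda>x. w x * f x) \<le> B * L2_norm M f"
proof -
  note [measurable] = L2_spaceD(1)[OF assms(1)] assms(2)
  have B: "B \<ge> 0" using assms(3)[of undefined] norm_ge_zero order_trans by blast
  have "(\<integral>\<^sup>+x. (cmod (w x * f x))\<^sup>2 \<partial>M) \<le> (\<integral>\<^sup>+x. ennreal (B\<^sup>2) * (cmod (f x))\<^sup>2 \<partial>M)"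
    by (intro nn_integral_mono)
       (auto simp: norm_mult power_mult_distrib B ennreal_mult[symmetric]
             intro!: mult_right_mono power_mono assms(3))
  also have "\<dots> = ennreal ((B * L2_norm M f)\<^sup>2)"
    by (subst nn_integral_cmult)
       (auto simp: nn_integral_L2_norm[OF assms(1)] power_mult_distrib ennreal_mult)
  finally have *: "(\<integral>\<^sup>+x. (cmod (w x * f x))\<^sup>2 \<partial>M) \<le> ennreal ((B * L2_norm M f)\<^sup>2)" .
  have m: "(\<lambda>x. w x * f x) \<in> borel_measurable M" by measurable
  show "(\<lambda>x. w x * f x) \<in> L2_space M" "L2_norm M (\<lambda>x. w x * f x) \<le> B * L2_norm M f"
    using L2_norm_leI[OF m *] B by auto
qed

lemma L2_norm_unimodular:
  assumes "\<And>x. cmod (w x) = 1"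
  shows "L2_norm M (\<lambda>x. w x * f x) = L2_norm M f"
  by (simp add: L2_norm_def norm_mult assms)

lemma L2_space_cmult: "f \<in> L2_space M \<Longrightarrow> (\<lambda>x. c * f x) \<in> L2_space M"
  by (rule L2_space_mult_bounded(1)[where B="cmod c"]) auto

lemma L2_norm_cmult: "L2_norm M (\<lambda>x. c * f x) = cmod c * L2_norm M f"
  by (simp add: L2_norm_def norm_mult power_mult_distrib real_sqrt_mult)

lemma L2_space_uminus: "f \<in> L2_space M \<Longrightarrow> (\<lambda>x. - f x) \<in> L2_space M"
  by (simp add: L2_space_def)

lemma L2_norm_uminus: "L2_norm M (\<lambda>x. - f x) = L2_norm M f"
  by (simp add: L2_norm_def)

lemma L2_norm_minus_commute: "L2_norm M (\<lambda>x. f x - g x) = L2_norm M (\<lambda>x. g x - f x)"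
  by (simp add: L2_norm_def norm_minus_commute)

lemma cmod_add_power2_le: "(cmod (a + b))\<^sup>2 \<le> 2 * (cmod a)\<^sup>2 + 2 * (cmod b)\<^sup>2"
proof -
  have "(cmod (a + b))\<^sup>2 \<le> (cmod a + cmod b)\<^sup>2"
    by (intro power_mono norm_triangle_ineq) auto
  also have "\<dots> \<le> 2 * (cmod a)\<^sup>2 + 2 * (cmod b)\<^sup>2"
    using zero_le_power2[of "cmod a - cmod b"] by (simp add: power2_eq_square algebra_simps)
  finally show ?thesis .
qed

lemma L2_space_add:
  assumes "f \<in> L2_space M" "g \<in> L2_space M"
  shows "(\<lambda>x. f x + g x) \<in> L2_space M"
proof -
  note [measurable] = assms[THEN L2_spaceD(1)]
  have "integrable M (\<lambda>x. 2 * (cmod (f x))\<^sup>2 + 2 * (cmod (g x))\<^sup>2)"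
    using assms[THEN L2_spaceD(2)] by auto
  hence "integrable M (\<lambda>x. (cmod (f x + g x))\<^sup>2)"
    by (rule Bochner_Integration.integrable_bound) (auto simp: cmod_add_power2_le)
  thus ?thesis by (simp add: L2_space_def)
qed

lemma L2_space_diff:
  "f \<in> L2_space M \<Longrightarrow> g \<in> L2_space M \<Longrightarrow> (\<lambda>x. f x - g x) \<in> L2_space M"
  using L2_space_add[of f M "\<lambda>x. - g x"] L2_space_uminus[of g M] by simp

lemma L2_space_sum:
  "(\<And>n. n \<in> F \<Longrightarrow> f n \<in> L2_space M) \<Longrightarrow> (\<lambda>x. \<Sum>n\<in>F. f n x) \<in> L2_space M"
  by (induction F rule: infinite_finite_induct) (auto intro: L2_space_add)

text \<open>Stated for the Lebesgue integral with values in \<open>[0,\<infinity>]\<close>, so that no integrability of the product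
has to be known beforehand.\<close>

lemma L2_norm_Cauchy_Schwarz:
  assumes "f \<in> L2_space M" "g \<in> L2_space M"
  shows "(\<integral>\<^sup>+x. ennreal (cmod (f x) * cmod (g x)) \<partial>M) \<le> ennreal (L2_norm M f * L2_norm M g)"
proof -
  note [measurable] = assms[THEN L2_spaceD(1)]
  have "(\<integral>\<^sup>+x. ennreal (cmod (f x) * cmod (g x)) \<partial>M)\<^sup>2
      \<le> (\<integral>\<^sup>+x. (cmod (f x))\<^sup>2 \<partial>M) * (\<integral>\<^sup>+x. (cmod (g x))\<^sup>2 \<partial>M)"
    using Cauchy_Schwarz_nn_integral[of "\<lambda>x. ennreal (cmod (f x))" M "\<lambda>x. ennreal (cmod (g x))"]
    by (simp add: ennreal_mult ennreal_power)
  also have "\<dots> = (ennreal (L2_norm M f * L2_norm M g))\<^sup>2"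
    by (simp add: assms nn_integral_L2_norm ennreal_mult[symmetric] power_mult_distrib ennreal_power)
  finally have *: "(\<integral>\<^sup>+x. ennreal (cmod (f x) * cmod (g x)) \<partial>M)\<^sup>2 \<le> (ennreal (L2_norm M f * L2_norm M g))\<^sup>2" .
  show ?thesis
  proof (cases "\<integral>\<^sup>+x. ennreal (cmod (f x) * cmod (g x)) \<partial>M" rule: ennreal_cases)
    case (real r)
    thus ?thesis using * by (simp add: ennreal_power abs_le_square_iff[symmetric])
  next
    case top
    thus ?thesis using * by (simp add: ennreal_power top_power_ennreal top_unique)
  qed
qed

lemma L2_norm_triangle:
  assumes "f \<in> L2_space M" "g \<in> L2_space M"
  shows "L2_norm M (\<lambda>x. f x + g x) \<le> L2_norm M f + L2_norm M g"
proof (rule L2_norm_leI(2))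
  note [measurable] = assms[THEN L2_spaceD(1)]
  show "(\<lambda>x. f x + g x) \<in> borel_measurable M" by measurable
  have "(cmod (f x + g x))\<^sup>2 \<le> (cmod (f x))\<^sup>2 + 2 * (cmod (f x) * cmod (g x)) + (cmod (g x))\<^sup>2" for x
  proof -
    have "(cmod (f x + g x))\<^sup>2 \<le> (cmod (f x) + cmod (g x))\<^sup>2"
      by (intro power_mono norm_triangle_ineq) auto
    thus ?thesis by (simp add: power2_eq_square algebra_simps)
  qed
  hence "(\<integral>\<^sup>+x. ennreal ((cmod (f x + g x))\<^sup>2) \<partial>M)
     \<le> (\<integral>\<^sup>+x. ennreal ((cmod (f x))\<^sup>2) + 2 * ennreal (cmod (f x) * cmod (g x)) + ennreal ((cmod (g x))\<^sup>2) \<partial>M)"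
    by (intro nn_integral_mono)
       (auto simp del: ennreal_plus ennreal_numeral
          simp: ennreal_plus[symmetric] ennreal_mult[symmetric] ennreal_numeral[symmetric])
  also have "\<dots> = ennreal ((L2_norm M f)\<^sup>2) + 2 * (\<integral>\<^sup>+x. ennreal (cmod (f x) * cmod (g x)) \<partial>M)
       + ennreal ((L2_norm M g)\<^sup>2)"
    by (simp add: nn_integral_add nn_integral_cmult nn_integral_L2_norm assms)
  also have "\<dots> \<le> ennreal ((L2_norm M f)\<^sup>2) + 2 * ennreal (L2_norm M f * L2_norm M g)
       + ennreal ((L2_norm M g)\<^sup>2)"
    by (intro add_mono mult_left_mono L2_norm_Cauchy_Schwarz assms) auto
  also have "\<dots> = ennreal ((L2_norm M f + L2_norm M g)\<^sup>2)"
    by (simp add: power2_sum ennreal_mult algebra_simps)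
  finally show "(\<integral>\<^sup>+x. ennreal ((cmod (f x + g x))\<^sup>2) \<partial>M) \<le> ennreal ((L2_norm M f + L2_norm M g)\<^sup>2)" .
qed auto

lemma L2_norm_triangle_diff:
  assumes "f \<in> L2_space M" "g \<in> L2_space M"
  shows "L2_norm M (\<lambda>x. f x - g x) \<le> L2_norm M f + L2_norm M g"
  using L2_norm_triangle[OF assms(1) L2_space_uminus[OF assms(2)]] by (simp add: L2_norm_uminus)

lemma L2_norm_triangle_mid:
  assumes "f \<in> L2_space M" "g \<in> L2_space M" "h \<in> L2_space M"
  shows "L2_norm M (\<lambda>x. f x - h x) \<le> L2_norm M (\<lambda>x. f x - g x) + L2_norm M (\<lambda>x. g x - h x)"
  using L2_norm_triangle[of "\<lambda>x. f x - g x" M "\<lambda>x. g x - h x"] assms L2_space_diff by fastforce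

lemma L2_norm_diff_ge:
  assumes "f \<in> L2_space M" "g \<in> L2_space M"
  shows "\<bar>L2_norm M f - L2_norm M g\<bar> \<le> L2_norm M (\<lambda>x. f x - g x)"
  using L2_norm_triangle[of "\<lambda>x. f x - g x" M g] L2_norm_triangle[of "\<lambda>x. g x - f x" M f]
        L2_norm_minus_commute[of M f g] assms by (auto simp: L2_space_diff)

lemma (in finite_measure) L2_space_bounded:
  assumes "f \<in> borel_measurable M" "\<And>x. x \<in> space M \<Longrightarrow> cmod (f x) \<le> B"
  shows "f \<in> L2_space M"
proof -
  note [measurable] = assms(1)
  have "integrable M (\<lambda>x. (cmod (f x))\<^sup>2)"
    by (rule integrable_const_bound[where B="B\<^sup>2"]) (auto intro!: AE_I2 power_mono assms(2))
  thus ?thesis using assms(1) by (simp add: L2_space_def)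
qed

lemma L2_norm_cong_AE:
  assumes "f \<in> borel_measurable M" "g \<in> borel_measurable M" "AE x in M. f x = g x"
  shows "L2_norm M f = L2_norm M g" "f \<in> L2_space M \<longleftrightarrow> g \<in> L2_space M"
proof -
  have [measurable]: "f \<in> borel_measurable M" "g \<in> borel_measurable M" by fact+
  have "(LINT x|M. (cmod (f x))\<^sup>2) = (LINT x|M. (cmod (g x))\<^sup>2)"
    by (rule integral_cong_AE) (use assms(3) in auto)
  thus "L2_norm M f = L2_norm M g" by (simp add: L2_norm_def)
  have "(\<integral>\<^sup>+x. (cmod (f x))\<^sup>2 \<partial>M) = (\<integral>\<^sup>+x. (cmod (g x))\<^sup>2 \<partial>M)"
    by (rule nn_integral_cong_AE) (use assms(3) in auto)
  thus "f \<in> L2_space M \<longleftrightarrow> g \<in> L2_space M" using assms by (simp add: L2_space_iff)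
qed

lemma L2_space_cong: "(\<And>x. x \<in> space M \<Longrightarrow> f x = g x) \<Longrightarrow> f \<in> L2_space M \<longleftrightarrow> g \<in> L2_space M"
  unfolding L2_space_def by (auto cong: measurable_cong Bochner_Integration.integrable_cong)

lemma L2_norm_cong: "(\<And>x. x \<in> space M \<Longrightarrow> f x = g x) \<Longrightarrow> L2_norm M f = L2_norm M g"
  unfolding L2_norm_def by (auto cong: Bochner_Integration.integral_cong)

section \<open>Closed linear spans\<close>

text \<open>Linear closure properties are proved for finite combinations first and pass to the closed span by
approximation.\<close>

definition lin_span :: "('i \<Rightarrow> 'a \<Rightarrow> complex) \<Rightarrow> 'i set \<Rightarrow> ('a \<Rightarrow> complex) set" where
  "lin_span f I = {(\<lambda>x. \<Sum>n\<in>F. c n * f n x) | F c. finite F \<and> F \<subseteq> I}"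

lemma lin_spanI: "finite F \<Longrightarrow> F \<subseteq> I \<Longrightarrow> (\<lambda>x. \<Sum>n\<in>F. c n * f n x) \<in> lin_span f I"
  by (auto simp: lin_span_def)

lemma L2_closed_span_iff:
  "g \<in> L2_closed_span M f I \<longleftrightarrow>
     g \<in> L2_space M \<and> (\<forall>\<epsilon>>0. \<exists>v\<in>lin_span f I. L2_norm M (\<lambda>x. g x - v x) < \<epsilon>)"
  unfolding L2_closed_span_def lin_span_def by (simp add: Bex_def) blast

lemma lin_span_zero: "(\<lambda>x. 0) \<in> lin_span f I"
  using lin_spanI[of "{}" I] by simp

lemma lin_span_base: "n \<in> I \<Longrightarrow> f n \<in> lin_span f I"
  using lin_spanI[of "{n}" I "\<lambda>_. 1" f] by simp

lemma lin_span_cmult: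
  assumes "u \<in> lin_span f I"
  shows "(\<lambda>x. a * u x) \<in> lin_span f I"
proof -
  obtain F c where F: "finite F" "F \<subseteq> I" "u = (\<lambda>x. \<Sum>n\<in>F. c n * f n x)"
    using assms by (auto simp: lin_span_def)
  have "(\<lambda>x. a * u x) = (\<lambda>x. \<Sum>n\<in>F. (a * c n) * f n x)"
    by (simp add: F sum_distrib_left mult.assoc)
  thus ?thesis using F(1,2) by (simp only: lin_spanI)
qed

lemma lin_span_add:
  assumes "u \<in> lin_span f I" "v \<in> lin_span f I"
  shows "(\<lambda>x. u x + v x) \<in> lin_span f I"
proof -
  obtain F c where F: "finite F" "F \<subseteq> I" "u = (\<lambda>x. \<Sum>n\<in>F. c n * f n x)"
    using assms by (auto simp: lin_span_def)
  obtain G d where G: "finite G" "G \<subseteq> I" "v = (\<lambda>x. \<Sum>n\<in>G. d n * f n x)"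
    using assms by (auto simp: lin_span_def)
  define e where "e n = (if n \<in> F then c n else 0) + (if n \<in> G then d n else 0)" for n
  have "u x + v x = (\<Sum>n\<in>F\<union>G. e n * f n x)" for x
  proof -
    have "(\<Sum>n\<in>F\<union>G. e n * f n x) =
       (\<Sum>n\<in>F\<union>G. (if n \<in> F then c n else 0) * f n x) + (\<Sum>n\<in>F\<union>G. (if n \<in> G then d n else 0) * f n x)"
      by (simp add: e_def distrib_right sum.distrib)
    also have "(\<Sum>n\<in>F\<union>G. (if n \<in> F then c n else 0) * f n x) = (\<Sum>n\<in>F. c n * f n x)"
      using F(1) G(1) by (intro sum.mono_neutral_cong_right) auto
    also have "(\<Sum>n\<in>F\<union>G. (if n \<in> G then d n else 0) * f n x) = (\<Sum>n\<in>G. d n * f n x)"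
      using F(1) G(1) by (intro sum.mono_neutral_cong_right) auto
    finally show ?thesis by (simp add: F G)
  qed
  thus ?thesis using F(1,2) G(1,2) by (simp add: lin_spanI)
qed

lemma lin_span_L2:
  "\<forall>n\<in>I. f n \<in> L2_space M \<Longrightarrow> v \<in> lin_span f I \<Longrightarrow> v \<in> L2_space M"
  by (auto simp: lin_span_def intro!: L2_space_sum L2_space_cmult)

lemma closed_span_lin_span:
  assumes "\<forall>n\<in>I. f n \<in> L2_space M" "v \<in> lin_span f I"
  shows "v \<in> L2_closed_span M f I"
  using assms lin_span_L2[OF assms] by (auto simp: L2_closed_span_iff intro!: bexI[of _ v])

lemma closed_span_add:
  assumes f: "\<forall>n\<in>I. f n \<in> L2_space M"
    and gh: "g \<in> L2_closed_span M f I" "h \<in> L2_closed_span M f I"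
  shows "(\<lambda>x. g x + h x) \<in> L2_closed_span M f I"
  unfolding L2_closed_span_iff
proof (intro conjI allI impI)
  have L: "g \<in> L2_space M" "h \<in> L2_space M" using gh by (auto simp: L2_closed_span_iff)
  thus "(\<lambda>x. g x + h x) \<in> L2_space M" by (rule L2_space_add)
  fix e :: real assume e: "0 < e"
  obtain u where u: "u \<in> lin_span f I" "L2_norm M (\<lambda>x. g x - u x) < e/2"
    using gh(1) e half_gt_zero unfolding L2_closed_span_iff by blast
  obtain v where v: "v \<in> lin_span f I" "L2_norm M (\<lambda>x. h x - v x) < e/2"
    using gh(2) e half_gt_zero unfolding L2_closed_span_iff by blast
  have "L2_norm M (\<lambda>x. (g x - u x) + (h x - v x)) < e"
    using L2_norm_triangle[OF L2_space_diff[OF L(1) lin_span_L2[OF f u(1)]]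
        L2_space_diff[OF L(2) lin_span_L2[OF f v(1)]]] u(2) v(2) by simp
  thus "\<exists>v\<in>lin_span f I. L2_norm M (\<lambda>x. g x + h x - v x) < e"
    using lin_span_add[OF u(1) v(1)] by (auto simp: algebra_simps)
qed

text \<open>Lets approximation arguments be nested: the approximants may themselves be known only as limits.\<close>

lemma closed_span_limit:
  assumes f: "\<forall>n\<in>I. f n \<in> L2_space M"
    and g: "g \<in> L2_space M"
    and lim: "\<And>e. e > 0 \<Longrightarrow> \<exists>h\<in>L2_closed_span M f I. L2_norm M (\<lambda>x. g x - h x) < e"
  shows "g \<in> L2_closed_span M f I"
  unfolding L2_closed_span_iff
proof (intro conjI allI impI g)
  fix e :: real assume e: "0 < e"
  obtain h where h: "h \<in> L2_closed_span M f I" "L2_norm M (\<lambda>x. g x - h x) < e/2"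
    using lim[of "e/2"] e by auto
  have hL: "h \<in> L2_space M" using h by (simp add: L2_closed_span_iff)
  obtain v where v: "v \<in> lin_span f I" "L2_norm M (\<lambda>x. h x - v x) < e/2"
    using h(1) e half_gt_zero unfolding L2_closed_span_iff by blast
  have "L2_norm M (\<lambda>x. g x - v x) < e"
    using L2_norm_triangle_mid[OF g hL lin_span_L2[OF f v(1)]] v(2) h(2) by simp
  thus "\<exists>v\<in>lin_span f I. L2_norm M (\<lambda>x. g x - v x) < e" using v(1) by blast
qed

lemma closed_span_cmult:
  assumes f: "\<forall>n\<in>I. f n \<in> L2_space M" and g: "g \<in> L2_closed_span M f I"
  shows "(\<lambda>x. a * g x) \<in> L2_closed_span M f I"
  unfolding L2_closed_span_iff
proof (intro conjI allI impI)
  show "(\<lambda>x. a * g x) \<in> L2_space M" using g by (auto simp: L2_closed_span_iff intro: L2_space_cmult)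
  fix e :: real assume e: "0 < e"
  have "e / (cmod a + 1) > 0" using e by (simp add: add_nonneg_pos)
  then obtain v where v: "v \<in> lin_span f I" "L2_norm M (\<lambda>x. g x - v x) < e / (cmod a + 1)"
    using g unfolding L2_closed_span_iff by blast
  have "L2_norm M (\<lambda>x. a * g x - a * v x) = cmod a * L2_norm M (\<lambda>x. g x - v x)"
    using L2_norm_cmult[of M a "\<lambda>x. g x - v x"] by (simp add: right_diff_distrib)
  also have "\<dots> \<le> cmod a * (e / (cmod a + 1))" using v(2) by (intro mult_left_mono) auto
  also have "\<dots> < e"
  proof -
    have p: "0 < cmod a + 1" by (simp add: add_nonneg_pos)
    have "cmod a * e < e * (cmod a + 1)" using e by (simp add: algebra_simps)
    thus ?thesis using pos_divide_less_eq[OF p, of "cmod a * e" e] by simp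
  qed
  finally have "L2_norm M (\<lambda>x. a * g x - a * v x) < e" .
  thus "\<exists>v\<in>lin_span f I. L2_norm M (\<lambda>x. a * g x - v x) < e"
    by (rule bexI[OF _ lin_span_cmult[OF v(1)]])
qed

lemma closed_span_sum:
  assumes f: "\<forall>n\<in>I. f n \<in> L2_space M"
    and "\<And>k. k \<in> F \<Longrightarrow> u k \<in> L2_closed_span M f I"
  shows "(\<lambda>x. \<Sum>k\<in>F. c k * u k x) \<in> L2_closed_span M f I"
  using assms(2)
proof (induction F rule: infinite_finite_induct)
  case (insert k F)
  thus ?case using closed_span_add[OF f closed_span_cmult[OF f, of "u k" "c k"]] by auto
qed (auto intro: closed_span_lin_span[OF f] lin_span_zero)

lemma closed_span_diff:
  assumes f: "\<forall>n\<in>I. f n \<in> L2_space M"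
    and "g \<in> L2_closed_span M f I" "h \<in> L2_closed_span M f I"
  shows "(\<lambda>x. g x - h x) \<in> L2_closed_span M f I"
  using closed_span_add[OF f assms(2) closed_span_cmult[OF f assms(3), of "-1"]] by simp

lemma closed_span_cong_AE:
  assumes f: "\<forall>n\<in>I. f n \<in> L2_space M" and h: "h \<in> L2_closed_span M f I"
    and g: "g \<in> borel_measurable M" and ae: "AE x in M. g x = h x"
  shows "g \<in> L2_closed_span M f I"
proof (rule closed_span_limit[OF f])
  have hL: "h \<in> L2_space M" using h by (simp add: L2_closed_span_iff)
  note hm [measurable] = L2_spaceD(1)[OF hL] g
  show "g \<in> L2_space M" using hL L2_norm_cong_AE(2)[OF g hm(1) ae] by simp
  have "L2_norm M (\<lambda>x. g x - h x) = L2_norm M (\<lambda>x. 0)"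
    by (rule L2_norm_cong_AE(1)) (use ae in auto)
  thus "\<exists>h\<in>L2_closed_span M f I. L2_norm M (\<lambda>x. g x - h x) < e" if "e > 0" for e
    using that h by (intro bexI[of _ h]) auto
qed

lemma L2_dominated_convergence:
  fixes u :: "nat \<Rightarrow> 'a \<Rightarrow> complex"
  assumes u: "\<And>k. u k \<in> borel_measurable M" and g: "g \<in> borel_measurable M" and w: "w \<in> L2_space M"
    and lim: "\<And>x. x \<in> space M \<Longrightarrow> (\<lambda>k. u k x) \<longlonglongrightarrow> g x"
    and bd: "\<And>k x. x \<in> space M \<Longrightarrow> cmod (u k x) \<le> cmod (w x)"
  shows "g \<in> L2_space M" "\<And>k. u k \<in> L2_space M" "(\<lambda>k. L2_norm M (\<lambda>x. g x - u k x)) \<longlonglongrightarrow> 0"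
proof -
  note [measurable] = u g L2_spaceD(1)[OF w]
  have gw: "cmod (g x) \<le> cmod (w x)" if "x \<in> space M" for x
    using tendsto_upperbound[OF tendsto_norm[OF lim[OF that]]] bd[OF that] by (auto simp: eventually_sequentially)
  have dom: "v \<in> L2_space M" if [measurable]: "v \<in> borel_measurable M"
    and "\<And>x. x \<in> space M \<Longrightarrow> cmod (v x) \<le> cmod (w x)" for v
  proof -
    have "integrable M (\<lambda>x. (cmod (v x))\<^sup>2)"
      by (rule Bochner_Integration.integrable_bound[OF L2_spaceD(2)[OF w]])
         (auto intro!: AE_I2 power_mono that(2))
    thus ?thesis by (simp add: L2_space_def)
  qed
  show "g \<in> L2_space M" "\<And>k. u k \<in> L2_space M" using gw bd by (auto intro: dom)
  have "(\<lambda>k. LINT x|M. (cmod (g x - u k x))\<^sup>2) \<longlonglongrightarrow> (LINT x|M. 0)"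
  proof (rule integral_dominated_convergence[where w="\<lambda>x. 4 * (cmod (w x))\<^sup>2"])
    show "integrable M (\<lambda>x. 4 * (cmod (w x))\<^sup>2)" using L2_spaceD(2)[OF w] by auto
    show "AE x in M. (\<lambda>k. (cmod (g x - u k x))\<^sup>2) \<longlonglongrightarrow> 0"
    proof (rule AE_I2)
      fix x assume x: "x \<in> space M"
      show "(\<lambda>k. (cmod (g x - u k x))\<^sup>2) \<longlonglongrightarrow> 0"
        using tendsto_power[OF tendsto_norm[OF tendsto_diff[OF tendsto_const lim[OF x], of "g x"]], of 2] by simp
    qed
    show "AE x in M. norm ((cmod (g x - u k x))\<^sup>2) \<le> 4 * (cmod (w x))\<^sup>2" for k
    proof (rule AE_I2)
      fix x assume x: "x \<in> space M"
      have "cmod (g x - u k x) \<le> 2 * cmod (w x)"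
        using norm_triangle_ineq4[of "g x" "u k x"] gw[OF x] bd[OF x, of k] by simp
      hence "(cmod (g x - u k x))\<^sup>2 \<le> (2 * cmod (w x))\<^sup>2" by (intro power_mono) auto
      thus "norm ((cmod (g x - u k x))\<^sup>2) \<le> 4 * (cmod (w x))\<^sup>2" by (simp add: power_mult_distrib)
    qed
  qed auto
  hence "(\<lambda>k. sqrt (LINT x|M. (cmod (g x - u k x))\<^sup>2)) \<longlonglongrightarrow> sqrt 0"
    by (intro tendsto_real_sqrt) simp
  thus "(\<lambda>k. L2_norm M (\<lambda>x. g x - u k x)) \<longlonglongrightarrow> 0" by (simp add: L2_norm_def)
qed

lemma closed_span_dominated_limit:
  fixes u :: "nat \<Rightarrow> 'a \<Rightarrow> complex"
  assumes f: "\<forall>n\<in>I. f n \<in> L2_space M"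
    and u: "\<And>k. u k \<in> L2_closed_span M f I"
    and g: "g \<in> borel_measurable M" and w: "w \<in> L2_space M"
    and lim: "\<And>x. x \<in> space M \<Longrightarrow> (\<lambda>k. u k x) \<longlonglongrightarrow> g x"
    and bd: "\<And>k x. x \<in> space M \<Longrightarrow> cmod (u k x) \<le> cmod (w x)"
  shows "g \<in> L2_closed_span M f I"
proof (rule closed_span_limit[OF f])
  have um: "u k \<in> borel_measurable M" for k using u[of k] by (simp add: L2_closed_span_iff L2_space_def)
  note L = L2_dominated_convergence[OF um g w lim bd]
  show "g \<in> L2_space M" by (rule L(1))
  fix e :: real assume "e > 0"
  hence "\<forall>\<^sub>F k in sequentially. L2_norm M (\<lambda>x. g x - u k x) < e"
    using order_tendstoD(2)[OF L(3)] by simp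
  then obtain k where "L2_norm M (\<lambda>x. g x - u k x) < e"
    by (auto simp: eventually_sequentially)
  thus "\<exists>h\<in>L2_closed_span M f I. L2_norm M (\<lambda>x. g x - h x) < e" using u by blast
qed

text \<open>The measurable sets whose indicators lie in the closed span form a Dynkin system, since this span is
linear and closed under dominated limits. So it suffices to check an intersection-stable generator;
simple functions do the rest.\<close>

lemma (in finite_measure) closed_span_eq_L2_spaceI:
  assumes f: "\<forall>n\<in>I. f n \<in> L2_space M"
    and G: "Int_stable G" "G \<subseteq> Pow (space M)" "sets M = sigma_sets (space M) G"
    and one: "(\<lambda>x. 1) \<in> L2_closed_span M f I"
    and ind: "\<And>A. A \<in> G \<Longrightarrow> indicator A \<in> L2_closed_span M f I"
  shows "L2_closed_span M f I = L2_space M"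
proof
  show "L2_closed_span M f I \<subseteq> L2_space M" by (auto simp: L2_closed_span_iff)
  have one2: "(\<lambda>x. 1) \<in> L2_space M" using one by (simp add: L2_closed_span_iff)
  have ind: "indicator A \<in> L2_closed_span M f I" if "A \<in> sets M" for A
  proof -
    have A: "A \<in> sigma_sets (space M) G" using that G(3) by (simp only:)
    from G(1,2) A show ?thesis
    proof (induction A rule: sigma_sets_induct_disjoint)
      case (basic A)
      thus ?case by (rule ind)
    next
      case empty
      thus ?case using closed_span_lin_span[OF f lin_span_zero] by (simp add: indicator_def[abs_def])
    next
      case (compl A)
      have *: "A \<subseteq> space M" using compl G(3) sets.sets_into_space by blast
      have "(\<lambda>x. 1 - indicator A x) \<in> L2_closed_span M f I"
        by (intro closed_span_diff[OF f] one compl) 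
      moreover have "(indicator (space M - A) :: _ \<Rightarrow> complex) x = 1 - indicator A x" if "x \<in> space M" for x
        using that by (auto simp: indicator_def)
      moreover have "A \<in> sets M" using compl(1) G(3) by (simp only:)
      hence "(indicator (space M - A) :: _ \<Rightarrow> complex) \<in> borel_measurable M" by measurable
      ultimately show ?case
        using closed_span_cong_AE[OF f, of "\<lambda>x. 1 - indicator A x" "indicator (space M - A)"]
        by (simp add: AE_I2)
    next
      case (union A)
      have m: "A i \<in> sets M" for i using union G(3) by auto
      show ?case
      proof (rule closed_span_dominated_limit[OF f, where w="\<lambda>_. 1" and
             u = "\<lambda>k x. \<Sum>i<k. 1 * indicator (A i) x"])
        show "(\<lambda>x. \<Sum>i<k. 1 * indicator (A i) x) \<in> L2_closed_span M f I" for k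
          by (intro closed_span_sum[OF f] union)
        have s: "(\<Sum>i<k. 1 * indicator (A i) x) = (indicator (\<Union>i<k. A i) x :: complex)" for k x
          using disjoint_family_on_mono[OF subset_UNIV union(1), of "{..<k}"]
          by (simp add: indicator_UN_disjoint)
        show "cmod (\<Sum>i<k. 1 * indicator (A i) x) \<le> cmod 1" for k x
          unfolding s by (auto simp: indicator_def)
        show "(\<lambda>k. \<Sum>i<k. 1 * indicator (A i) x :: complex) \<longlonglongrightarrow> indicator (\<Union> (range A)) x" for x
          unfolding s by (rule LIMSEQ_indicator_UN)
      qed (use one2 m in auto)
    qed
  qed
  show "L2_space M \<subseteq> L2_closed_span M f I"
  proof
    fix g assume g: "g \<in> L2_space M"
    obtain F where F: "\<And>i. simple_function M (F i)" "\<And>x. x \<in> space M \<Longrightarrow> (\<lambda>i. F i x) \<longlonglongrightarrow> g x"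
       "\<And>i x. x \<in> space M \<Longrightarrow> dist (F i x) 0 \<le> 2 * dist (g x) 0"
      using borel_measurable_implies_sequence_metric[OF L2_spaceD(1)[OF g], of 0] by blast
    have FL: "F i \<in> L2_closed_span M f I" for i
    proof -
      let ?u = "\<lambda>x. \<Sum>y\<in>F i ` space M. y * indicator (F i -` {y} \<inter> space M) x"
      have u: "?u \<in> L2_closed_span M f I"
        using F(1)[of i] by (intro closed_span_sum[OF f] ind) (auto simp: simple_function_def)
      have "F i x = ?u x" if "x \<in> space M" for x
      proof -
        have "?u x = (\<Sum>y\<in>{F i x}. y)"
          using that F(1)[of i] by (intro sum.mono_neutral_cong_right) (auto simp: simple_function_def indicator_def)
        thus ?thesis by simp
      qed
      hence ae: "AE x in M. F i x = ?u x" by (intro AE_I2)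
      show ?thesis
        by (rule closed_span_cong_AE[OF f u borel_measurable_simple_function[OF F(1)] ae])
    qed
    show "g \<in> L2_closed_span M f I"
      by (rule closed_span_dominated_limit[OF f FL L2_spaceD(1)[OF g] L2_space_cmult[OF g, of 2] F(2)])
         (use F(3) in \<open>simp_all add: norm_mult dist_norm\<close>)
  qed
qed

section \<open>Completeness and Riesz bases\<close>

text \<open>Increments that decay geometrically in \<open>L^2\<close> are summable in \<open>L^1\<close>, because the measure is finite. Hence
the sequence converges almost everywhere, and Fatou's lemma turns the pointwise limit into an \<open>L^2\<close>-limit.\<close>

lemma (in finite_measure) L2_Riesz_Fischer:
  fixes S :: "nat \<Rightarrow> 'a \<Rightarrow> complex"
  assumes S: "\<And>k. S k \<in> L2_space M"
    and step: "\<And>k. L2_norm M (\<lambda>x. S (Suc k) x - S k x) \<le> C * (1/2)^k"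
  shows "\<exists>g\<in>L2_space M. (\<lambda>k. L2_norm M (\<lambda>x. g x - S k x)) \<longlonglongrightarrow> 0"
proof -
  have [measurable]: "S k \<in> borel_measurable M" for k using S by (simp add: L2_space_def)
  have C: "0 \<le> C" using order_trans[OF L2_norm_nonneg step[of 0]] by simp
  define D where "D k x = S (Suc k) x - S k x" for k x
  have [measurable]: "D k \<in> borel_measurable M" for k unfolding D_def by measurable
  have D: "D k \<in> L2_space M" for k unfolding D_def[abs_def] by (intro L2_space_diff S)
  have one: "(\<lambda>x. 1) \<in> L2_space M" by (rule L2_space_bounded[where B=1]) auto
  define K where "K = L2_norm M (\<lambda>x. 1)"
  have K: "0 \<le> K" by (simp add: K_def)
  have "(\<integral>\<^sup>+x. ennreal (cmod (D k x)) \<partial>M) \<le> ennreal (C * K * (1/2)^k)" for k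
  proof -
    have "(\<integral>\<^sup>+x. ennreal (cmod (D k x) * cmod 1) \<partial>M) \<le> ennreal (L2_norm M (D k) * K)"
      unfolding K_def by (rule L2_norm_Cauchy_Schwarz[OF D one])
    also have "\<dots> \<le> ennreal (C * (1/2)^k * K)"
      using step[of k] K by (intro ennreal_leI mult_right_mono) (auto simp: D_def[abs_def])
    finally show ?thesis by (simp add: mult_ac)
  qed
  hence "(\<Sum>k. \<integral>\<^sup>+x. ennreal (cmod (D k x)) \<partial>M) \<le> (\<Sum>k. ennreal (C * K * (1/2)^k))"
    by (intro suminf_le) auto
  also have "\<dots> = ennreal (\<Sum>k. C * K * (1/2)^k)"
    using C K by (intro suminf_ennreal2 summable_mult summable_geometric) auto
  finally have "(\<integral>\<^sup>+x. (\<Sum>k. ennreal (cmod (D k x))) \<partial>M) \<noteq> \<infinity>"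
    by (subst nn_integral_suminf) (auto simp: top_unique)
  hence "AE x in M. (\<Sum>k. ennreal (cmod (D k x))) \<noteq> \<infinity>"
    by (intro nn_integral_PInf_AE) auto
  hence conv: "AE x in M. (\<lambda>k. S k x) \<longlonglongrightarrow> lim (\<lambda>k. S k x)"
  proof eventually_elim
    case (elim x)
    have "summable (\<lambda>k. cmod (D k x))"
      by (rule summable_suminf_not_top) (use elim in auto)
    hence "summable (\<lambda>k. D k x)" by (rule summable_norm_cancel)
    hence "convergent (\<lambda>n. \<Sum>k<n. D k x)" by (simp add: summable_iff_convergent)
    moreover have "(\<Sum>k<n. D k x) = S n x - S 0 x" for n
      unfolding D_def by (rule sum_lessThan_telescope)
    ultimately have "convergent (\<lambda>n. (S n x - S 0 x) + S 0 x)"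
      by (intro convergent_add convergent_const) simp
    thus ?case by (simp add: convergent_LIMSEQ_iff)
  qed
  define g where "g x = lim (\<lambda>k. S k x)" for x
  have [measurable]: "g \<in> borel_measurable M" unfolding g_def by measurable
  have tail: "L2_norm M (\<lambda>x. S (k + n) x - S k x) \<le> 2 * C * (1/2)^k" for k n
  proof -
    have "L2_norm M (\<lambda>x. S (k + n) x - S k x) \<le> 2 * C * (1/2)^k * (1 - (1/2)^n)"
    proof (induction n)
      case (Suc n)
      have "L2_norm M (\<lambda>x. S (k + Suc n) x - S k x)
          \<le> L2_norm M (\<lambda>x. S (Suc (k + n)) x - S (k + n) x) + L2_norm M (\<lambda>x. S (k + n) x - S k x)"
        using L2_norm_triangle_mid[OF S S S] by simp
      also have "\<dots> \<le> C * (1/2)^(k + n) + 2 * C * (1/2)^k * (1 - (1/2)^n)"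
        by (intro add_mono step Suc)
      also have "\<dots> = 2 * C * (1/2)^k * (1 - (1/2)^Suc n)"
        by (simp add: power_add algebra_simps)
      finally show ?case .
    qed simp
    also have "\<dots> \<le> 2 * C * (1/2)^k * 1"
      using C by (intro mult_left_mono) auto
    finally show ?thesis by simp
  qed
  have gS: "(\<lambda>x. g x - S k x) \<in> L2_space M \<and> L2_norm M (\<lambda>x. g x - S k x) \<le> 2 * C * (1/2)^k" for k
  proof -
    have "(\<integral>\<^sup>+x. ennreal ((cmod (g x - S k x))\<^sup>2) \<partial>M)
        = (\<integral>\<^sup>+x. liminf (\<lambda>n. ennreal ((cmod (S (k + n) x - S k x))\<^sup>2)) \<partial>M)"
    proof (rule nn_integral_cong_AE, use conv in eventually_elim)
      case (elim x)
      have "(\<lambda>n. S (n + k) x) \<longlonglongrightarrow> g x" unfolding g_def by (rule LIMSEQ_ignore_initial_segment[OF elim])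
      hence "(\<lambda>n. ennreal ((cmod (S (k + n) x - S k x))\<^sup>2)) \<longlonglongrightarrow> ennreal ((cmod (g x - S k x))\<^sup>2)"
        by (intro tendsto_ennrealI tendsto_power tendsto_norm tendsto_diff tendsto_const) (simp add: add.commute)
      from lim_imp_Liminf[OF _ this] show ?case by simp
    qed
    also have "\<dots> \<le> liminf (\<lambda>n. \<integral>\<^sup>+x. ennreal ((cmod (S (k + n) x - S k x))\<^sup>2) \<partial>M)"
      by (rule nn_integral_liminf) auto
    also have "\<dots> \<le> liminf (\<lambda>n. ennreal ((2 * C * (1/2)^k)\<^sup>2))"
    proof (rule Liminf_mono, rule always_eventually, rule allI)
      fix n
      show "(\<integral>\<^sup>+x. ennreal ((cmod (S (k + n) x - S k x))\<^sup>2) \<partial>M) \<le> ennreal ((2 * C * (1/2)^k)\<^sup>2)"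
        unfolding nn_integral_L2_norm[OF L2_space_diff[OF S S]]
        by (intro ennreal_leI power_mono tail) auto
    qed
    also have "\<dots> = ennreal ((2 * C * (1/2)^k)\<^sup>2)" by (simp add: Liminf_const)
    finally have *: "(\<integral>\<^sup>+x. ennreal ((cmod (g x - S k x))\<^sup>2) \<partial>M) \<le> ennreal ((2 * C * (1/2)^k)\<^sup>2)" .
    have "(\<lambda>x. g x - S k x) \<in> borel_measurable M" by measurable
    from L2_norm_leI[OF this *] C show ?thesis by simp
  qed
  show ?thesis
  proof (rule bexI[of _ g])
    show "g \<in> L2_space M" using L2_space_add[OF gS[of 0, THEN conjunct1] S[of 0]] by simp
    show "(\<lambda>k. L2_norm M (\<lambda>x. g x - S k x)) \<longlonglongrightarrow> 0"
    proof (rule tendsto_sandwich[OF _ _ tendsto_const])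
      show "(\<lambda>k. 2 * C * (1/2)^k) \<longlonglongrightarrow> 0"
        by (intro tendsto_mult_right_zero LIMSEQ_realpow_zero) auto
    qed (use gS in auto)
  qed
qed

definition Riesz_bounds ::
  "'a measure \<Rightarrow> ('i \<Rightarrow> 'a \<Rightarrow> complex) \<Rightarrow> 'i set \<Rightarrow> real \<Rightarrow> real \<Rightarrow> bool" where
  "Riesz_bounds M f I a b \<longleftrightarrow> (\<forall>F c. finite F \<longrightarrow> F \<subseteq> I \<longrightarrow>
     a * (\<Sum>n\<in>F. (cmod (c n))\<^sup>2) \<le> (L2_norm M (\<lambda>x. \<Sum>n\<in>F. c n * f n x))\<^sup>2 \<and>
     (L2_norm M (\<lambda>x. \<Sum>n\<in>F. c n * f n x))\<^sup>2 \<le> b * (\<Sum>n\<in>F. (cmod (c n))\<^sup>2))"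

text \<open>A Riesz basis described without infinite series. The two constants are independent of each other, which
spares comparing them in every construction.\<close>

definition finitary_Riesz_basis ::
  "'a measure \<Rightarrow> ('i \<Rightarrow> 'a \<Rightarrow> complex) \<Rightarrow> 'i set \<Rightarrow> bool" where
  "finitary_Riesz_basis M f I \<longleftrightarrow>
     (\<forall>n\<in>I. f n \<in> L2_space M) \<and> L2_closed_span M f I = L2_space M \<and>
     (\<exists>a b. 0 < a \<and> 0 < b \<and> Riesz_bounds M f I a b)"

lemma summable_on_small_tail:
  fixes p :: "'i \<Rightarrow> real"
  assumes p: "p summable_on I" and e: "0 < e"
  shows "\<exists>E. finite E \<and> E \<subseteq> I \<and> (\<forall>F. finite F \<longrightarrow> F \<subseteq> I \<longrightarrow> F \<inter> E = {} \<longrightarrow> sum p F < e)"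
proof -
  have "(sum p \<longlongrightarrow> infsum p I) (finite_subsets_at_top I)"
    using has_sum_infsum[OF p] by (simp add: has_sum_def)
  hence "\<forall>\<^sub>F F in finite_subsets_at_top I. dist (sum p F) (infsum p I) < e/2"
    using e by (intro tendstoD) auto
  then obtain E where E: "finite E" "E \<subseteq> I"
     and close: "\<And>F. finite F \<Longrightarrow> E \<subseteq> F \<Longrightarrow> F \<subseteq> I \<Longrightarrow> dist (sum p F) (infsum p I) < e/2"
    by (auto simp: eventually_finite_subsets_at_top)
  have "sum p F < e" if F: "finite F" "F \<subseteq> I" "F \<inter> E = {}" for F
  proof -
    have "sum p (F \<union> E) = sum p F + sum p E" using F E by (intro sum.union_disjoint) auto
    moreover have "dist (sum p (F \<union> E)) (infsum p I) < e/2" "dist (sum p E) (infsum p I) < e/2"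
      using close[of "F \<union> E"] close[of E] F E by auto
    ultimately show ?thesis unfolding dist_real_def by linarith
  qed
  thus ?thesis using E by blast
qed

text \<open>The upper bound makes the partial sums over finite sets a Cauchy net. A sequence of growing finite sets
that captures all but a geometrically small part of the coefficients brings this into the range of the
Riesz-Fischer theorem.\<close>

lemma (in finite_measure) finitary_Riesz_basis_series:
  assumes f: "\<forall>n\<in>I. f n \<in> L2_space M"
    and bnd: "\<And>F c. finite F \<Longrightarrow> F \<subseteq> I \<Longrightarrow>
       (L2_norm M (\<lambda>x. \<Sum>n\<in>F. c n * f n x))\<^sup>2 \<le> b * (\<Sum>n\<in>F. (cmod (c n))\<^sup>2)"
    and b: "0 < b"
    and c: "(\<lambda>n. (cmod (c n))\<^sup>2) summable_on I"
  shows "\<exists>g\<in>L2_space M. L2_has_sum M (\<lambda>n x. c n * f n x) g I"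
proof -
  define T where "T F x = (\<Sum>n\<in>F. c n * f n x)" for F x
  have T: "T F \<in> L2_space M" if "F \<subseteq> I" for F
    unfolding T_def[abs_def] using that f by (intro L2_space_sum L2_space_cmult) auto
  have "\<forall>k. \<exists>E. finite E \<and> E \<subseteq> I \<and> (\<forall>F. finite F \<longrightarrow> F \<subseteq> I \<longrightarrow> F \<inter> E = {} \<longrightarrow>
       (\<Sum>n\<in>F. (cmod (c n))\<^sup>2) < (1/4)^k)"
    by (intro allI summable_on_small_tail[OF c]) auto
  then obtain E where E: "\<And>k. finite (E k)" "\<And>k. E k \<subseteq> I"
    "\<And>k F. finite F \<Longrightarrow> F \<subseteq> I \<Longrightarrow> F \<inter> E k = {} \<Longrightarrow> (\<Sum>n\<in>F. (cmod (c n))\<^sup>2) < (1/4)^k"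
    by metis
  define G where "G k = (\<Union>i\<le>k. E i)" for k
  have G: "finite (G k)" "G k \<subseteq> I" "E k \<subseteq> G k" "G k \<subseteq> G (Suc k)" for k
    using E by (auto simp: G_def intro: le_SucI)
  have close: "L2_norm M (\<lambda>x. T F x - T (G k) x) \<le> sqrt b * (1/2)^k"
    if F: "finite F" "F \<subseteq> I" "G k \<subseteq> F" for F k
  proof -
    have "T F x - T (G k) x = (\<Sum>n\<in>F - G k. c n * f n x)" for x
      unfolding T_def using F by (simp add: sum_diff)
    hence "(L2_norm M (\<lambda>x. T F x - T (G k) x))\<^sup>2 \<le> b * (\<Sum>n\<in>F - G k. (cmod (c n))\<^sup>2)"
      using bnd[of "F - G k" c] F by auto
    also have "\<dots> \<le> b * (1/4)^k"
      using E(3)[of "F - G k" k] F G(3)[of k] b by (intro mult_left_mono) (auto intro: less_imp_le)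
    also have "\<dots> = (sqrt b * (1/2)^k)\<^sup>2"
    proof -
      have "((1/2::real)^k)\<^sup>2 = (1/4)^k" by (simp add: power2_eq_square flip: power_mult_distrib)
      thus ?thesis using b by (simp add: power_mult_distrib)
    qed
    finally show ?thesis by (rule power2_le_imp_le) (use b in auto)
  qed
  obtain g where g: "g \<in> L2_space M" "(\<lambda>k. L2_norm M (\<lambda>x. g x - T (G k) x)) \<longlonglongrightarrow> 0"
    using L2_Riesz_Fischer[of "\<lambda>k. T (G k)" "sqrt b", OF T[OF G(2)] close[OF G(1,2,4)]] by auto
  have "L2_has_sum M (\<lambda>n x. c n * f n x) g I"
    unfolding L2_has_sum_def
  proof (rule tendstoI)
    fix e :: real assume e: "0 < e"
    have "\<forall>\<^sub>F k in sequentially. L2_norm M (\<lambda>x. g x - T (G k) x) < e/2"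
      using order_tendstoD(2)[OF g(2), of "e/2"] e by simp
    moreover have "(\<lambda>k. sqrt b * (1/2)^k) \<longlonglongrightarrow> 0"
      by (intro tendsto_mult_right_zero LIMSEQ_realpow_zero) auto
    hence "\<forall>\<^sub>F k in sequentially. sqrt b * (1/2)^k < e/2"
      using order_tendstoD(2) e half_gt_zero by blast
    ultimately have "\<forall>\<^sub>F k in sequentially. L2_norm M (\<lambda>x. g x - T (G k) x) < e/2 \<and> sqrt b * (1/2)^k < e/2"
      by eventually_elim auto
    then obtain k where k: "L2_norm M (\<lambda>x. g x - T (G k) x) < e/2" "sqrt b * (1/2)^k < e/2"
      by (auto simp: eventually_sequentially)
    have "L2_norm M (\<lambda>x. g x - T F x) < e" if F: "finite F" "G k \<subseteq> F" "F \<subseteq> I" for F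
      using L2_norm_triangle_mid[OF g(1) T[OF G(2)[of k]] T[OF F(3)]] close[OF F(1,3,2)] k
        L2_norm_minus_commute[of M "T F" "T (G k)"] by linarith
    thus "\<forall>\<^sub>F F in finite_subsets_at_top I. dist (L2_norm M (\<lambda>x. g x - (\<Sum>n\<in>F. c n * f n x))) 0 < e"
      using G(1,2)[of k] unfolding eventually_finite_subsets_at_top T_def by (auto simp: dist_real_def)
  qed
  thus ?thesis using g by blast
qed

theorem (in finite_measure) L2_Riesz_basis_if_finitary:
  assumes "finitary_Riesz_basis M f I" "countable I"
  shows "L2_Riesz_basis M f I"
proof -
  obtain a b where f: "\<forall>n\<in>I. f n \<in> L2_space M" and span: "L2_closed_span M f I = L2_space M"
    and ab: "0 < a" "0 < b" "Riesz_bounds M f I a b"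
    using assms(1) by (auto simp: finitary_Riesz_basis_def)
  have lo: "a * (\<Sum>n\<in>F. (cmod (c n))\<^sup>2) \<le> (L2_norm M (\<lambda>x. \<Sum>n\<in>F. c n * f n x))\<^sup>2"
   and up: "(L2_norm M (\<lambda>x. \<Sum>n\<in>F. c n * f n x))\<^sup>2 \<le> b * (\<Sum>n\<in>F. (cmod (c n))\<^sup>2)"
    if "finite F" "F \<subseteq> I" for F c
    using ab(3) that by (auto simp: Riesz_bounds_def)
  define B where "B = max a b"
  have main: "\<exists>g\<in>L2_space M. L2_has_sum M (\<lambda>n x. c n * f n x) g I \<and>
       a * (\<Sum>\<^sub>\<infinity>n\<in>I. (cmod (c n))\<^sup>2) \<le> (L2_norm M g)\<^sup>2 \<and>
       (L2_norm M g)\<^sup>2 \<le> B * (\<Sum>\<^sub>\<infinity>n\<in>I. (cmod (c n))\<^sup>2)"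
    if c: "(\<lambda>n. (cmod (c n))\<^sup>2) summable_on I" for c
  proof -
    obtain g where g: "g \<in> L2_space M" "L2_has_sum M (\<lambda>n x. c n * f n x) g I"
      using finitary_Riesz_basis_series[OF f up ab(2) c] by blast
    let ?T = "\<lambda>F x. \<Sum>n\<in>F. c n * f n x" and ?F = "finite_subsets_at_top I"
    have ev: "\<forall>\<^sub>F F in ?F. finite F \<and> F \<subseteq> I"
      by (simp add: eventually_finite_subsets_at_top_weakI)
    have "((\<lambda>F. L2_norm M (?T F) - L2_norm M g) \<longlongrightarrow> 0) ?F"
    proof (rule Lim_null_comparison[OF _ g(2)[unfolded L2_has_sum_def]])
      show "\<forall>\<^sub>F F in ?F. norm (L2_norm M (?T F) - L2_norm M g) \<le> L2_norm M (\<lambda>x. g x - ?T F x)"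
        using ev
      proof eventually_elim
        case (elim F)
        have "?T F \<in> L2_space M" using elim f by (intro L2_space_sum L2_space_cmult) auto
        from L2_norm_diff_ge[OF g(1) this] show ?case by (simp add: abs_minus_commute)
      qed
    qed
    hence T: "((\<lambda>F. (L2_norm M (?T F))\<^sup>2) \<longlongrightarrow> (L2_norm M g)\<^sup>2) ?F"
      by (intro tendsto_power) (simp add: LIM_zero_iff)
    have S: "((\<lambda>F. \<Sum>n\<in>F. (cmod (c n))\<^sup>2) \<longlongrightarrow> (\<Sum>\<^sub>\<infinity>n\<in>I. (cmod (c n))\<^sup>2)) ?F"
      using has_sum_infsum[OF c] by (simp add: has_sum_def)
    have "a * (\<Sum>\<^sub>\<infinity>n\<in>I. (cmod (c n))\<^sup>2) \<le> (L2_norm M g)\<^sup>2"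
      by (rule tendsto_le[OF _ T tendsto_mult_left[OF S]])
         (auto intro: eventually_mono[OF ev] lo)
    moreover have "(L2_norm M g)\<^sup>2 \<le> b * (\<Sum>\<^sub>\<infinity>n\<in>I. (cmod (c n))\<^sup>2)"
      by (rule tendsto_le[OF _ tendsto_mult_left[OF S] T])
         (auto intro: eventually_mono[OF ev] up)
    moreover have "b * (\<Sum>\<^sub>\<infinity>n\<in>I. (cmod (c n))\<^sup>2) \<le> B * (\<Sum>\<^sub>\<infinity>n\<in>I. (cmod (c n))\<^sup>2)"
      by (intro mult_right_mono infsum_nonneg) (auto simp: B_def)
    ultimately show ?thesis using g by (intro bexI[of _ g]) auto
  qed
  show ?thesis unfolding L2_Riesz_basis_def
  proof (intro conjI)
    show "\<exists>\<alpha> \<beta>. 0 < \<alpha> \<and> \<alpha> \<le> \<beta> \<and>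
        (\<forall>c. (\<lambda>n. (cmod (c n))\<^sup>2) summable_on I \<longrightarrow>
           (\<exists>g\<in>L2_space M. L2_has_sum M (\<lambda>n x. c n * f n x) g I \<and>
              \<alpha> * (\<Sum>\<^sub>\<infinity>n\<in>I. (cmod (c n))\<^sup>2) \<le> (L2_norm M g)\<^sup>2 \<and>
              (L2_norm M g)\<^sup>2 \<le> \<beta> * (\<Sum>\<^sub>\<infinity>n\<in>I. (cmod (c n))\<^sup>2)))"
      using ab(1) main by (intro exI[of _ a] exI[of _ B] conjI) (auto simp: B_def)
  qed (use assms(2) f span in auto)
qed

section \<open>Transporting Riesz bases\<close>

text \<open>Only norms of finite sums and of their distances to a given function matter for being a Riesz basis, so any
correspondence between two spaces that rescales these by a constant carries one basis to the other.
The function \<open>g'\<close> may be chosen separately for each \<open>g\<close>, which covers pullbacks under substitutions as well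
as changes of representatives on null sets.\<close>

lemma finitary_Riesz_basis_transfer:
  assumes R: "finitary_Riesz_basis N \<phi> I"
    and f: "\<forall>n\<in>I. f n \<in> L2_space M" and K: "0 < K"
    and norm: "\<And>F c. finite F \<Longrightarrow> F \<subseteq> I \<Longrightarrow>
       L2_norm M (\<lambda>x. \<Sum>n\<in>F. c n * f n x) = K * L2_norm N (\<lambda>y. \<Sum>n\<in>F. c n * \<phi> n y)"
    and approx: "\<And>g. g \<in> L2_space M \<Longrightarrow> \<exists>g'\<in>L2_space N. \<forall>F c. finite F \<longrightarrow> F \<subseteq> I \<longrightarrow>
       L2_norm M (\<lambda>x. g x - (\<Sum>n\<in>F. c n * f n x)) = K * L2_norm N (\<lambda>y. g' y - (\<Sum>n\<in>F. c n * \<phi> n y))"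
  shows "finitary_Riesz_basis M f I"
proof -
  obtain a b where span: "L2_closed_span N \<phi> I = L2_space N"
    and ab: "0 < a" "0 < b" "Riesz_bounds N \<phi> I a b"
    using R by (auto simp: finitary_Riesz_basis_def)
  have "Riesz_bounds M f I (K\<^sup>2 * a) (K\<^sup>2 * b)"
    using ab(3) unfolding Riesz_bounds_def
    by (auto simp: norm power_mult_distrib mult.assoc intro!: mult_left_mono)
  moreover have "L2_space M \<subseteq> L2_closed_span M f I"
  proof
    fix g assume g: "g \<in> L2_space M"
    obtain g' where g': "g' \<in> L2_space N" "\<And>F c. finite F \<Longrightarrow> F \<subseteq> I \<Longrightarrow>
       L2_norm M (\<lambda>x. g x - (\<Sum>n\<in>F. c n * f n x)) = K * L2_norm N (\<lambda>y. g' y - (\<Sum>n\<in>F. c n * \<phi> n y))"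
      using approx[OF g] by auto
    have "\<exists>F c. finite F \<and> F \<subseteq> I \<and> L2_norm M (\<lambda>x. g x - (\<Sum>n\<in>F. c n * f n x)) < e" if e: "0 < e" for e
    proof -
      have "e / K > 0" using e K by simp
      moreover have "g' \<in> L2_closed_span N \<phi> I" using g'(1) span by simp
      ultimately obtain F c where F: "finite F" "F \<subseteq> I" "L2_norm N (\<lambda>y. g' y - (\<Sum>n\<in>F. c n * \<phi> n y)) < e / K"
        unfolding L2_closed_span_def by blast
      thus ?thesis using g'(2)[OF F(1,2), of c] K by (auto simp: field_simps intro!: exI[of _ F] exI[of _ c])
    qed
    thus "g \<in> L2_closed_span M f I" using g by (auto simp: L2_closed_span_def)
  qed
  moreover have "L2_closed_span M f I \<subseteq> L2_space M" by (auto simp: L2_closed_span_def)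
  moreover have "0 < K\<^sup>2 * a" "0 < K\<^sup>2 * b" using ab K by auto
  ultimately show ?thesis unfolding finitary_Riesz_basis_def
    using f by blast
qed

lemma finitary_Riesz_basis_cong:
  assumes R: "finitary_Riesz_basis M \<phi> I"
    and eq: "\<And>n x. n \<in> I \<Longrightarrow> x \<in> space M \<Longrightarrow> f n x = \<phi> n x"
  shows "finitary_Riesz_basis M f I"
proof (rule finitary_Riesz_basis_transfer[OF R, where K=1])
  show "\<forall>n\<in>I. f n \<in> L2_space M"
    using R eq L2_space_cong[of M] unfolding finitary_Riesz_basis_def by blast
  show "L2_norm M (\<lambda>x. \<Sum>n\<in>F. c n * f n x) = 1 * L2_norm M (\<lambda>y. \<Sum>n\<in>F. c n * \<phi> n y)"
    if "finite F" "F \<subseteq> I" for F c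
    using that eq by (auto intro!: L2_norm_cong sum.cong)
  show "\<exists>g'\<in>L2_space M. \<forall>F c. finite F \<longrightarrow> F \<subseteq> I \<longrightarrow>
       L2_norm M (\<lambda>x. g x - (\<Sum>n\<in>F. c n * f n x)) = 1 * L2_norm M (\<lambda>y. g' y - (\<Sum>n\<in>F. c n * \<phi> n y))"
    if "g \<in> L2_space M" for g
  proof (intro bexI[of _ g] allI impI that)
    fix F c assume "finite F" "F \<subseteq> I"
    thus "L2_norm M (\<lambda>x. g x - (\<Sum>n\<in>F. c n * f n x)) = 1 * L2_norm M (\<lambda>y. g y - (\<Sum>n\<in>F. c n * \<phi> n y))"
      using eq by (auto intro!: L2_norm_cong arg_cong2[where f="(-)"] sum.cong simp: subset_iff)
  qed
qed auto

lemma finitary_Riesz_basis_unimodular: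
  assumes R: "finitary_Riesz_basis M \<phi> I"
    and w: "w \<in> borel_measurable M" "\<And>x. cmod (w x) = 1"
  shows "finitary_Riesz_basis M (\<lambda>n x. w x * \<phi> n x) I"
proof (rule finitary_Riesz_basis_transfer[OF R, where K=1])
  have ww: "w x * cnj (w x) = 1" for x
    using w(2)[of x] by (simp flip: complex_norm_square)
  have c: "(\<lambda>x. cnj (w x)) \<in> borel_measurable M"
    using borel_measurable_continuous_onI[of cnj] w(1) measurable_compose[OF w(1), of cnj borel]
    by (simp add: continuous_on_cnj)
  show "\<forall>n\<in>I. (\<lambda>x. w x * \<phi> n x) \<in> L2_space M"
    using R w by (auto simp: finitary_Riesz_basis_def intro!: L2_space_mult_bounded(1)[where B=1])
  have s: "(\<Sum>n\<in>F. d n * (w x * \<phi> n x)) = w x * (\<Sum>n\<in>F. d n * \<phi> n x)" for F d x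
    by (simp add: sum_distrib_left mult_ac)
  show "L2_norm M (\<lambda>x. \<Sum>n\<in>F. d n * (w x * \<phi> n x)) = 1 * L2_norm M (\<lambda>y. \<Sum>n\<in>F. d n * \<phi> n y)" for F d
    unfolding s by (simp add: L2_norm_unimodular w)
  show "\<exists>g'\<in>L2_space M. \<forall>F d. finite F \<longrightarrow> F \<subseteq> I \<longrightarrow>
       L2_norm M (\<lambda>x. g x - (\<Sum>n\<in>F. d n * (w x * \<phi> n x))) = 1 * L2_norm M (\<lambda>y. g' y - (\<Sum>n\<in>F. d n * \<phi> n y))"
    if g: "g \<in> L2_space M" for g
  proof (intro bexI[of _ "\<lambda>x. cnj (w x) * g x"] allI impI)
    fix F d
    have "g x - w x * (\<Sum>n\<in>F. d n * \<phi> n x) = w x * (cnj (w x) * g x - (\<Sum>n\<in>F. d n * \<phi> n x))" for x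
      by (simp add: right_diff_distrib mult.assoc[symmetric] ww)
    thus "L2_norm M (\<lambda>x. g x - (\<Sum>n\<in>F. d n * (w x * \<phi> n x))) =
       1 * L2_norm M (\<lambda>y. cnj (w y) * g y - (\<Sum>n\<in>F. d n * \<phi> n y))"
      unfolding s by (simp add: L2_norm_unimodular w)
  next
    show "(\<lambda>x. cnj (w x) * g x) \<in> L2_space M"
      by (rule L2_space_mult_bounded(1)[OF g c, where B=1]) (simp add: w)
  qed
qed auto

lemma finitary_Riesz_basis_substitution:
  assumes R: "finitary_Riesz_basis N (\<lambda>n y. f n (T y)) I" and K: "0 < K"
    and f: "\<And>n. n \<in> I \<Longrightarrow> f n \<in> borel_measurable M"
    and norm: "\<And>g. g \<in> borel_measurable M \<Longrightarrow> L2_norm M g = K * L2_norm N (\<lambda>y. g (T y))"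
    and L2: "\<And>g. g \<in> borel_measurable M \<Longrightarrow> g \<in> L2_space M \<longleftrightarrow> (\<lambda>y. g (T y)) \<in> L2_space N"
  shows "finitary_Riesz_basis M f I"
proof (rule finitary_Riesz_basis_transfer[OF R _ K])
  have fs: "(\<lambda>x. \<Sum>n\<in>F. c n * f n x) \<in> borel_measurable M" if "F \<subseteq> I" for F c
    using f that by (auto intro!: borel_measurable_sum borel_measurable_times)
  show "\<forall>n\<in>I. f n \<in> L2_space M"
    using R f by (auto simp: finitary_Riesz_basis_def L2)
  show "L2_norm M (\<lambda>x. \<Sum>n\<in>F. c n * f n x) = K * L2_norm N (\<lambda>y. \<Sum>n\<in>F. c n * f n (T y))"
    if "F \<subseteq> I" for F c by (rule norm[OF fs[OF that]])
  fix g assume g: "g \<in> L2_space M"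
  show "\<exists>g'\<in>L2_space N. \<forall>F c. finite F \<longrightarrow> F \<subseteq> I \<longrightarrow>
       L2_norm M (\<lambda>x. g x - (\<Sum>n\<in>F. c n * f n x)) = K * L2_norm N (\<lambda>y. g' y - (\<Sum>n\<in>F. c n * f n (T y)))"
    using norm[OF borel_measurable_diff[OF L2_spaceD(1)[OF g] fs]] g L2[OF L2_spaceD(1)[OF g]]
    by (intro bexI[of _ "\<lambda>y. g (T y)"]) auto
qed

lemma finitary_Riesz_basis_distr:
  assumes R: "finitary_Riesz_basis N (\<lambda>n y. f n (T y)) I"
    and T [measurable]: "T \<in> measurable N M" and f: "\<And>n. n \<in> I \<Longrightarrow> f n \<in> borel_measurable M"
  shows "finitary_Riesz_basis (distr N M T) f I"
proof (rule finitary_Riesz_basis_substitution[where T=T and K=1, OF R zero_less_one])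
  fix g :: "_ \<Rightarrow> complex" assume "g \<in> borel_measurable (distr N M T)"
  hence [measurable]: "g \<in> borel_measurable M" by simp
  show "L2_norm (distr N M T) g = 1 * L2_norm N (\<lambda>y. g (T y))"
    unfolding L2_norm_def by (subst integral_distr[OF T]) auto
  show "g \<in> L2_space (distr N M T) \<longleftrightarrow> (\<lambda>y. g (T y)) \<in> L2_space N"
    unfolding L2_space_iff by (subst nn_integral_distr[OF T]) auto
qed (use f in auto)

lemma lin_span_image:
  assumes "inj_on h J"
  shows "lin_span f (h ` J) = lin_span (\<lambda>j. f (h j)) J"
proof
  show "lin_span f (h ` J) \<subseteq> lin_span (\<lambda>j. f (h j)) J"
  proof
    fix u assume "u \<in> lin_span f (h ` J)"
    then obtain F c where F: "finite F" "F \<subseteq> h ` J" "u = (\<lambda>x. \<Sum>n\<in>F. c n * f n x)"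
      by (auto simp: lin_span_def)
    then obtain G where G: "G \<subseteq> J" "finite G" "F = h ` G" using finite_subset_image[OF F(1,2)] by auto
    have "u = (\<lambda>x. \<Sum>j\<in>G. c (h j) * f (h j) x)"
      unfolding F(3) G(3) using inj_on_subset[OF assms G(1)] by (subst sum.reindex) auto
    thus "u \<in> lin_span (\<lambda>j. f (h j)) J" using lin_spanI[OF G(2,1)] by auto
  qed
  show "lin_span (\<lambda>j. f (h j)) J \<subseteq> lin_span f (h ` J)"
  proof
    fix u assume "u \<in> lin_span (\<lambda>j. f (h j)) J"
    then obtain G c where G: "finite G" "G \<subseteq> J" "u = (\<lambda>x. \<Sum>j\<in>G. c j * f (h j) x)"
      by (auto simp: lin_span_def)
    have "u = (\<lambda>x. \<Sum>n\<in>h ` G. c (inv_into J h n) * f n x)"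
      unfolding G(3) using inj_on_subset[OF assms G(2)] G(2) assms
      by (subst sum.reindex) (auto intro!: sum.cong ext simp: inv_into_f_f subset_eq)
    moreover have "finite (h ` G)" "h ` G \<subseteq> h ` J" using G by auto
    ultimately show "u \<in> lin_span f (h ` J)" by (simp only: lin_spanI)
  qed
qed

lemma finitary_Riesz_basis_image:
  assumes inj: "inj_on h J" and R: "finitary_Riesz_basis M (\<lambda>j. f (h j)) J"
  shows "finitary_Riesz_basis M f (h ` J)"
proof -
  obtain a b where ab: "0 < a" "0 < b" "Riesz_bounds M (\<lambda>j. f (h j)) J a b"
    using R by (auto simp: finitary_Riesz_basis_def)
  have "Riesz_bounds M f (h ` J) a b"
    unfolding Riesz_bounds_def
  proof (intro allI impI)
    fix F c assume F: "finite F" "F \<subseteq> h ` J"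
    then obtain G where G: "G \<subseteq> J" "finite G" "F = h ` G" using finite_subset_image[OF F(1,2)] by auto
    have i: "inj_on h G" using inj_on_subset[OF inj G(1)] .
    show "a * (\<Sum>n\<in>F. (cmod (c n))\<^sup>2) \<le> (L2_norm M (\<lambda>x. \<Sum>n\<in>F. c n * f n x))\<^sup>2 \<and>
     (L2_norm M (\<lambda>x. \<Sum>n\<in>F. c n * f n x))\<^sup>2 \<le> b * (\<Sum>n\<in>F. (cmod (c n))\<^sup>2)"
      using ab(3)[unfolded Riesz_bounds_def, rule_format, OF G(2,1), of "\<lambda>j. c (h j)"]
      by (simp add: G(3) sum.reindex[OF i])
  qed
  moreover have "L2_closed_span M f (h ` J) = L2_closed_span M (\<lambda>j. f (h j)) J"
    by (auto simp: L2_closed_span_iff lin_span_image[OF inj])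
  ultimately show ?thesis using R ab unfolding finitary_Riesz_basis_def by auto
qed

section \<open>Fourier series on an interval\<close>

text \<open>Lebesgue measure on \<open>[0,h]\<close>, but as a measure on the whole line: measurability is then plain Borel
measurability for all \<open>h\<close>, and functions may be shifted and restricted to other intervals freely.\<close>

definition icc :: "real \<Rightarrow> real measure" where
  "icc h = density lborel (indicator {0..h})"

text \<open>The one-dimensional character \<open>e(\<gamma> x)\<close>. Frequencies are real because the Fourier basis of \<open>[0,h]\<close> has the
frequencies \<open>n / h\<close>.\<close>

definition chi :: "real \<Rightarrow> real \<Rightarrow> complex" where
  "chi \<gamma> x = cis (2 * pi * \<gamma> * x)"

abbreviation int_chi :: "int \<Rightarrow> real \<Rightarrow> complex" where
  "int_chi n \<equiv> chi (of_int n)"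

abbreviation multiples :: "nat \<Rightarrow> int set" where
  "multiples N \<equiv> range ((*) (int N))"

lemma sets_icc [measurable_cong, simp]: "sets (icc h) = sets borel"
  and space_icc [simp]: "space (icc h) = UNIV"
  by (simp_all add: icc_def)

lemma borel_measurable_icc [simp]: "borel_measurable (icc h) = borel_measurable borel"
  by (rule measurable_cong_sets) auto

lemma nn_integral_icc:
  "f \<in> borel_measurable borel \<Longrightarrow> (\<integral>\<^sup>+x. f x \<partial>icc h) = (\<integral>\<^sup>+x. indicator {0..h} x * f x \<partial>lborel)"
  unfolding icc_def by (rule nn_integral_density) auto

lemma finite_measure_icc: "finite_measure (icc h)"
proof (rule finite_measureI)
  have "emeasure (icc h) (space (icc h)) = (\<integral>\<^sup>+x. 1 \<partial>icc h)" by simp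
  also have "\<dots> = emeasure lborel {0..h}" by (subst nn_integral_icc) auto
  also have "\<dots> \<noteq> \<infinity>" by (cases "0 \<le> h") auto
  finally show "emeasure (icc h) (space (icc h)) \<noteq> \<infinity>" .
qed

lemma integral_icc:
  fixes f :: "real \<Rightarrow> 'b::{banach, second_countable_topology}"
  assumes "f \<in> borel_measurable borel"
  shows "(LINT x|icc h. f x) = (LINT x|lborel. indicator {0..h} x *\<^sub>R f x)"
proof -
  have *: "icc h = density lborel (\<lambda>x. ennreal (indicator {0..h} x))"
    unfolding icc_def by (intro arg_cong[where f="density lborel"] ext) (simp add: indicator_def)
  show ?thesis unfolding * by (rule integral_density) (use assms in auto)
qed

lemma AE_icc: "(AE x in icc h. P x) \<longleftrightarrow> (AE x in lborel. x \<in> {0..h} \<longrightarrow> P x)"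
proof -
  have "(AE x in icc h. P x) \<longleftrightarrow> (AE x in lborel. 0 < (indicator {0..h} x :: ennreal) \<longrightarrow> P x)"
    unfolding icc_def by (rule AE_density) auto
  also have "\<dots> \<longleftrightarrow> (AE x in lborel. x \<in> {0..h} \<longrightarrow> P x)"
    by (intro AE_cong) (auto simp: indicator_def)
  finally show ?thesis .
qed

lemma continuous_on_chi [continuous_intros]: "continuous_on A (chi \<gamma>)"
  unfolding chi_def[abs_def] by (intro continuous_intros)

lemma chi_measurable [measurable]: "chi \<gamma> \<in> borel_measurable borel"
  by (intro borel_measurable_continuous_onI continuous_intros)

lemma norm_chi [simp]: "cmod (chi \<gamma> x) = 1"
  by (simp add: chi_def)

lemma chi_add: "chi (\<gamma> + \<delta>) x = chi \<gamma> x * chi \<delta> x"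
  by (simp add: chi_def cis_mult algebra_simps)

lemma chi_add_arg: "chi \<gamma> (x + y) = chi \<gamma> x * chi \<gamma> y"
  by (simp add: chi_def cis_mult algebra_simps)

lemma cnj_chi: "cnj (chi \<gamma> x) = chi (- \<gamma>) x"
  by (simp add: chi_def cis_cnj)

lemma chi_0 [simp]: "chi 0 x = 1" "chi \<gamma> 0 = 1"
  by (simp_all add: chi_def)

lemma chi_int [simp]: "int_chi n 1 = 1"
  by (simp add: chi_def cis_multiple_2pi)

lemma L2_chi [simp]: "chi \<gamma> \<in> L2_space (icc h)"
  by (rule finite_measure.L2_space_bounded[OF finite_measure_icc, where B=1]) auto

lemma has_vector_derivative_chi:
  "(chi \<gamma> has_vector_derivative (2 * pi * \<gamma> * \<i>) * chi \<gamma> x) (at x within A)"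
proof -
  have "((\<lambda>x. exp ((2 * pi * \<gamma> * \<i>) * complex_of_real x)) has_vector_derivative
     ((2 * pi * \<gamma> * \<i>) * exp ((2 * pi * \<gamma> * \<i>) * complex_of_real x))) (at x within A)"
    by (auto intro!: derivative_eq_intros has_vector_derivative_real_field)
  moreover have "(\<lambda>x. exp ((2 * pi * \<gamma> * \<i>) * complex_of_real x)) = chi \<gamma>"
    by (auto simp: chi_def cis_conv_exp mult_ac)
  ultimately show ?thesis by (metis (no_types, lifting))
qed

lemma (in finite_measure) integrable_bounded_complex:
  fixes f :: "'a \<Rightarrow> complex"
  shows "f \<in> borel_measurable M \<Longrightarrow> (\<And>x. cmod (f x) \<le> B) \<Longrightarrow> integrable M f"
  by (rule integrable_const_bound[where B=B]) auto

text \<open>With \<open>s = 0\<close> this is Parseval's identity for finite sums, and with the Fourier coefficients of \<open>s\<close> in place of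
\<open>c\<close> it is Bessel's identity.\<close>

lemma (in finite_measure) L2_norm_minus_orthonormal:
  fixes e :: "'i \<Rightarrow> 'a \<Rightarrow> complex"
  assumes s: "s \<in> borel_measurable M" "\<And>x. cmod (s x) \<le> B"
    and e: "\<And>n. n \<in> F \<Longrightarrow> e n \<in> borel_measurable M" "\<And>n x. n \<in> F \<Longrightarrow> cmod (e n x) \<le> 1"
    and F: "finite F"
    and orth: "\<And>n m. n \<in> F \<Longrightarrow> m \<in> F \<Longrightarrow> (LINT x|M. e n x * cnj (e m x)) = (if n = m then 1 else 0)"
  shows "complex_of_real ((L2_norm M (\<lambda>x. s x - (\<Sum>n\<in>F. c n * e n x)))\<^sup>2) =
     (LINT x|M. s x * cnj (s x)) - (\<Sum>n\<in>F. cnj (c n) * (LINT x|M. s x * cnj (e n x)))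
      - (\<Sum>n\<in>F. c n * cnj (LINT x|M. s x * cnj (e n x))) + (\<Sum>n\<in>F. c n * cnj (c n))"
proof -
  note [measurable] = s(1) e(1)
  have B: "0 \<le> B" using s(2)[of undefined] norm_ge_zero order_trans by blast
  have cm: "(\<lambda>x. cnj (u x)) \<in> borel_measurable M" if "u \<in> borel_measurable M" for u :: "'a \<Rightarrow> complex"
    using measurable_compose[OF that, of cnj borel] borel_measurable_continuous_onI[of cnj]
    by (simp add: continuous_on_cnj)
  have i1: "integrable M (\<lambda>x. s x * cnj (s x))"
    by (rule integrable_bounded_complex[where B="B*B"]) (auto simp: norm_mult B s intro!: cm mult_mono borel_measurable_times)
  have i2: "integrable M (\<lambda>x. s x * cnj (e n x))" if "n \<in> F" for n
    by (rule integrable_bounded_complex[where B="B*1"])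
       (auto simp: norm_mult B that simp del: mult_1_right intro!: cm mult_mono s e borel_measurable_times)
  have i3: "integrable M (\<lambda>x. cnj (s x * cnj (e n x)))" if "n \<in> F" for n
    using i2[OF that] by (simp only: integrable_cnj)
  have i4: "integrable M (\<lambda>x. e n x * cnj (e m x))" if "n \<in> F" "m \<in> F" for n m
    by (rule integrable_bounded_complex[where B=1])
       (auto simp: norm_mult that intro!: cm mult_le_one e borel_measurable_times)
  have "complex_of_real ((L2_norm M (\<lambda>x. s x - (\<Sum>n\<in>F. c n * e n x)))\<^sup>2)
     = (LINT x|M. complex_of_real ((cmod (s x - (\<Sum>n\<in>F. c n * e n x)))\<^sup>2))"
    unfolding L2_norm_power2 by (rule integral_complex_of_real[symmetric])
  also have "\<dots> = (LINT x|M. s x * cnj (s x) - (\<Sum>n\<in>F. cnj (c n) * (s x * cnj (e n x)))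
      - (\<Sum>n\<in>F. c n * cnj (s x * cnj (e n x))) + (\<Sum>n\<in>F. \<Sum>m\<in>F. (c n * cnj (c m)) * (e n x * cnj (e m x))))"
  proof (intro Bochner_Integration.integral_cong refl)
    fix x
    have "complex_of_real ((cmod (s x - (\<Sum>n\<in>F. c n * e n x)))\<^sup>2) =
       (s x - (\<Sum>n\<in>F. c n * e n x)) * (cnj (s x) - (\<Sum>n\<in>F. cnj (c n) * cnj (e n x)))"
      by (simp only: complex_norm_square complex_cnj_diff cnj_sum complex_cnj_mult)
    also have "\<dots> = s x * cnj (s x) - s x * (\<Sum>n\<in>F. cnj (c n) * cnj (e n x)) - (\<Sum>n\<in>F. c n * e n x) * cnj (s x)
       + (\<Sum>n\<in>F. c n * e n x) * (\<Sum>m\<in>F. cnj (c m) * cnj (e m x))"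
      by (simp add: algebra_simps)
    also have "s x * (\<Sum>n\<in>F. cnj (c n) * cnj (e n x)) = (\<Sum>n\<in>F. cnj (c n) * (s x * cnj (e n x)))"
      by (simp add: sum_distrib_left mult_ac)
    also have "(\<Sum>n\<in>F. c n * e n x) * cnj (s x) = (\<Sum>n\<in>F. c n * cnj (s x * cnj (e n x)))"
      by (subst sum_distrib_right) (simp add: mult_ac)
    also have "(\<Sum>n\<in>F. c n * e n x) * (\<Sum>m\<in>F. cnj (c m) * cnj (e m x)) =
       (\<Sum>n\<in>F. \<Sum>m\<in>F. (c n * cnj (c m)) * (e n x * cnj (e m x)))"
      by (simp add: sum_product mult_ac)
    finally show "complex_of_real ((cmod (s x - (\<Sum>n\<in>F. c n * e n x)))\<^sup>2) = 
       s x * cnj (s x) - (\<Sum>n\<in>F. cnj (c n) * (s x * cnj (e n x)))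
      - (\<Sum>n\<in>F. c n * cnj (s x * cnj (e n x))) + (\<Sum>n\<in>F. \<Sum>m\<in>F. (c n * cnj (c m)) * (e n x * cnj (e m x)))" .
  qed
  also have "\<dots> = (LINT x|M. s x * cnj (s x)) - (\<Sum>n\<in>F. cnj (c n) * (LINT x|M. s x * cnj (e n x)))
      - (\<Sum>n\<in>F. c n * (LINT x|M. cnj (s x * cnj (e n x))))
      + (\<Sum>n\<in>F. \<Sum>m\<in>F. (c n * cnj (c m)) * (LINT x|M. e n x * cnj (e m x)))"
  proof -
    have j1: "has_bochner_integral M (\<lambda>x. \<Sum>n\<in>F. cnj (c n) * (s x * cnj (e n x)))
        (\<Sum>n\<in>F. cnj (c n) * (LINT x|M. s x * cnj (e n x)))"
      by (intro has_bochner_integral_sum has_bochner_integral_mult_right has_bochner_integral_integrable i2)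
    have j2: "has_bochner_integral M (\<lambda>x. \<Sum>n\<in>F. c n * cnj (s x * cnj (e n x)))
        (\<Sum>n\<in>F. c n * (LINT x|M. cnj (s x * cnj (e n x))))"
      by (intro has_bochner_integral_sum has_bochner_integral_mult_right has_bochner_integral_integrable i3)
    have j3: "has_bochner_integral M (\<lambda>x. \<Sum>n\<in>F. \<Sum>m\<in>F. (c n * cnj (c m)) * (e n x * cnj (e m x)))
        (\<Sum>n\<in>F. \<Sum>m\<in>F. (c n * cnj (c m)) * (LINT x|M. e n x * cnj (e m x)))"
      by (intro has_bochner_integral_sum has_bochner_integral_mult_right has_bochner_integral_integrable i4)
    show ?thesis
      by (rule has_bochner_integral_integral_eq)
         (intro has_bochner_integral_add has_bochner_integral_diff j1 j2 j3 has_bochner_integral_integrable i1)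
  qed
  also have "(\<Sum>n\<in>F. \<Sum>m\<in>F. (c n * cnj (c m)) * (LINT x|M. e n x * cnj (e m x)))
     = (\<Sum>n\<in>F. \<Sum>m\<in>F. if n = m then c n * cnj (c m) else 0)"
    by (intro sum.cong refl) (simp add: orth)
  also have "\<dots> = (\<Sum>n\<in>F. c n * cnj (c n))"
    using F by (intro sum.cong refl) (simp add: sum.delta')
  also have "(\<Sum>n\<in>F. c n * (LINT x|M. cnj (s x * cnj (e n x)))) = (\<Sum>n\<in>F. c n * cnj (LINT x|M. s x * cnj (e n x)))"
    by (intro sum.cong refl arg_cong2[where f="(*)"] Bochner_Integration.integral_cnj)
  finally show ?thesis .
qed

lemma integral_chi_Icc:
  assumes "0 \<le> a" "\<gamma> \<noteq> 0"
  shows "(LINT x|lborel. indicator {0..a} x *\<^sub>R chi \<gamma> x) = (chi \<gamma> a - 1) / (2 * pi * \<gamma> * \<i>)"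
proof -
  let ?w = "2 * pi * \<gamma> * \<i> :: complex"
  have w: "?w \<noteq> 0" using assms by simp
  have "((\<lambda>x. chi \<gamma> x / ?w) has_vector_derivative chi \<gamma> x) (at x within {0..a})" for x
    using bounded_linear.has_vector_derivative[OF bounded_linear_mult_left[of "1 / ?w"] has_vector_derivative_chi[of \<gamma> x "{0..a}"]] w
    by simp
  from integral_FTC_Icc[OF assms(1) this continuous_on_chi]
  show ?thesis by (simp add: diff_divide_distrib)
qed

lemma integral_linear_chi_Icc:
  assumes "\<gamma> \<noteq> 0" "chi \<gamma> 1 = 1"
  shows "(LINT x|lborel. indicator {0..1} x *\<^sub>R (of_real (x - a) * chi \<gamma> x)) = 1 / (2 * pi * \<gamma> * \<i>)"
proof -
  let ?w = "2 * pi * \<gamma> * \<i> :: complex"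
  have w: "?w \<noteq> 0" using assms by simp
  let ?F = "\<lambda>x. of_real (x - a) * (chi \<gamma> x / ?w) - chi \<gamma> x / ?w / ?w"
  have d: "((\<lambda>x. chi \<gamma> x / ?w) has_vector_derivative chi \<gamma> x) (at x within {0..1})" for x
    using bounded_linear.has_vector_derivative[OF bounded_linear_mult_left[of "1 / ?w"] has_vector_derivative_chi[of \<gamma> x "{0..1}"]] w
    by simp
  have d2: "((\<lambda>x. chi \<gamma> x / ?w / ?w) has_vector_derivative chi \<gamma> x / ?w) (at x within {0..1})" for x
    using bounded_linear.has_vector_derivative[OF bounded_linear_mult_left[of "1 / ?w"] d[of x]] by simp
  have "(?F has_vector_derivative of_real (x - a) * chi \<gamma> x) (at x within {0..1})" for x
  proof -
    have "((\<lambda>x. complex_of_real (x - a)) has_vector_derivative 1) (at x within {0..1})"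
      by (auto intro!: derivative_eq_intros has_vector_derivative_of_real[where D=1, simplified]
           simp: has_real_derivative_iff_has_vector_derivative[symmetric])
    from has_vector_derivative_diff[OF has_vector_derivative_mult[OF this d] d2]
    show ?thesis by simp
  qed
  moreover have "continuous_on {0..1} (\<lambda>x. of_real (x - a) * chi \<gamma> x)" by (intro continuous_intros)
  ultimately have "(LINT x|lborel. indicator {0..1} x *\<^sub>R (of_real (x - a) * chi \<gamma> x)) = ?F 1 - ?F 0"
    by (rule integral_FTC_Icc[OF zero_le_one])
  also have "\<dots> = 1 / ?w" using assms by (simp add: diff_divide_distrib)
  finally show ?thesis .
qed

lemma chi_orthonormal:
  fixes n m :: int
  shows "(LINT x|icc 1. chi n x * cnj (chi m x)) = (if n = m then 1 else 0)"
proof -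
  have *: "chi n x * cnj (chi m x) = chi (of_int (n - m)) x" for x
    by (simp add: cnj_chi flip: chi_add)
  have "(LINT x|icc 1. chi n x * cnj (chi m x)) = (LINT x|lborel. indicator {0..1} x *\<^sub>R chi (of_int (n - m)) x)"
    unfolding * by (rule integral_icc) simp
  also have "\<dots> = (if n = m then 1 else 0)"
    using integral_chi_Icc[of 1 "of_int (n - m)"] chi_int[of "n - m"]
    by (auto simp del: of_int_diff chi_int)
  finally show ?thesis .
qed

lemma chi_Parseval:
  fixes c :: "int \<Rightarrow> complex"
  assumes "finite F"
  shows "(L2_norm (icc 1) (\<lambda>x. \<Sum>n\<in>F. c n * chi n x))\<^sup>2 = (\<Sum>n\<in>F. (cmod (c n))\<^sup>2)"
proof -
  interpret finite_measure "icc 1" by (rule finite_measure_icc)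
  have "complex_of_real ((L2_norm (icc 1) (\<lambda>x. 0 - (\<Sum>n\<in>F. c n * chi n x)))\<^sup>2) = (\<Sum>n\<in>F. c n * cnj (c n))"
    by (subst L2_norm_minus_orthonormal[where B=0]) (use assms in \<open>auto simp: chi_orthonormal\<close>)
  also have "\<dots> = complex_of_real (\<Sum>n\<in>F. (cmod (c n))\<^sup>2)"
    by (simp only: of_real_sum complex_norm_square)
  finally show ?thesis by (simp only: of_real_eq_iff L2_norm_uminus diff_0)
qed

lemma sum_symmetric_int_interval:
  fixes p :: "int \<Rightarrow> real"
  shows "(\<Sum>n\<in>{-int N..int N}. p n) = p 0 + (\<Sum>k<N. p (int k + 1) + p (- (int k + 1)))"
proof (induction N)
  case (Suc N)
  have "{-int (Suc N)..int (Suc N)} = insert (int N + 1) (insert (- (int N + 1)) {-int N..int N})" by auto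
  thus ?case using Suc by simp
qed simp

lemma integral_of_real_Icc:
  assumes "0 \<le> a" "\<And>x. (G has_real_derivative g x) (at x)" "\<And>x. isCont g x"
  shows "(LINT x|lborel. indicator {0..a} x *\<^sub>R complex_of_real (g x)) = of_real (G a - G 0)"
proof -
  have "(LINT x|lborel. indicator {0..a} x *\<^sub>R complex_of_real (g x)) = (LINT x|lborel. complex_of_real (g x * indicator {0..a} x))"
    by (intro Bochner_Integration.integral_cong) (auto simp: indicator_def)
  also have "\<dots> = of_real (G a - G 0)"
    unfolding integral_complex_of_real by (subst integral_FTC_Icc_real[OF assms(1)]) (use assms in auto)
  finally show ?thesis .
qed

text \<open>On \<open>[0,1)\<close> this is the fractional part of \<open>x - a\<close>, up to its value at \<open>a\<close>. Its Fourier coefficients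
have absolute values independent of \<open>a\<close>, and the difference of two such functions is an indicator up to
a constant.\<close>

definition sawtooth :: "real \<Rightarrow> real \<Rightarrow> complex" where
  "sawtooth a x = indicator {0..1} x * (of_real (x - a) + indicator {0..a} x)"

lemma sawtooth_measurable [measurable]: "sawtooth a \<in> borel_measurable borel"
  unfolding sawtooth_def[abs_def] by measurable

lemma norm_sawtooth_le:
  assumes "0 \<le> a" "a \<le> 1"
  shows "cmod (sawtooth a x) \<le> 1"
proof -
  have "sawtooth a x = of_real (indicator {0..1} x * ((x - a) + indicator {0..a} x))"
    by (simp add: sawtooth_def indicator_def)
  moreover have "\<bar>indicator {0..1} x * ((x - a) + indicator {0..a} x)\<bar> \<le> 1"
    using assms by (auto simp: indicator_def)
  ultimately show ?thesis by (simp only: norm_of_real)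
qed

lemma integral_Icc_split:
  fixes u v :: "real \<Rightarrow> complex"
  assumes "continuous_on UNIV u" "continuous_on UNIV v"
  shows "(LINT x|lborel. indicator {0..1} x *\<^sub>R u x + indicator {0..a} x *\<^sub>R v x) =
     (LINT x|lborel. indicator {0..1} x *\<^sub>R u x) + (LINT x|lborel. indicator {0..a} x *\<^sub>R v x)"
  using borel_integrable_atLeastAtMost'[of 0 1 u] borel_integrable_atLeastAtMost'[of 0 a v]
     continuous_on_subset[OF assms(1)] continuous_on_subset[OF assms(2)]
  by (intro Bochner_Integration.integral_add) (auto simp: set_integrable_def)

lemma sawtooth_coeff:
  fixes n :: int
  assumes a: "0 \<le> a" "a \<le> 1"
  shows "(LINT x|icc 1. sawtooth a x * cnj (chi n x)) =
     (if n = 0 then 1/2 else chi (- n) a / (2 * pi * (- n) * \<i>))"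
proof -
  have "(LINT x|icc 1. sawtooth a x * cnj (chi n x)) =
     (LINT x|lborel. indicator {0..1} x *\<^sub>R (sawtooth a x * chi (- n) x))"
    unfolding cnj_chi of_int_minus by (rule integral_icc) simp
  also have "\<dots> = (LINT x|lborel. indicator {0..1} x *\<^sub>R (of_real (x - a) * chi (- n) x) + indicator {0..a} x *\<^sub>R chi (- n) x)"
    using a by (intro Bochner_Integration.integral_cong refl) (auto simp: sawtooth_def indicator_def algebra_simps)
  also have "\<dots> = (LINT x|lborel. indicator {0..1} x *\<^sub>R (of_real (x - a) * chi (- n) x)) + (LINT x|lborel. indicator {0..a} x *\<^sub>R chi (- n) x)"
    by (rule integral_Icc_split) (auto intro!: continuous_intros)
  also have "\<dots> = (if n = 0 then 1/2 else chi (- n) a / (2 * pi * (- n) * \<i>))"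
  proof (cases "n = 0")
    case True
    have "(LINT x|lborel. indicator {0..1} x *\<^sub>R (complex_of_real (x - a))) = of_real ((1^2/2 - a * 1) - (0^2/2 - a * 0))"
      by (rule integral_of_real_Icc) (auto intro!: derivative_eq_intros continuous_intros)
    moreover have "(LINT x|lborel. indicator {0..a} x *\<^sub>R complex_of_real 1) = of_real (a - 0)"
      by (rule integral_of_real_Icc) (use a in \<open>auto intro!: derivative_eq_intros continuous_intros\<close>)
    ultimately show ?thesis using True by simp
  next
    case False
    have "chi (- real_of_int n) 1 = 1" using chi_int[of "- n"] by simp
    thus ?thesis
      using False integral_linear_chi_Icc[of "- real_of_int n" a] integral_chi_Icc[of a "- real_of_int n"] a
      by (simp add: diff_divide_distrib del: chi_int)
  qed
  finally show ?thesis .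
qed

lemma sawtooth_norm:
  assumes a: "0 \<le> a" "a \<le> 1"
  shows "(LINT x|icc 1. sawtooth a x * cnj (sawtooth a x)) = 1/3"
proof -
  have "(LINT x|icc 1. sawtooth a x * cnj (sawtooth a x)) =
     (LINT x|lborel. indicator {0..1} x *\<^sub>R (sawtooth a x * cnj (sawtooth a x)))"
  proof (rule integral_icc)
    have "sawtooth a x * cnj (sawtooth a x) = of_real ((cmod (sawtooth a x))\<^sup>2)" for x
      by (simp only: complex_norm_square)
    thus "(\<lambda>x. sawtooth a x * cnj (sawtooth a x)) \<in> borel_measurable borel" by simp
  qed
  also have "\<dots> = (LINT x|lborel. indicator {0..1} x *\<^sub>R (of_real ((x - a)\<^sup>2)) + indicator {0..a} x *\<^sub>R of_real (2 * (x - a) + 1))"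
    using a by (intro Bochner_Integration.integral_cong refl)
       (auto simp: sawtooth_def indicator_def algebra_simps power2_eq_square)
  also have "\<dots> = (LINT x|lborel. indicator {0..1} x *\<^sub>R (complex_of_real ((x - a)\<^sup>2))) + (LINT x|lborel. indicator {0..a} x *\<^sub>R of_real (2 * (x - a) + 1))"
    by (rule integral_Icc_split) (auto intro!: continuous_intros)
  also have "(LINT x|lborel. indicator {0..1} x *\<^sub>R (complex_of_real ((x - a)\<^sup>2))) = of_real ((1 - a)^3/3 - (0 - a)^3/3)"
    by (rule integral_of_real_Icc) (auto intro!: derivative_eq_intros continuous_intros)
  also have "(LINT x|lborel. indicator {0..a} x *\<^sub>R complex_of_real (2 * (x - a) + 1)) = of_real (((a - a)\<^sup>2 + a) - ((0 - a)\<^sup>2 + 0))"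
    by (rule integral_of_real_Icc) (use a in \<open>auto intro!: derivative_eq_intros continuous_intros\<close>)
  also have "complex_of_real ((1 - a)^3/3 - (0 - a)^3/3) + of_real (((a - a)\<^sup>2 + a) - ((0 - a)\<^sup>2 + 0))
     = of_real (1/3)"
    unfolding of_real_add[symmetric]
    by (intro arg_cong[where f=of_real]) (simp add: power3_eq_cube power2_eq_square field_simps)
  finally show ?thesis by simp
qed

text \<open>Bessel's identity reduces the claim to \<open>1/4 + 2 \<Sum> 1 / (4 pi^2 n^2) = 1/3\<close>, summed over \<open>n \<ge> 1\<close>, which is
the value \<open>pi^2 / 6\<close> of the sum of the inverse squares.\<close>

lemma sawtooth_in_closed_span:
  assumes a: "0 \<le> a" "a \<le> 1"
  shows "sawtooth a \<in> L2_closed_span (icc 1) int_chi UNIV"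
  unfolding L2_closed_span_iff
proof (intro conjI allI impI)
  interpret finite_measure "icc 1" by (rule finite_measure_icc)
  show "sawtooth a \<in> L2_space (icc 1)"
    by (rule L2_space_bounded[where B=1]) (auto simp: norm_sawtooth_le a)
  fix e :: real assume e: "0 < e"
  define c where "c n = (LINT x|icc 1. sawtooth a x * cnj (int_chi n x))" for n :: int
  have c0: "(cmod (c 0))\<^sup>2 = 1/4" 
    unfolding c_def sawtooth_coeff[OF a] by (simp add: power2_eq_square norm_divide)
  have cn: "(cmod (c n))\<^sup>2 = 1 / (4 * pi\<^sup>2) * (1 / (of_int n)\<^sup>2)" if "n \<noteq> 0" for n
    unfolding c_def sawtooth_coeff[OF a] using that
    by (simp add: norm_divide norm_mult power_divide power_mult_distrib field_simps)
  have err: "(L2_norm (icc 1) (\<lambda>x. sawtooth a x - (\<Sum>n\<in>F. c n * int_chi n x)))\<^sup>2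
     = 1/3 - (\<Sum>n\<in>F. (cmod (c n))\<^sup>2)" if F: "finite F" for F
  proof -
    have "complex_of_real ((L2_norm (icc 1) (\<lambda>x. sawtooth a x - (\<Sum>n\<in>F. c n * int_chi n x)))\<^sup>2)
      = 1/3 - (\<Sum>n\<in>F. cnj (c n) * c n) - (\<Sum>n\<in>F. c n * cnj (c n)) + (\<Sum>n\<in>F. c n * cnj (c n))"
      unfolding c_def sawtooth_norm[OF a, symmetric]
      by (rule L2_norm_minus_orthonormal[where B=1])
         (use F in \<open>auto simp: norm_sawtooth_le a chi_orthonormal\<close>)
    also have "\<dots> = complex_of_real (1/3 - (\<Sum>n\<in>F. (cmod (c n))\<^sup>2))"
      by (simp add: complex_norm_square mult.commute del: of_real_power)
    finally show ?thesis by (simp only: of_real_eq_iff)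
  qed
  have "(\<lambda>k. 1 / (4 * pi\<^sup>2) * (1 / (real (k + 1))\<^sup>2) + 1 / (4 * pi\<^sup>2) * (1 / (real (k + 1))\<^sup>2))
      sums (1 / (4 * pi\<^sup>2) * (pi\<^sup>2 / 6) + 1 / (4 * pi\<^sup>2) * (pi\<^sup>2 / 6))"
    using inverse_squares_sums by (intro sums_add sums_mult) (simp_all add: add.commute)
  hence "(\<lambda>N. \<Sum>k<N. 1 / (4 * pi\<^sup>2) * (1 / (real (k + 1))\<^sup>2) + 1 / (4 * pi\<^sup>2) * (1 / (real (k + 1))\<^sup>2)) \<longlonglongrightarrow> 1/12"
    by (simp add: sums_def power2_eq_square)
  from tendsto_diff[OF tendsto_const[of "1/3"] tendsto_add[OF tendsto_const[of "1/4"] this]]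
  have lim: "(\<lambda>N. 1/3 - (1/4 + (\<Sum>k<N. 1 / (4 * pi\<^sup>2) * (1 / (real (k + 1))\<^sup>2) + 1 / (4 * pi\<^sup>2) * (1 / (real (k + 1))\<^sup>2))))
     \<longlonglongrightarrow> 0" by simp
  have sum: "(\<Sum>n\<in>{-int N..int N}. (cmod (c n))\<^sup>2) = 1/4 +
      (\<Sum>k<N. 1 / (4 * pi\<^sup>2) * (1 / (real (k + 1))\<^sup>2) + 1 / (4 * pi\<^sup>2) * (1 / (real (k + 1))\<^sup>2))" for N
    unfolding sum_symmetric_int_interval c0
  proof (intro arg_cong2[where f="(+)"] refl sum.cong)
    fix k
    have p: "(real_of_int (- (int k + 1)))\<^sup>2 = (real (k + 1))\<^sup>2" "(real_of_int (int k + 1))\<^sup>2 = (real (k + 1))\<^sup>2"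
      by (simp_all add: power2_eq_square algebra_simps)
    show "(cmod (c (int k + 1)))\<^sup>2 = 1 / (4 * pi\<^sup>2) * (1 / (real (k + 1))\<^sup>2)"
      "(cmod (c (- (int k + 1))))\<^sup>2 = 1 / (4 * pi\<^sup>2) * (1 / (real (k + 1))\<^sup>2)"
      by (subst cn; simp only: p; simp)+
  qed
  have "\<forall>\<^sub>F N in sequentially. 1/3 - (\<Sum>n\<in>{-int N..int N}. (cmod (c n))\<^sup>2) < e\<^sup>2"
    unfolding sum by (rule order_tendstoD(2)[OF lim]) (use e in simp)
  then obtain N where "1/3 - (\<Sum>n\<in>{-int N..int N}. (cmod (c n))\<^sup>2) < e\<^sup>2"
    by (auto simp: eventually_sequentially)
  hence "(L2_norm (icc 1) (\<lambda>x. sawtooth a x - (\<Sum>n\<in>{-int N..int N}. c n * int_chi n x)))\<^sup>2 < e\<^sup>2"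
    by (simp add: err)
  hence "L2_norm (icc 1) (\<lambda>x. sawtooth a x - (\<Sum>n\<in>{-int N..int N}. c n * int_chi n x)) < e"
    by (rule power2_less_imp_less) (use e in simp)
  thus "\<exists>v\<in>lin_span int_chi UNIV. L2_norm (icc 1) (\<lambda>x. sawtooth a x - v x) < e"
    by (rule bexI[OF _ lin_spanI]) auto
qed

text \<open>The indicator of \<open>[0,a]\<close> is, on \<open>[0,1]\<close>, a combination of two sawtooth functions and a constant, and the
sets \<open>(-\<infinity>,a]\<close> generate the Borel sets.\<close>

theorem closed_span_chi_int: "L2_closed_span (icc 1) int_chi UNIV = L2_space (icc 1)"
proof -
  interpret finite_measure "icc 1" by (rule finite_measure_icc)
  let ?V = "L2_closed_span (icc 1) int_chi UNIV"
  have f: "\<forall>n\<in>(UNIV::int set). int_chi n \<in> L2_space (icc 1)" by simp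
  have one: "(\<lambda>x. 1) \<in> ?V"
    using closed_span_lin_span[OF f lin_span_base[of 0]] by (simp add: chi_def[abs_def])
  show ?thesis
  proof (rule closed_span_eq_L2_spaceI[OF f _ _ _ one])
    show "Int_stable (range (\<lambda>a::real. {..a}))" by (auto simp: Int_stable_def)
    show "sets (icc 1) = sigma_sets (space (icc 1)) (range (\<lambda>a::real. {..a}))"
      by (simp add: borel_eq_atMost[where 'a=real])
    fix A :: "real set" assume "A \<in> range (\<lambda>a. {..a})"
    then obtain a where A: "A = {..a}" by auto
    define b where "b = max 0 (min a 1)"
    have b: "0 \<le> b" "b \<le> 1" by (auto simp: b_def)
    have v: "(\<lambda>x. sawtooth b x - sawtooth 1 x + (of_real b :: complex) * 1) \<in> ?V"
      by (intro closed_span_add[OF f] closed_span_diff[OF f] closed_span_cmult[OF f one] sawtooth_in_closed_span b) auto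
    show "indicator A \<in> ?V"
    proof (cases "0 \<le> a")
      case True
      have "AE x in icc 1. (indicator A x :: complex) = sawtooth b x - sawtooth 1 x + of_real b * 1"
        unfolding AE_icc by (intro AE_I2) (use True in \<open>auto simp: sawtooth_def A b_def indicator_def min_def max_def\<close>)
      thus ?thesis by (intro closed_span_cong_AE[OF f v]) (auto simp: A)
    next
      case False
      have "AE x in icc 1. (indicator A x :: complex) = 0"
        unfolding AE_icc by (intro AE_I2) (use False in \<open>auto simp: A\<close>)
      thus ?thesis
        by (intro closed_span_cong_AE[OF f closed_span_lin_span[OF f lin_span_zero]]) (auto simp: A)
    qed
  qed auto
qed

section \<open>Rescaling the interval\<close>

lemma L2_icc_scale:
  assumes h: "0 < h" and g[measurable]: "g \<in> borel_measurable borel"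
  shows "L2_norm (icc (h * a)) g = sqrt h * L2_norm (icc a) (\<lambda>x. g (h * x))"
    and "g \<in> L2_space (icc (h * a)) \<longleftrightarrow> (\<lambda>x. g (h * x)) \<in> L2_space (icc a)"
proof -
  have eq: "(\<integral>\<^sup>+x. (cmod (g x))\<^sup>2 \<partial>icc (h * a)) = ennreal h * (\<integral>\<^sup>+x. (cmod (g (h * x)))\<^sup>2 \<partial>icc a)"
  proof -
    have "(\<integral>\<^sup>+x. (cmod (g x))\<^sup>2 \<partial>icc (h * a)) = (\<integral>\<^sup>+x. indicator {0..h * a} x * ennreal ((cmod (g x))\<^sup>2) \<partial>lborel)"
      by (rule nn_integral_icc) simp
    also have "\<dots> = ennreal h * (\<integral>\<^sup>+x. indicator {0..h * a} (0 + h * x) * ennreal ((cmod (g (0 + h * x)))\<^sup>2) \<partial>lborel)"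
      using h by (subst nn_integral_real_affine[where c=h and t=0]) auto
    also have "(\<integral>\<^sup>+x. indicator {0..h * a} (0 + h * x) * ennreal ((cmod (g (0 + h * x)))\<^sup>2) \<partial>lborel)
       = (\<integral>\<^sup>+x. indicator {0..a} x * ennreal ((cmod (g (h * x)))\<^sup>2) \<partial>lborel)"
      using h by (intro nn_integral_cong) (auto simp: indicator_def zero_le_mult_iff mult_le_cancel_left)
    also have "\<dots> = (\<integral>\<^sup>+x. (cmod (g (h * x)))\<^sup>2 \<partial>icc a)" by (rule nn_integral_icc[symmetric]) simp
    finally show ?thesis .
  qed
  show iff: "g \<in> L2_space (icc (h * a)) \<longleftrightarrow> (\<lambda>x. g (h * x)) \<in> L2_space (icc a)"
    unfolding L2_space_iff eq using h by (auto simp: ennreal_mult_less_top)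
  have "(LINT x|icc (h * a). (cmod (g x))\<^sup>2) = h * (LINT x|icc a. (cmod (g (h * x)))\<^sup>2)"
    using h by (simp add: integral_eq_nn_integral eq enn2real_mult)
  thus "L2_norm (icc (h * a)) g = sqrt h * L2_norm (icc a) (\<lambda>x. g (h * x))"
    by (simp add: L2_norm_def real_sqrt_mult)
qed

lemma finitary_Riesz_basis_icc_scale:
  assumes R: "finitary_Riesz_basis (icc a) (\<lambda>n x. f n (h * x)) I"
    and h: "0 < h" and f: "\<And>n. n \<in> I \<Longrightarrow> f n \<in> borel_measurable borel"
  shows "finitary_Riesz_basis (icc (h * a)) f I"
  by (rule finitary_Riesz_basis_substitution[where T = "\<lambda>x. h * x" and K="sqrt h", OF R]) (use h f in \<open>auto simp: L2_icc_scale\<close>)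

lemma chi_scale: "chi \<gamma> (h * x) = chi (h * \<gamma>) x"
  by (simp add: chi_def mult_ac)

theorem Fourier_basis:
  assumes h: "0 < h"
  shows "finitary_Riesz_basis (icc h) (\<lambda>n::int. chi (of_int n / h)) UNIV"
proof -
  have "Riesz_bounds (icc 1) int_chi UNIV 1 1"
    unfolding Riesz_bounds_def using chi_Parseval by simp
  hence "finitary_Riesz_basis (icc 1) int_chi UNIV"
    unfolding finitary_Riesz_basis_def using closed_span_chi_int by (auto intro!: exI[of _ 1])
  hence "finitary_Riesz_basis (icc 1) (\<lambda>(n::int) x. chi (of_int n / h) (h * x)) UNIV"
    using h by (simp add: chi_scale)
  from finitary_Riesz_basis_icc_scale[OF this h] show ?thesis by simp
qed

lemma Fourier_Parseval:
  fixes c :: "int \<Rightarrow> complex"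
  assumes h: "0 < h" and F: "finite F"
  shows "(L2_norm (icc h) (\<lambda>x. \<Sum>n\<in>F. c n * chi (of_int n / h) x))\<^sup>2 = h * (\<Sum>n\<in>F. (cmod (c n))\<^sup>2)"
proof -
  have "L2_norm (icc (h * 1)) (\<lambda>x. \<Sum>n\<in>F. c n * chi (of_int n / h) x)
      = sqrt h * L2_norm (icc 1) (\<lambda>x. \<Sum>n\<in>F. c n * int_chi n x)"
    using h by (subst L2_icc_scale(1)[OF h]) (auto simp: chi_scale)
  thus ?thesis using chi_Parseval[OF F, of c] h by (simp add: power_mult_distrib)
qed

section \<open>Perturbation of Riesz bases\<close>

text \<open>The hypothesis gives the bounds directly. For density, approximating \<open>g\<close> by a sum over \<open>e\<close> and using the same
coefficients for \<open>f\<close> leaves an error of norm about \<open>q\<close> times that of \<open>g\<close>; repeating this on the error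
gives errors of size \<open>q^k\<close>.\<close>

lemma Paley_Wiener_perturbation:
  assumes R: "finitary_Riesz_basis M e I"
    and f: "\<forall>n\<in>I. f n \<in> L2_space M" and q: "0 \<le> q" "q < 1"
    and close: "\<And>F c. finite F \<Longrightarrow> F \<subseteq> I \<Longrightarrow>
       L2_norm M (\<lambda>x. \<Sum>n\<in>F. c n * (f n x - e n x)) \<le> q * L2_norm M (\<lambda>x. \<Sum>n\<in>F. c n * e n x)"
  shows "finitary_Riesz_basis M f I"
proof -
  obtain a b where e: "\<forall>n\<in>I. e n \<in> L2_space M" and span: "L2_closed_span M e I = L2_space M"
    and ab: "0 < a" "0 < b" "Riesz_bounds M e I a b"
    using R by (auto simp: finitary_Riesz_basis_def)
  let ?E = "\<lambda>F c x. \<Sum>n\<in>F. c n * e n x" and ?T = "\<lambda>F c x. \<Sum>n\<in>F. c n * f n x"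
  have E: "?E F c \<in> L2_space M" and T: "?T F c \<in> L2_space M" if "F \<subseteq> I" for F c
    using that e f by (auto intro!: L2_space_sum L2_space_cmult)
  have close': "L2_norm M (\<lambda>x. ?E F c x - ?T F c x) \<le> q * L2_norm M (?E F c)" if "finite F" "F \<subseteq> I" for F c
    using close[OF that, of c]
    by (subst L2_norm_minus_commute) (simp add: sum_subtractf right_diff_distrib)
  have "Riesz_bounds M f I ((1 - q)\<^sup>2 * a) ((1 + q)\<^sup>2 * b)"
    unfolding Riesz_bounds_def
  proof (intro allI impI conjI)
    fix F c assume F: "finite F" "F \<subseteq> I"
    have d: "\<bar>L2_norm M (?E F c) - L2_norm M (?T F c)\<bar> \<le> q * L2_norm M (?E F c)"
      using L2_norm_diff_ge[OF E[OF F(2)] T[OF F(2)]] close'[OF F] by (rule order_trans)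
    have lo: "(1 - q) * L2_norm M (?E F c) \<le> L2_norm M (?T F c)"
      and up: "L2_norm M (?T F c) \<le> (1 + q) * L2_norm M (?E F c)"
      using d by (auto simp: algebra_simps abs_le_iff)
    have ee: "a * (\<Sum>n\<in>F. (cmod (c n))\<^sup>2) \<le> (L2_norm M (?E F c))\<^sup>2"
             "(L2_norm M (?E F c))\<^sup>2 \<le> b * (\<Sum>n\<in>F. (cmod (c n))\<^sup>2)"
      using ab(3) F by (auto simp: Riesz_bounds_def)
    have "(1 - q)\<^sup>2 * a * (\<Sum>n\<in>F. (cmod (c n))\<^sup>2) \<le> (1 - q)\<^sup>2 * (L2_norm M (?E F c))\<^sup>2"
      using ee(1) by (simp add: mult.assoc mult_left_mono)
    also have "\<dots> \<le> (L2_norm M (?T F c))\<^sup>2"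
      unfolding power_mult_distrib[symmetric] using q by (intro power_mono lo) auto
    finally show "(1 - q)\<^sup>2 * a * (\<Sum>n\<in>F. (cmod (c n))\<^sup>2) \<le> (L2_norm M (?T F c))\<^sup>2" .
    have "(L2_norm M (?T F c))\<^sup>2 \<le> (1 + q)\<^sup>2 * (L2_norm M (?E F c))\<^sup>2"
      unfolding power_mult_distrib[symmetric] by (intro power_mono up) auto
    also have "\<dots> \<le> (1 + q)\<^sup>2 * b * (\<Sum>n\<in>F. (cmod (c n))\<^sup>2)"
      using ee(2) by (simp add: mult.assoc mult_left_mono)
    finally show "(L2_norm M (?T F c))\<^sup>2 \<le> (1 + q)\<^sup>2 * b * (\<Sum>n\<in>F. (cmod (c n))\<^sup>2)" .
  qed
  moreover have "0 < (1 - q)\<^sup>2 * a" "0 < (1 + q)\<^sup>2 * b" using ab q by auto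
  moreover have "L2_space M \<subseteq> L2_closed_span M f I"
  proof
    \<comment> \<open>the slack \<open>\<eta>\<close> absorbs the errors of approximation in all steps\<close>
    have iter: "\<exists>v\<in>lin_span f I. L2_norm M (\<lambda>x. g x - v x) \<le> q ^ k * L2_norm M g + \<eta>"
      if "g \<in> L2_space M" "0 < \<eta>" for g k \<eta>
      using that
    proof (induction k arbitrary: g \<eta>)
      case 0
      thus ?case using lin_span_zero by (intro bexI[of _ "\<lambda>x. 0"]) auto
    next
      case (Suc k)
      have "0 < \<eta> / 4" using Suc by simp
      moreover have "g \<in> L2_closed_span M e I" using Suc span by simp
      ultimately obtain F c where F: "finite F" "F \<subseteq> I" "L2_norm M (\<lambda>x. g x - ?E F c x) < \<eta> / 4"
        unfolding L2_closed_span_def by blast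
      have "L2_norm M (?E F c) \<le> L2_norm M g + \<eta> / 4"
        using L2_norm_diff_ge[OF Suc.prems(1) E[OF F(2)], of c] F(3) by linarith
      hence "q * L2_norm M (?E F c) \<le> q * (L2_norm M g + \<eta> / 4)" using q by (intro mult_left_mono) auto
      also have "\<dots> \<le> q * L2_norm M g + \<eta> / 4"
        using mult_right_mono[of q 1 "\<eta>/4"] q Suc.prems(2) by (simp add: distrib_left)
      finally have one: "L2_norm M (\<lambda>x. g x - ?T F c x) \<le> q * L2_norm M g + \<eta> / 2"
        using L2_norm_triangle_mid[OF Suc.prems(1) E[OF F(2)] T[OF F(2)], of c c] close'[OF F(1,2), of c] F(3)
        by linarith
      have gT: "(\<lambda>x. g x - ?T F c x) \<in> L2_space M" by (intro L2_space_diff Suc.prems T F)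
      obtain v where v: "v \<in> lin_span f I"
         "L2_norm M (\<lambda>x. g x - ?T F c x - v x) \<le> q ^ k * L2_norm M (\<lambda>x. g x - ?T F c x) + \<eta> / 2"
        using Suc.IH[OF gT, of "\<eta> / 2"] Suc.prems(2) by auto
      have "q ^ k * L2_norm M (\<lambda>x. g x - ?T F c x) \<le> q ^ k * (q * L2_norm M g + \<eta> / 2)"
        using q by (intro mult_left_mono one) auto
      also have "\<dots> \<le> q ^ Suc k * L2_norm M g + \<eta> / 2"
        using mult_right_mono[of "q ^ k" 1 "\<eta>/2"] q Suc.prems(2) power_le_one[of q k]
        by (simp add: distrib_left)
      finally have "L2_norm M (\<lambda>x. g x - (?T F c x + v x)) \<le> q ^ Suc k * L2_norm M g + \<eta>"
        using v(2) by (simp add: diff_diff_eq)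
      moreover have "(\<lambda>x. ?T F c x + v x) \<in> lin_span f I"
        by (intro lin_span_add lin_spanI F v)
      ultimately show ?case by (rule bexI)
    qed
    fix g assume g: "g \<in> L2_space M"
    show "g \<in> L2_closed_span M f I"
      unfolding L2_closed_span_iff
    proof (intro conjI allI impI g)
      fix \<epsilon> :: real assume eps: "0 < \<epsilon>"
      have "(\<lambda>k. q ^ k * L2_norm M g) \<longlonglongrightarrow> 0"
        using q by (intro tendsto_mult_left_zero LIMSEQ_realpow_zero) auto
      hence "\<forall>\<^sub>F k in sequentially. q ^ k * L2_norm M g < \<epsilon> / 2"
        by (rule order_tendstoD(2)) (use eps in simp)
      then obtain k where k: "q ^ k * L2_norm M g < \<epsilon> / 2" by (auto simp: eventually_sequentially)
      obtain v where v: "v \<in> lin_span f I" "L2_norm M (\<lambda>x. g x - v x) \<le> q ^ k * L2_norm M g + \<epsilon> / 2"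
        using iter[OF g, of "\<epsilon> / 2" k] eps by auto
      show "\<exists>v\<in>lin_span f I. L2_norm M (\<lambda>x. g x - v x) < \<epsilon>"
        by (rule bexI[OF _ v(1)]) (use v(2) k in linarith)
    qed
  qed
  moreover have "L2_closed_span M f I \<subseteq> L2_space M" by (auto simp: L2_closed_span_def)
  ultimately show ?thesis unfolding finitary_Riesz_basis_def using f by blast
qed

lemma emeasure_icc: "0 \<le> h \<Longrightarrow> emeasure (icc h) UNIV = ennreal h"
proof -
  assume h: "0 \<le> h"
  have "emeasure (icc h) UNIV = (\<integral>\<^sup>+x. 1 \<partial>icc h)" by simp
  also have "\<dots> = emeasure lborel {0..h}" by (subst nn_integral_icc) auto
  finally show ?thesis using h by simp
qed

lemma L2_norm_one_icc: "0 \<le> h \<Longrightarrow> L2_norm (icc h) (\<lambda>x. 1) = sqrt h"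
  by (rule L2_normI(2)) (auto simp: emeasure_icc)

text \<open>Write \<open>e(\<nu>_n x) - e(n x / h)\<close> as the integral over \<open>s\<close> from \<open>0\<close> to \<open>x\<close> of the derivative of
\<open>e(n x / h) e(\<delta>_n s)\<close>. By the Cauchy-Schwarz inequality the square of the sum at \<open>x\<close> is at most \<open>h\<close>
times an integral over all \<open>s\<close> in \<open>[0,h]\<close>; after exchanging the integrals, Parseval's identity applies in
\<open>x\<close> for each fixed \<open>s\<close>.\<close>

lemma chi_perturbation_bound:
  fixes c :: "int \<Rightarrow> complex" and \<nu> :: "int \<Rightarrow> real"
  assumes h: "0 < h" and D: "0 \<le> D" "\<And>n. \<bar>\<nu> n - n / h\<bar> \<le> D" and F: "finite F"
  shows "L2_norm (icc h) (\<lambda>x. \<Sum>n\<in>F. c n * (chi (\<nu> n) x - chi (n / h) x))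
     \<le> (2 * pi * D * h) * L2_norm (icc h) (\<lambda>x. \<Sum>n\<in>F. c n * chi (n / h) x)"
proof (rule L2_norm_leI(2))
  interpret finite_measure "icc h" by (rule finite_measure_icc)
  interpret P: pair_sigma_finite "icc h" "icc h" ..
  define f where "f x = (\<Sum>n\<in>F. c n * (chi (\<nu> n) x - chi (n / h) x))" for x
  define \<delta> where "\<delta> n = \<nu> n - n / h" for n
  define \<Phi> where "\<Phi> s x = (\<Sum>n\<in>F. (c n * ((2 * pi * \<delta> n * \<i>) * chi (\<delta> n) s)) * chi (n / h) x)" for s x
  define S where "S = (\<Sum>n\<in>F. (cmod (c n))\<^sup>2)"
  have S: "0 \<le> S" unfolding S_def by (intro sum_nonneg) auto
  have norm2: "(L2_norm (icc h) (\<lambda>x. \<Sum>n\<in>F. c n * chi (n / h) x))\<^sup>2 = h * S"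
    unfolding S_def by (rule Fourier_Parseval[OF h F])
  have m [measurable]: "(\<lambda>s. \<Phi> s x) \<in> borel_measurable borel" "\<Phi> s \<in> borel_measurable borel" for s x
    unfolding \<Phi>_def[abs_def] by measurable
  have m2: "(\<lambda>p. ennreal ((cmod (\<Phi> (snd p) (fst p)))\<^sup>2)) \<in> borel_measurable (icc h \<Otimes>\<^sub>M icc h)"
    unfolding \<Phi>_def by measurable
  have f_int: "f x = (LINT s|lborel. indicator {0..x} s *\<^sub>R \<Phi> s x)" if "0 \<le> x" for x
  proof -
    let ?G = "\<lambda>s. \<Sum>n\<in>F. (c n * chi (\<delta> n) s) * chi (n / h) x"
    have "(?G has_vector_derivative \<Phi> s x) (at s within {0..x})" for s
      unfolding \<Phi>_def
      by (intro has_vector_derivative_sum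
            bounded_linear.has_vector_derivative[OF bounded_linear_mult_left]
            bounded_linear.has_vector_derivative[OF bounded_linear_mult_right] has_vector_derivative_chi)
    moreover have "continuous_on {0..x} (\<lambda>s. \<Phi> s x)"
      unfolding \<Phi>_def by (intro continuous_intros)
    ultimately have "(LINT s|lborel. indicator {0..x} s *\<^sub>R \<Phi> s x) = ?G x - ?G 0"
      by (rule integral_FTC_Icc[OF that])
    also have "\<dots> = f x"
    proof -
      have "chi (\<delta> n) x * chi (n / h) x = chi (\<nu> n) x" for n :: int
        by (simp add: \<delta>_def flip: chi_add)
      thus ?thesis by (simp add: f_def right_diff_distrib sum_subtractf mult.assoc)
    qed
    finally show ?thesis by simp
  qed
  have bound: "ennreal ((cmod (f x))\<^sup>2) \<le> ennreal h * (\<integral>\<^sup>+s. ennreal ((cmod (\<Phi> s x))\<^sup>2) \<partial>icc h)"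
    if x: "x \<in> {0..h}" for x
  proof -
    have "ennreal (cmod (f x)) \<le> (\<integral>\<^sup>+s. norm (indicator {0..x} s *\<^sub>R \<Phi> s x) \<partial>lborel)"
    proof -
      have "norm (LINT s|lborel. indicator {0..x} s *\<^sub>R \<Phi> s x) \<le> (LINT s|lborel. norm (indicator {0..x} s *\<^sub>R \<Phi> s x))"
        by (rule integral_norm_bound)
      also have "ennreal \<dots> \<le> (\<integral>\<^sup>+s. norm (indicator {0..x} s *\<^sub>R \<Phi> s x) \<partial>lborel)"
      proof (cases "integrable lborel (\<lambda>s. norm (indicator {0..x} s *\<^sub>R \<Phi> s x))")
        case True
        thus ?thesis by (simp add: nn_integral_eq_integral)
      next
        case False
        thus ?thesis by (simp add: not_integrable_integral_eq)
      qed
      finally show ?thesis using f_int x by (simp add: ennreal_leI)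
    qed
    also have "\<dots> \<le> (\<integral>\<^sup>+s. indicator {0..h} s * ennreal (cmod (\<Phi> s x) * cmod 1) \<partial>lborel)"
      using x by (intro nn_integral_mono) (auto simp: indicator_def)
    also have "\<dots> = (\<integral>\<^sup>+s. ennreal (cmod (\<Phi> s x) * cmod 1) \<partial>icc h)"
      by (rule nn_integral_icc[symmetric]) simp
    finally have 1: "ennreal (cmod (f x)) \<le> (\<integral>\<^sup>+s. ennreal (cmod (\<Phi> s x) * cmod 1) \<partial>icc h)" .
    have \<Phi>L: "(\<lambda>s. \<Phi> s x) \<in> L2_space (icc h)"
    proof -
      have "(\<lambda>s. \<Sum>n\<in>F. (c n * (2 * pi * \<delta> n * \<i>) * chi (n / h) x) * chi (\<delta> n) s) \<in> L2_space (icc h)"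
        by (intro L2_space_sum L2_space_cmult) simp
      thus ?thesis unfolding \<Phi>_def by (simp add: mult_ac)
    qed
    have "(\<integral>\<^sup>+s. ennreal (cmod (\<Phi> s x) * cmod 1) \<partial>icc h) \<le> ennreal (L2_norm (icc h) (\<lambda>s. \<Phi> s x) * L2_norm (icc h) (\<lambda>s. 1))"
      by (rule L2_norm_Cauchy_Schwarz[OF \<Phi>L]) (auto intro!: L2_space_bounded)
    also have "L2_norm (icc h) (\<lambda>s. 1) = sqrt h" using h by (simp add: L2_norm_one_icc)
    finally have "ennreal (cmod (f x)) \<le> ennreal (L2_norm (icc h) (\<lambda>s. \<Phi> s x) * sqrt h)"
      using 1 by (rule order_trans[rotated])
    hence "cmod (f x) \<le> L2_norm (icc h) (\<lambda>s. \<Phi> s x) * sqrt h"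
      using h by (simp add: ennreal_le_iff)
    hence "(cmod (f x))\<^sup>2 \<le> (L2_norm (icc h) (\<lambda>s. \<Phi> s x) * sqrt h)\<^sup>2"
      by (intro power_mono) auto
    also have "\<dots> = h * (L2_norm (icc h) (\<lambda>s. \<Phi> s x))\<^sup>2" using h by (simp add: power_mult_distrib)
    finally show ?thesis
      using h by (simp add: nn_integral_L2_norm[OF \<Phi>L] ennreal_leI flip: ennreal_mult)
  qed
  have inner: "(\<integral>\<^sup>+x. ennreal ((cmod (\<Phi> s x))\<^sup>2) \<partial>icc h) \<le> ennreal (h * ((2 * pi * D)\<^sup>2 * S))" for s
  proof -
    let ?d = "\<lambda>n. c n * ((2 * pi * \<delta> n * \<i>) * chi (\<delta> n) s)"
    have "\<Phi> s \<in> L2_space (icc h)"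
      unfolding \<Phi>_def[abs_def] by (intro L2_space_sum L2_space_cmult) simp
    hence "(\<integral>\<^sup>+x. ennreal ((cmod (\<Phi> s x))\<^sup>2) \<partial>icc h) = ennreal ((L2_norm (icc h) (\<Phi> s))\<^sup>2)"
      by (rule nn_integral_L2_norm)
    also have "(L2_norm (icc h) (\<Phi> s))\<^sup>2 = h * (\<Sum>n\<in>F. (cmod (?d n))\<^sup>2)"
      unfolding \<Phi>_def[abs_def] by (rule Fourier_Parseval[OF h F])
    also have "(\<Sum>n\<in>F. (cmod (?d n))\<^sup>2) \<le> (\<Sum>n\<in>F. (2 * pi * D)\<^sup>2 * (cmod (c n))\<^sup>2)"
    proof (rule sum_mono)
      fix n
      have "(cmod (?d n))\<^sup>2 = (2 * pi * \<bar>\<delta> n\<bar>)\<^sup>2 * (cmod (c n))\<^sup>2"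
        by (simp add: norm_mult power_mult_distrib)
      also have "\<dots> \<le> (2 * pi * D)\<^sup>2 * (cmod (c n))\<^sup>2"
        using D(2)[of n] by (intro mult_right_mono power_mono mult_left_mono) (auto simp: \<delta>_def)
      finally show "(cmod (?d n))\<^sup>2 \<le> (2 * pi * D)\<^sup>2 * (cmod (c n))\<^sup>2" .
    qed
    also have "(\<Sum>n\<in>F. (2 * pi * D)\<^sup>2 * (cmod (c n))\<^sup>2) = (2 * pi * D)\<^sup>2 * S"
      by (simp add: S_def sum_distrib_left)
    finally show ?thesis using h by (simp add: ennreal_leI mult_left_mono)
  qed
  have "(\<integral>\<^sup>+x. ennreal ((cmod (f x))\<^sup>2) \<partial>icc h) \<le> (\<integral>\<^sup>+x. ennreal h * (\<integral>\<^sup>+s. ennreal ((cmod (\<Phi> s x))\<^sup>2) \<partial>icc h) \<partial>icc h)"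
    by (rule nn_integral_mono_AE) (auto simp: AE_icc intro!: AE_I2 bound)
  also have "\<dots> = ennreal h * (\<integral>\<^sup>+x. (\<integral>\<^sup>+s. ennreal ((cmod (\<Phi> s x))\<^sup>2) \<partial>icc h) \<partial>icc h)"
    using borel_measurable_nn_integral_fst[OF m2] by (intro nn_integral_cmult) simp
  also have "(\<integral>\<^sup>+x. (\<integral>\<^sup>+s. ennreal ((cmod (\<Phi> s x))\<^sup>2) \<partial>icc h) \<partial>icc h) = (\<integral>\<^sup>+s. (\<integral>\<^sup>+x. ennreal ((cmod (\<Phi> s x))\<^sup>2) \<partial>icc h) \<partial>icc h)"
    using P.Fubini[OF m2] by simp
  also have "\<dots> \<le> (\<integral>\<^sup>+s. ennreal (h * ((2 * pi * D)\<^sup>2 * S)) \<partial>icc h)"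
    by (intro nn_integral_mono inner)
  also have "\<dots> = ennreal (h * ((2 * pi * D)\<^sup>2 * S)) * ennreal h"
    using h by (simp add: emeasure_icc)
  also have "ennreal h * \<dots> = ennreal (((2 * pi * D * h) * L2_norm (icc h) (\<lambda>x. \<Sum>n\<in>F. c n * chi (n / h) x))\<^sup>2)"
    using h S by (simp add: power_mult_distrib norm2 mult_ac flip: ennreal_mult) (simp add: power2_eq_square mult_ac)
  finally show "(\<integral>\<^sup>+x. ennreal ((cmod (\<Sum>n\<in>F. c n * (chi (\<nu> n) x - chi (n / h) x)))\<^sup>2) \<partial>icc h)
     \<le> ennreal (((2 * pi * D * h) * L2_norm (icc h) (\<lambda>x. \<Sum>n\<in>F. c n * chi (n / h) x))\<^sup>2)"
    by (simp add: f_def mult_left_mono)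
qed (use h D in auto)

text \<open>Rounding \<open>n / h\<close> to the nearest multiple of \<open>N\<close> moves it by at most \<open>N / 2\<close>, so the perturbation factor
is \<open>2 pi (N / 2) h\<close>. As the numbers \<open>n / h\<close> are more than \<open>N\<close> apart, distinct ones have distinct roundings.\<close>

lemma short_interval_Riesz_basis:
  fixes N :: nat
  assumes N: "1 \<le> N" and h: "0 < h" "pi * N * h < 1"
  shows "\<exists>\<Gamma>::int set. (\<forall>\<gamma>\<in>\<Gamma>. int N dvd \<gamma>) \<and> finitary_Riesz_basis (icc h) int_chi \<Gamma>"
proof -
  define \<nu> where "\<nu> n = int N * round (of_int n / (N * h))" for n :: int
  have d: "\<bar>of_int (\<nu> n) - n / h\<bar> \<le> N / 2" for n
  proof -
    have "of_int (\<nu> n) - n / h = N * (of_int (round (of_int n / (N * h))) - of_int n / (N * h))"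
      using N h by (simp add: \<nu>_def right_diff_distrib)
    hence "\<bar>of_int (\<nu> n) - n / h\<bar> = N * \<bar>of_int (round (of_int n / (N * h))) - of_int n / (N * h)\<bar>"
      by (simp add: abs_mult)
    also have "\<dots> \<le> N * (1/2)" by (intro mult_left_mono of_int_round_abs_le) auto
    finally show ?thesis by simp
  qed
  have "finitary_Riesz_basis (icc h) (\<lambda>n. chi (of_int (\<nu> n))) UNIV"
  proof (rule Paley_Wiener_perturbation[OF Fourier_basis[OF h(1)], where q="pi * N * h"])
    show "L2_norm (icc h) (\<lambda>x. \<Sum>n\<in>F. c n * (chi (of_int (\<nu> n)) x - chi (of_int n / h) x))
       \<le> pi * N * h * L2_norm (icc h) (\<lambda>x. \<Sum>n\<in>F. c n * chi (of_int n / h) x)" if "finite F" for F c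
      using chi_perturbation_bound[OF h(1) _ d that, of c] by simp
  qed (use h in auto)
  moreover have "inj \<nu>"
  proof (rule injI)
    fix n m assume "\<nu> n = \<nu> m"
    hence "\<bar>n / h - m / h\<bar> \<le> N" using d[of n] d[of m] by (simp only: abs_le_iff) linarith
    hence "\<bar>real_of_int (n - m)\<bar> \<le> N * h" using h by (simp add: field_simps flip: diff_divide_distrib)
    also have "\<dots> \<le> pi * (N * h)" using mult_right_mono[of 1 pi "N * h"] pi_ge_two h by simp
    also have "\<dots> < 1" using h by (simp add: mult_ac)
    finally show "n = m" by linarith
  qed
  ultimately have "finitary_Riesz_basis (icc h) int_chi (range \<nu>)"
    by (rule finitary_Riesz_basis_image[rotated])
  moreover have "\<forall>\<gamma>\<in>range \<nu>. int N dvd \<gamma>" by (auto simp: \<nu>_def)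
  ultimately show ?thesis by blast
qed

section \<open>Lengthening the interval\<close>

lemma nn_integral_icc_shift:
  assumes [measurable]: "u \<in> borel_measurable borel"
  shows "(\<integral>\<^sup>+x. u (x + t) \<partial>icc a) = (\<integral>\<^sup>+x. indicator {t..a + t} x * u x \<partial>lborel)"
proof -
  have "(\<integral>\<^sup>+x. indicator {t..a + t} x * u x \<partial>lborel)
      = (\<integral>\<^sup>+x. indicator {t..a + t} (t + 1 * x) * u (t + 1 * x) \<partial>lborel)"
    by (subst nn_integral_real_affine[where c=1 and t=t]) auto
  also have "\<dots> = (\<integral>\<^sup>+x. indicator {0..a} x * u (x + t) \<partial>lborel)"
    by (intro nn_integral_cong) (auto simp: indicator_def add.commute)
  also have "\<dots> = (\<integral>\<^sup>+x. u (x + t) \<partial>icc a)" by (rule nn_integral_icc[symmetric]) simp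
  finally show ?thesis by simp
qed

lemma L2_icc_subinterval:
  assumes g: "g \<in> L2_space (icc b)" and t: "0 \<le> t" "a + t \<le> b"
  shows "(\<lambda>x. g (x + t)) \<in> L2_space (icc a)" "L2_norm (icc a) (\<lambda>x. g (x + t)) \<le> L2_norm (icc b) g"
proof -
  have gm [measurable]: "g \<in> borel_measurable borel" using L2_spaceD(1)[OF g] by simp
  have m: "(\<lambda>x. g (x + t)) \<in> borel_measurable (icc a)" by simp
  have "(\<integral>\<^sup>+x. ennreal ((cmod (g (x + t)))\<^sup>2) \<partial>icc a) = (\<integral>\<^sup>+x. indicator {t..a + t} x * ennreal ((cmod (g x))\<^sup>2) \<partial>lborel)"
    by (rule nn_integral_icc_shift) simp
  also have "\<dots> \<le> (\<integral>\<^sup>+x. indicator {0..b} x * ennreal ((cmod (g x))\<^sup>2) \<partial>lborel)"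
    using t by (intro nn_integral_mono) (auto simp: indicator_def)
  also have "\<dots> = (\<integral>\<^sup>+x. ennreal ((cmod (g x))\<^sup>2) \<partial>icc b)" by (rule nn_integral_icc[symmetric]) simp
  also have "\<dots> = ennreal ((L2_norm (icc b) g)\<^sup>2)" by (rule nn_integral_L2_norm[OF g])
  finally have *: "(\<integral>\<^sup>+x. ennreal ((cmod (g (x + t)))\<^sup>2) \<partial>icc a) \<le> ennreal ((L2_norm (icc b) g)\<^sup>2)" .
  show "(\<lambda>x. g (x + t)) \<in> L2_space (icc a)" "L2_norm (icc a) (\<lambda>x. g (x + t)) \<le> L2_norm (icc b) g"
    using L2_norm_leI[OF m *] by auto
qed

lemmas L2_icc_shift = L2_icc_subinterval[OF _ _ order_refl]

lemma L2_icc_mono: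
  assumes "g \<in> L2_space (icc b)" "a \<le> b"
  shows "g \<in> L2_space (icc a)" "L2_norm (icc a) g \<le> L2_norm (icc b) g"
  using L2_icc_subinterval[of g b 0 a] assms by auto

lemma L2_norm_icc_split:
  assumes g: "g \<in> L2_space (icc (a + t))" and a: "0 \<le> a" "0 \<le> t"
  shows "L2_norm (icc (a + t)) g \<le> L2_norm (icc t) g + L2_norm (icc a) (\<lambda>x. g (x + t))"
proof (rule L2_norm_leI(2)[OF L2_spaceD(1)[OF g]])
  have gm [measurable]: "g \<in> borel_measurable borel" using L2_spaceD(1)[OF g] by simp
  have gt: "g \<in> L2_space (icc t)" using L2_icc_mono[OF g] a by simp
  have "(\<integral>\<^sup>+x. ennreal ((cmod (g x))\<^sup>2) \<partial>icc (a + t)) = (\<integral>\<^sup>+x. indicator {0..a + t} x * ennreal ((cmod (g x))\<^sup>2) \<partial>lborel)"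
    by (rule nn_integral_icc) simp
  also have "\<dots> \<le> (\<integral>\<^sup>+x. indicator {0..t} x * ennreal ((cmod (g x))\<^sup>2) + indicator {t..a + t} x * ennreal ((cmod (g x))\<^sup>2) \<partial>lborel)"
    using a by (intro nn_integral_mono) (auto simp: indicator_def)
  also have "\<dots> = (\<integral>\<^sup>+x. ennreal ((cmod (g x))\<^sup>2) \<partial>icc t) + (\<integral>\<^sup>+x. ennreal ((cmod (g (x + t)))\<^sup>2) \<partial>icc a)"
    by (subst nn_integral_add)
       (simp_all add: nn_integral_icc[of _ t] nn_integral_icc_shift[of "\<lambda>x. ennreal ((cmod (g x))\<^sup>2)"])
  also have "\<dots> = ennreal ((L2_norm (icc t) g)\<^sup>2 + (L2_norm (icc a) (\<lambda>x. g (x + t)))\<^sup>2)"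
    by (simp add: nn_integral_L2_norm gt L2_icc_shift[OF g a(2)])
  also have "\<dots> \<le> ennreal ((L2_norm (icc t) g + L2_norm (icc a) (\<lambda>x. g (x + t)))\<^sup>2)"
    by (intro ennreal_leI) (simp add: power2_sum)
  finally show "(\<integral>\<^sup>+x. ennreal ((cmod (g x))\<^sup>2) \<partial>icc (a + t))
     \<le> ennreal ((L2_norm (icc t) g + L2_norm (icc a) (\<lambda>x. g (x + t)))\<^sup>2)" .
qed auto

lemma chi_eq_1_iff: "chi \<gamma> x = 1 \<longleftrightarrow> \<gamma> * x \<in> \<int>"
proof
  assume "chi \<gamma> x = 1"
  hence "exp (\<i> * complex_of_real (2 * pi * \<gamma> * x)) = 1" by (simp add: chi_def cis_conv_exp)
  then obtain n :: int where "2 * pi * \<gamma> * x = of_int (2 * n) * pi" by (auto simp: exp_eq_1)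
  hence "\<gamma> * x = of_int n" by simp
  thus "\<gamma> * x \<in> \<int>" by simp
next
  assume "\<gamma> * x \<in> \<int>"
  then obtain n :: int where "\<gamma> * x = of_int n" by (auto elim: Ints_cases)
  hence "2 * pi * \<gamma> * x = 2 * pi * of_int n" by (simp only: mult.assoc)
  hence "chi \<gamma> x = cis (2 * pi * of_int n)" by (simp only: chi_def)
  thus "chi \<gamma> x = 1" by (simp add: cis_multiple_2pi)
qed

text \<open>The value depends on \<open>\<gamma>\<close> modulo \<open>N\<close> only, so a minimum over finitely many residues does.\<close>

lemma chi_away_from_1:
  fixes N :: nat
  assumes N: "1 \<le> N"
  shows "\<exists>\<delta>>0. \<forall>\<gamma>::int. \<not> int N dvd \<gamma> \<longrightarrow> \<delta> \<le> cmod (int_chi \<gamma> (1 / N) - 1)"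
proof -
  define A where "A = (\<lambda>r::int. cmod (int_chi r (1 / N) - 1)) ` {1..<int N}"
  define \<delta> where "\<delta> = Min (insert 1 A)"
  have fin: "finite (insert 1 A)" by (simp add: A_def)
  have "0 < x" if "x \<in> insert 1 A" for x
  proof -
    have "int_chi r (1 / N) \<noteq> 1" if "1 \<le> r" "r < int N" for r :: int
    proof
      assume "int_chi r (1 / N) = 1"
      then obtain k :: int where "of_int r * (1 / real N) = of_int k" by (auto simp: chi_eq_1_iff elim: Ints_cases)
      hence "real_of_int r = of_int k * real N" using N by (simp add: field_simps)
      hence "real_of_int r = of_int (k * int N)" by simp
      hence r: "r = k * int N" by (simp only: of_int_eq_iff)
      hence "int N dvd r" by simp
      thus False using that by (auto dest: zdvd_imp_le)
    qed
    thus ?thesis using that by (auto simp: A_def)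
  qed
  hence "0 < \<delta>" unfolding \<delta>_def using fin Min_in[of "insert 1 A"] by blast
  moreover have "\<delta> \<le> cmod (int_chi \<gamma> (1 / N) - 1)" if "\<not> int N dvd \<gamma>" for \<gamma> :: int
  proof -
    have "of_int \<gamma> = real N * of_int (\<gamma> div int N) + of_int (\<gamma> mod int N)"
    proof -
      have "\<gamma> = int N * (\<gamma> div int N) + \<gamma> mod int N" by simp
      thus ?thesis by (metis of_int_add of_int_mult of_int_of_nat_eq)
    qed
    moreover have "chi (real N * of_int (\<gamma> div int N)) (1 / N) = 1"
      using N by (simp add: chi_eq_1_iff)
    ultimately have "int_chi \<gamma> (1 / N) = chi (of_int (\<gamma> mod int N)) (1 / N)"
      by (simp add: chi_add)
    moreover have "\<gamma> mod int N \<in> {1..<int N}"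
    proof -
      have "\<gamma> mod int N \<noteq> 0" using that by (simp add: dvd_eq_mod_eq_0)
      moreover have "0 \<le> \<gamma> mod int N" "\<gamma> mod int N < int N" using N by auto
      ultimately show ?thesis by auto
    qed
    hence "cmod (chi (of_int (\<gamma> mod int N)) (1 / N) - 1) \<in> A" by (auto simp: A_def)
    ultimately show ?thesis unfolding \<delta>_def using fin by (auto intro: Min_le)
  qed
  ultimately show ?thesis by blast
qed

lemma L2_sum_chi: "(\<lambda>x. \<Sum>n\<in>F. c n * chi (g n) x) \<in> L2_space (icc h)"
  by (intro L2_space_sum L2_space_cmult L2_chi)

lemma multiples_Riesz_basis:
  fixes N :: nat
  assumes N: "1 \<le> N"
  shows "finitary_Riesz_basis (icc (1 / N)) int_chi (multiples N)"
proof (rule finitary_Riesz_basis_image)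
  show "inj ((*) (int N))" using N by (auto simp: inj_def)
  have "(\<lambda>n::int. chi (of_int n / (1 / N))) = (\<lambda>n. chi (of_int (int N * n)))"
    by (simp add: mult.commute)
  thus "finitary_Riesz_basis (icc (1 / N)) (\<lambda>n. chi (of_int (int N * n))) UNIV"
    using Fourier_basis[of "1 / N"] N by simp
qed

text \<open>Step from one interval of length \<open>t\<close> to the next: if \<open>r\<close> is small on the first one and its increments over
distance \<open>t\<close> are small, then \<open>r\<close> is small everywhere, with a loss that is linear in the number of steps.\<close>

lemma norm_le_of_small_differences:
  assumes r: "r \<in> L2_space (icc (h + t))" and t: "0 < t" and h: "0 \<le> h"
    and small: "L2_norm (icc t) r \<le> \<epsilon>" "L2_norm (icc h) (\<lambda>x. r (x + t) - r x) \<le> \<epsilon>"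
    and s: "0 \<le> s" "s \<le> h + t" "s \<le> real (Suc k) * t"
  shows "L2_norm (icc s) r \<le> (2 * k + 1) * \<epsilon>"
  using s
proof (induction k arbitrary: s)
  case 0
  have "r \<in> L2_space (icc t)" using L2_icc_mono(1)[OF r] h by simp
  from L2_icc_mono(2)[OF this, of s] show ?case using 0 small(1) by simp
next
  case (Suc k)
  have e: "0 \<le> \<epsilon>" using small(1) L2_norm_nonneg order_trans by blast
  have rt: "r \<in> L2_space (icc t)" using L2_icc_mono(1)[OF r] h by simp
  show ?case
  proof (cases "s \<le> t")
    case True
    have "L2_norm (icc s) r \<le> 1 * \<epsilon>" using L2_icc_mono(2)[OF rt True] small(1) by simp
    also have "\<dots> \<le> (2 * Suc k + 1) * \<epsilon>" using e by (intro mult_right_mono) auto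
    finally show ?thesis by simp
  next
    case False
    define s' where "s' = s - t"
    have s': "s = s' + t" "0 \<le> s'" "s' \<le> h" "s' \<le> h + t" "s' \<le> real (Suc k) * t"
      using False Suc.prems t by (auto simp: s'_def algebra_simps)
    have rs: "r \<in> L2_space (icc (s' + t))" using L2_icc_mono(1)[OF r, of "s' + t"] s' by simp
    have rs': "r \<in> L2_space (icc s')" using L2_icc_mono(1)[OF r, of s'] s' by simp
    have rsh: "(\<lambda>x. r (x + t)) \<in> L2_space (icc h)" "r \<in> L2_space (icc h)"
      using L2_icc_shift(1)[OF r] L2_icc_mono(1)[OF r, of h] t by auto
    have D: "(\<lambda>x. r (x + t) - r x) \<in> L2_space (icc h)" by (intro L2_space_diff rsh)
    have "L2_norm (icc s') (\<lambda>x. r (x + t)) \<le> L2_norm (icc s') (\<lambda>x. r (x + t) - r x) + L2_norm (icc s') r"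
      using L2_norm_triangle[OF L2_icc_mono(1)[OF D s'(3)] rs'] by simp
    also have "\<dots> \<le> \<epsilon> + (2 * k + 1) * \<epsilon>"
      using L2_icc_mono(2)[OF D s'(3)] small(2) Suc.IH[OF s'(2,4,5)] by (intro add_mono) (auto simp: add.commute)
    finally have "L2_norm (icc s) r \<le> \<epsilon> + (\<epsilon> + (2 * k + 1) * \<epsilon>)"
      unfolding s'(1) using L2_norm_icc_split[OF rs s'(2)] t small(1) by fastforce
    thus ?thesis by (simp add: algebra_simps)
  qed
qed

text \<open>Upper bounds come for free: all frequencies are integers and the interval lies in \<open>[0,1]\<close>, where integer
frequencies are orthonormal. For the lower bound, the difference operator controls the coefficients of the
frequencies in \<open>\<Gamma>\<close>; subtracting that part leaves a Fourier series with frequencies in \<open>N Z\<close>,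
whose coefficients are visible on \<open>[0,1/N]\<close>.\<close>

lemma lengthening_bounds:
  fixes N :: nat and \<Gamma> :: "int set"
  assumes N: "1 \<le> N" and h: "0 \<le> h" "h + 1 / N \<le> 1"
    and ndvd: "\<forall>\<gamma>\<in>\<Gamma>. \<not> int N dvd \<gamma>"
    and R: "finitary_Riesz_basis (icc h) int_chi \<Gamma>"
  shows "\<exists>a>0. Riesz_bounds (icc (h + 1 / N)) int_chi (multiples N \<union> \<Gamma>) a 1"
proof -
  define t where "t = 1 / real N"
  have t: "0 < t" "h + t \<le> 1" "t \<le> 1" using N h by (auto simp: t_def)
  obtain a b' where a: "0 < a" and Ra: "Riesz_bounds (icc h) int_chi \<Gamma> a b'"
    using R unfolding finitary_Riesz_basis_def by auto
  have lo\<Gamma>: "a * (\<Sum>n\<in>F. (cmod (c n))\<^sup>2) \<le> (L2_norm (icc h) (\<lambda>x. \<Sum>n\<in>F. c n * int_chi n x))\<^sup>2"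
    if "finite F" "F \<subseteq> \<Gamma>" for F c
    using Ra that by (simp add: Riesz_bounds_def)
  obtain b b'' where b: "0 < b" and Rb: "Riesz_bounds (icc t) int_chi (multiples N) b b''"
    using multiples_Riesz_basis[OF N] unfolding finitary_Riesz_basis_def t_def by auto
  have loN: "b * (\<Sum>n\<in>F. (cmod (c n))\<^sup>2) \<le> (L2_norm (icc t) (\<lambda>x. \<Sum>n\<in>F. c n * int_chi n x))\<^sup>2"
    if "finite F" "F \<subseteq> multiples N" for F c
    using Rb that by (simp add: Riesz_bounds_def)
  obtain \<delta> where \<delta>: "0 < \<delta>" and \<delta>': "\<forall>\<gamma>::int. \<not> int N dvd \<gamma> \<longrightarrow> \<delta> \<le> cmod (int_chi \<gamma> t - 1)"
    using chi_away_from_1[OF N] unfolding t_def by auto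
  define K where "K = sqrt (4 / (a * \<delta>\<^sup>2))"
  \<comment> \<open>\<open>K\<^sup>2\<close> bounds the coefficients in \<open>\<Gamma>\<close>, and \<open>(1 + K)\<^sup>2 / b\<close> those in \<open>N Z\<close>, relative to the
      squared norm of the sum\<close>
  define C where "C = K\<^sup>2 + (1 + K)\<^sup>2 / b"
  have "0 < a * \<delta>\<^sup>2" using a \<delta> by simp
  hence K: "0 < K" "K\<^sup>2 = 4 / (a * \<delta>\<^sup>2)" by (auto simp: K_def)
  have C: "0 < C" unfolding C_def using K(1) b by (intro add_pos_nonneg) auto
  have "Riesz_bounds (icc (h + t)) int_chi (multiples N \<union> \<Gamma>) (1 / C) 1"
    unfolding Riesz_bounds_def
  proof (intro allI impI conjI)
    fix F c assume F: "finite F" "F \<subseteq> multiples N \<union> \<Gamma>"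
    let ?S = "\<lambda>A x. \<Sum>n\<in>A. c n * int_chi n x"
    let ?q = "\<lambda>A. \<Sum>n\<in>A. (cmod (c n))\<^sup>2"
    show "(L2_norm (icc (h + t)) (?S F))\<^sup>2 \<le> 1 * ?q F"
    proof -
      have "(L2_norm (icc (h + t)) (?S F))\<^sup>2 \<le> (L2_norm (icc 1) (?S F))\<^sup>2"
        using L2_icc_mono(2)[OF L2_sum_chi t(2)] by (intro power_mono) auto
      thus ?thesis using chi_Parseval[OF F(1), of c] by simp
    qed
    define F0 where "F0 = F \<inter> multiples N"
    define F1 where "F1 = F - multiples N"
    have F01: "finite F0" "finite F1" "F0 \<inter> F1 = {}" "F = F0 \<union> F1" "F0 \<subseteq> multiples N" "F1 \<subseteq> \<Gamma>"
      using F by (auto simp: F0_def F1_def)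
    have split: "?S F x = ?S F0 x + ?S F1 x" for x
      unfolding F01(4) by (rule sum.union_disjoint) (use F01 in auto)
    define m where "m = L2_norm (icc (h + t)) (?S F)"
    have m: "0 \<le> m" by (simp add: m_def)
    \<comment> \<open>the difference operator annihilates the characters from the lattice of multiples\<close>
    have diff: "?S F (x + t) - ?S F x = (\<Sum>n\<in>F1. (c n * (int_chi n t - 1)) * int_chi n x)" for x
    proof -
      have "int_chi n t = 1" if "n \<in> F0" for n
        using that F01(5) N by (auto simp: chi_eq_1_iff t_def)
      hence "?S F0 (x + t) = ?S F0 x" by (intro sum.cong) (auto simp: chi_add_arg)
      thus ?thesis unfolding split
        by (simp add: chi_add_arg algebra_simps flip: sum_subtractf)
    qed
    have "a * (\<delta>\<^sup>2 * ?q F1) \<le> a * (\<Sum>n\<in>F1. (cmod (c n * (int_chi n t - 1)))\<^sup>2)"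
    proof -
      have "\<delta>\<^sup>2 * (cmod (c n))\<^sup>2 \<le> (cmod (c n * (int_chi n t - 1)))\<^sup>2" if "n \<in> F1" for n
      proof -
        have "\<delta>\<^sup>2 \<le> (cmod (int_chi n t - 1))\<^sup>2" using \<delta> \<delta>' that F01(6) ndvd by (intro power_mono) auto
        from mult_right_mono[OF this, of "(cmod (c n))\<^sup>2"] show ?thesis
          by (simp add: norm_mult power_mult_distrib mult.commute)
      qed
      thus ?thesis using a by (simp add: sum_distrib_left sum_mono)
    qed
    also have "\<dots> \<le> (L2_norm (icc h) (\<lambda>x. ?S F (x + t) - ?S F x))\<^sup>2"
      unfolding diff by (rule lo\<Gamma>[OF F01(2,6)])
    also have "\<dots> \<le> (2 * m)\<^sup>2"
    proof (intro power_mono)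
      have "L2_norm (icc h) (\<lambda>x. ?S F (x + t) - ?S F x) \<le> L2_norm (icc h) (\<lambda>x. ?S F (x + t)) + L2_norm (icc h) (?S F)"
        by (rule L2_norm_triangle_diff[OF L2_icc_shift(1)]) (use t in \<open>auto intro: L2_sum_chi\<close>)
      moreover have "L2_norm (icc h) (\<lambda>x. ?S F (x + t)) \<le> m"
        unfolding m_def by (rule L2_icc_shift(2)[OF L2_sum_chi]) (use t in auto)
      moreover have "L2_norm (icc h) (?S F) \<le> m"
        unfolding m_def by (rule L2_icc_mono(2)[OF L2_sum_chi]) (use t in auto)
      ultimately show "L2_norm (icc h) (\<lambda>x. ?S F (x + t) - ?S F x) \<le> 2 * m" by linarith
    qed auto
    finally have "a * \<delta>\<^sup>2 * ?q F1 \<le> 4 * m\<^sup>2" by (simp add: power_mult_distrib mult.assoc)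
    hence q1: "?q F1 \<le> (K * m)\<^sup>2"
      unfolding power_mult_distrib K(2) using a \<delta> by (simp add: field_simps)
    have "L2_norm (icc t) (?S F1) \<le> L2_norm (icc 1) (?S F1)"
      by (rule L2_icc_mono(2)[OF L2_sum_chi t(3)])
    also have "\<dots> \<le> K * m"
      by (rule power2_le_imp_le) (use q1 chi_Parseval[OF F01(2), of c] K m in auto)
    finally have n1: "L2_norm (icc t) (?S F1) \<le> K * m" .
    have "L2_norm (icc t) (?S F0) \<le> L2_norm (icc t) (?S F) + L2_norm (icc t) (?S F1)"
      using L2_norm_triangle_diff[OF L2_sum_chi L2_sum_chi, of t c of_int F c of_int F1] by (simp add: split)
    also have "L2_norm (icc t) (?S F) \<le> m"
      unfolding m_def by (rule L2_icc_mono(2)[OF L2_sum_chi]) (use h in auto)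
    finally have "L2_norm (icc t) (?S F0) \<le> (1 + K) * m" using n1 by (simp add: algebra_simps)
    hence "(L2_norm (icc t) (?S F0))\<^sup>2 \<le> ((1 + K) * m)\<^sup>2" by (intro power_mono) auto
    hence "b * ?q F0 \<le> ((1 + K) * m)\<^sup>2" using loN[OF F01(1,5), of c] by linarith
    hence q0: "?q F0 \<le> (1 + K)\<^sup>2 / b * m\<^sup>2" 
      using b unfolding power_mult_distrib by (simp add: pos_le_divide_eq mult.commute)
    have "?q F = ?q F0 + ?q F1" unfolding F01(4) by (rule sum.union_disjoint) (use F01 in auto)
    also have "\<dots> \<le> C * m\<^sup>2" using q0 q1 by (simp add: C_def power_mult_distrib algebra_simps)
    finally show "1 / C * ?q F \<le> (L2_norm (icc (h + t)) (?S F))\<^sup>2"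
      using C by (simp add: m_def field_simps)
  qed
  moreover have "0 < 1 / C" using C by simp
  ultimately show ?thesis unfolding t_def by blast
qed

lemma lin_span_mono: "I \<subseteq> J \<Longrightarrow> lin_span f I \<subseteq> lin_span f J"
  by (auto simp: lin_span_def)

text \<open>Choose a combination \<open>G\<close> of frequencies in \<open>\<Gamma>\<close> whose difference approximates that of \<open>g\<close>, then a
Fourier polynomial \<open>P\<close> with frequencies in \<open>N Z\<close> that approximates \<open>g - G\<close> on \<open>[0,1/N]\<close>. The remainder is
small there and has small differences, hence is small on the whole interval.\<close>

lemma lengthening_complete:
  fixes N :: nat and \<Gamma> :: "int set"
  assumes N: "1 \<le> N" and h: "0 \<le> h" "h + 1 / N \<le> 1"
    and ndvd: "\<forall>\<gamma>\<in>\<Gamma>. \<not> int N dvd \<gamma>"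
    and R: "finitary_Riesz_basis (icc h) int_chi \<Gamma>"
    and g: "g \<in> L2_space (icc (h + 1 / N))"
  shows "g \<in> L2_closed_span (icc (h + 1 / N)) int_chi (multiples N \<union> \<Gamma>)"
  unfolding L2_closed_span_iff
proof (intro conjI allI impI g)
  fix e :: real assume e: "0 < e"
  define t where "t = 1 / real N"
  have t: "0 < t" "h + t \<le> 1" "real N * t = 1" using N h by (auto simp: t_def)
  define \<epsilon> where "\<epsilon> = e / (2 * real N)"
  have eps: "0 < \<epsilon>" using e N by (simp add: \<epsilon>_def)
  have g: "g \<in> L2_space (icc (h + t))" using g by (simp add: t_def)
  have gh: "g \<in> L2_space (icc h)" using L2_icc_mono(1)[OF g, of h] t by simp
  have "(\<lambda>x. g (x + t) - g x) \<in> L2_closed_span (icc h) int_chi \<Gamma>"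
    using R L2_space_diff[OF L2_icc_shift(1)[OF g] gh] t unfolding finitary_Riesz_basis_def by auto
  then obtain F d where F: "finite F" "F \<subseteq> \<Gamma>"
    "L2_norm (icc h) (\<lambda>x. g (x + t) - g x - (\<Sum>\<gamma>\<in>F. d \<gamma> * int_chi \<gamma> x)) < \<epsilon>"
    using eps unfolding L2_closed_span_def by blast
  define G where "G x = (\<Sum>\<gamma>\<in>F. (d \<gamma> / (int_chi \<gamma> t - 1)) * int_chi \<gamma> x)" for x
  have G: "G \<in> lin_span int_chi \<Gamma>"
    unfolding G_def[abs_def] by (rule lin_spanI[OF F(1,2)])
  have GL: "G \<in> L2_space (icc b)" for b unfolding G_def[abs_def] by (rule L2_sum_chi)
  have Gd: "G (x + t) - G x = (\<Sum>\<gamma>\<in>F. d \<gamma> * int_chi \<gamma> x)" for x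
  proof -
    obtain \<delta> where \<delta>: "0 < \<delta>" "\<forall>\<gamma>::int. \<not> int N dvd \<gamma> \<longrightarrow> \<delta> \<le> cmod (int_chi \<gamma> t - 1)"
      using chi_away_from_1[OF N] unfolding t_def by auto
    have ne: "int_chi \<gamma> t - 1 \<noteq> 0" if "\<gamma> \<in> F" for \<gamma>
    proof -
      have "\<delta> \<le> cmod (int_chi \<gamma> t - 1)" using that F(2) ndvd \<delta>(2) by auto
      thus ?thesis using \<delta>(1) by auto
    qed
    have "(d \<gamma> / (int_chi \<gamma> t - 1)) * int_chi \<gamma> (x + t) - (d \<gamma> / (int_chi \<gamma> t - 1)) * int_chi \<gamma> x
       = d \<gamma> * int_chi \<gamma> x" (is "?l = _") if "\<gamma> \<in> F" for \<gamma>
    proof -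
      have "?l = (d \<gamma> / (int_chi \<gamma> t - 1) * (int_chi \<gamma> t - 1)) * int_chi \<gamma> x"
        by (simp only: chi_add_arg algebra_simps mult_1_left)
      thus ?thesis using ne[OF that] by simp
    qed
    thus ?thesis unfolding G_def sum_subtractf[symmetric] by (intro sum.cong) auto
  qed
  have "(\<lambda>x. g x - G x) \<in> L2_space (icc t)"
    using L2_icc_mono(1)[OF g, of t] h by (intro L2_space_diff GL) simp
  hence "(\<lambda>x. g x - G x) \<in> L2_closed_span (icc t) int_chi (multiples N)"
    using multiples_Riesz_basis[OF N] by (simp add: finitary_Riesz_basis_def t_def)
  then obtain F' c where F': "finite F'" "F' \<subseteq> multiples N"
    "L2_norm (icc t) (\<lambda>x. g x - G x - (\<Sum>\<gamma>\<in>F'. c \<gamma> * int_chi \<gamma> x)) < \<epsilon>"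
    using eps unfolding L2_closed_span_def by blast
  define P where "P x = (\<Sum>\<gamma>\<in>F'. c \<gamma> * int_chi \<gamma> x)" for x
  have P: "P \<in> lin_span int_chi (multiples N)"
    unfolding P_def[abs_def] by (rule lin_spanI[OF F'(1,2)])
  have PL: "P \<in> L2_space (icc b)" for b unfolding P_def[abs_def] by (rule L2_sum_chi)
  have Pd: "P (x + t) = P x" for x
  proof -
    have "int_chi \<gamma> t = 1" if "\<gamma> \<in> F'" for \<gamma>
      using that F'(2) N by (auto simp: chi_eq_1_iff t_def)
    thus ?thesis unfolding P_def by (intro sum.cong) (auto simp: chi_add_arg)
  qed
  define r where "r x = g x - G x - P x" for x
  have r: "r \<in> L2_space (icc (h + t))"
    unfolding r_def[abs_def] by (intro L2_space_diff GL PL g)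
  have rd: "r (x + t) - r x = g (x + t) - g x - (\<Sum>\<gamma>\<in>F. d \<gamma> * int_chi \<gamma> x)" for x
    unfolding r_def Gd[symmetric] Pd by (simp add: algebra_simps)
  have "L2_norm (icc (h + t)) r \<le> (2 * real (N - 1) + 1) * \<epsilon>"
  proof (rule norm_le_of_small_differences[OF r t(1) h(1)])
    show "L2_norm (icc t) r \<le> \<epsilon>" using F'(3) unfolding r_def P_def by simp
    show "L2_norm (icc h) (\<lambda>x. r (x + t) - r x) \<le> \<epsilon>" unfolding rd using F(3) by simp
    show "h + t \<le> real (Suc (N - 1)) * t" using t N by simp
  qed (use h t in auto)
  also have "(2 * real (N - 1) + 1) * \<epsilon> < (2 * real N) * \<epsilon>"
    using N eps by (intro mult_strict_right_mono) auto
  also have "\<dots> = e" using N by (simp add: \<epsilon>_def)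
  finally have "L2_norm (icc (h + t)) (\<lambda>x. g x - (G x + P x)) < e"
    by (simp add: r_def[abs_def] diff_diff_eq)
  moreover have "(\<lambda>x. G x + P x) \<in> lin_span int_chi (multiples N \<union> \<Gamma>)"
    by (intro lin_span_add subsetD[OF lin_span_mono G] subsetD[OF lin_span_mono P]) auto
  ultimately show "\<exists>v\<in>lin_span int_chi (multiples N \<union> \<Gamma>).
      L2_norm (icc (h + 1 / N)) (\<lambda>x. g x - v x) < e"
    unfolding t_def by (rule bexI)
qed

lemma Riesz_basis_lengthen:
  fixes N :: nat and \<Gamma> :: "int set"
  assumes "1 \<le> N" and "0 \<le> h" "h + 1 / N \<le> 1"
    and "\<forall>\<gamma>\<in>\<Gamma>. \<not> int N dvd \<gamma>"
    and "finitary_Riesz_basis (icc h) int_chi \<Gamma>"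
  shows "finitary_Riesz_basis (icc (h + 1 / N)) int_chi (multiples N \<union> \<Gamma>)"
proof -
  obtain a where "0 < a" "Riesz_bounds (icc (h + 1 / N)) int_chi (multiples N \<union> \<Gamma>) a 1"
    using lengthening_bounds[OF assms] by blast
  moreover have "L2_space (icc (h + 1 / N)) \<subseteq>
      L2_closed_span (icc (h + 1 / N)) int_chi (multiples N \<union> \<Gamma>)"
    using lengthening_complete[OF assms] by blast
  ultimately show ?thesis
    unfolding finitary_Riesz_basis_def
    by (intro conjI exI[of _ a] exI[of _ 1]) (auto simp: L2_closed_span_iff)
qed

text \<open>Adding 1 to all frequencies multiplies the functions by a common factor of modulus 1.\<close>

lemma Riesz_basis_translate:
  fixes \<Gamma> :: "int set"
  assumes R: "finitary_Riesz_basis (icc h) int_chi \<Gamma>"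
  shows "finitary_Riesz_basis (icc h) int_chi ((\<lambda>\<gamma>. \<gamma> + 1) ` \<Gamma>)"
proof (rule finitary_Riesz_basis_image)
  have "finitary_Riesz_basis (icc h) (\<lambda>\<gamma> x. chi 1 x * int_chi \<gamma> x) \<Gamma>"
    by (rule finitary_Riesz_basis_unimodular[OF R]) auto
  thus "finitary_Riesz_basis (icc h) (\<lambda>\<gamma>. chi (of_int (\<gamma> + 1))) \<Gamma>"
    by (rule finitary_Riesz_basis_cong) (simp add: chi_add mult.commute)
qed auto

text \<open>After \<open>j\<close> steps the residues modulo \<open>N\<close> are among \<open>0, \<dots>, j\<close>; the translation by 1 moves them to
\<open>1, \<dots>, j + 1\<close>. This avoids the multiples of \<open>N\<close> as long as \<open>j + 1 < N\<close>.\<close>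

lemma Riesz_basis_lengthen_iterate:
  fixes N j :: nat and \<Gamma> :: "int set"
  assumes N: "1 \<le> N" and h: "0 \<le> h"
    and dvd: "\<forall>\<gamma>\<in>\<Gamma>. int N dvd \<gamma>"
    and R: "finitary_Riesz_basis (icc h) int_chi \<Gamma>"
    and j: "j < N" "h + j / N \<le> 1"
  shows "\<exists>\<Gamma>'. (\<forall>\<gamma>\<in>\<Gamma>'. \<gamma> mod int N \<le> int j) \<and>
     finitary_Riesz_basis (icc (h + j / N)) int_chi \<Gamma>'"
  using j
proof (induction j)
  case 0
  thus ?case using dvd R by (intro exI[of _ \<Gamma>]) auto
next
  case (Suc j)
  have eq: "h + real (Suc j) / N = (h + j / N) + 1 / N" by (simp add: add_divide_distrib)
  have le: "h + j / N \<le> 1" using Suc.prems(2) unfolding eq by (smt (verit) divide_nonneg_nonneg of_nat_0_le_iff)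
  obtain \<Delta> where \<Delta>: "\<forall>\<gamma>\<in>\<Delta>. \<gamma> mod int N \<le> int j"
     "finitary_Riesz_basis (icc (h + j / N)) int_chi \<Delta>"
    using Suc.IH[OF _ le] Suc.prems(1) by auto
  have res: "(\<gamma> + 1) mod int N = \<gamma> mod int N + 1" if "\<gamma> \<in> \<Delta>" for \<gamma>
  proof -
    have "\<gamma> mod int N + 1 < int N" "0 \<le> \<gamma> mod int N + 1"
      using \<Delta>(1) that Suc.prems(1) N by (auto simp: add_nonneg_nonneg)
    hence "(\<gamma> mod int N + 1) mod int N = \<gamma> mod int N + 1" by (simp add: mod_pos_pos_trivial)
    thus ?thesis by (simp add: mod_add_left_eq)
  qed
  let ?\<Delta> = "(\<lambda>\<gamma>. \<gamma> + 1) ` \<Delta>"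
  have "\<forall>\<gamma>\<in>?\<Delta>. \<not> int N dvd \<gamma>"
    using res N by (auto simp: dvd_eq_mod_eq_0 add_nonneg_eq_0_iff)
  from Riesz_basis_lengthen[OF N _ _ this Riesz_basis_translate[OF \<Delta>(2)]] h Suc.prems(2)
  have "finitary_Riesz_basis (icc (h + real (Suc j) / N)) int_chi (multiples N \<union> ?\<Delta>)"
    unfolding eq by simp
  moreover have "\<forall>\<gamma>\<in>multiples N \<union> ?\<Delta>. \<gamma> mod int N \<le> int (Suc j)"
    using res \<Delta>(1) by auto
  ultimately show ?case by blast
qed

text \<open>Rational \<open>h\<close> have multiples with fractional part 0; for irrational ones the fractional parts of the
multiples are dense.\<close>

lemma small_fractional_part:
  fixes h :: real
  shows "\<exists>N::nat. 1 \<le> N \<and> frac (real N * h) \<le> 1/4"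
proof (cases "h \<in> \<rat>")
  case True
  then obtain p q :: int where pq: "q > 0" "h = of_int p / of_int q" by (auto elim: Rats_cases')
  hence "real (nat q) * h = of_int p" by simp
  hence "frac (real (nat q) * h) = 0" by (simp only: frac_of_int)
  thus ?thesis using pq by (intro exI[of _ "nat q"]) auto
next
  case False
  obtain k where k: "k > 0" "\<bar>frac (real k * h) - 1/8\<bar> < 1/8"
    using Kronecker_approx_1_explicit[OF False, of "1/8" "1/8"] by auto
  have "frac (real k * h) \<le> 1/4" using k(2) by linarith
  thus ?thesis using k(1) by (intro exI[of _ k]) simp
qed

text \<open>The starting point of the construction when \<open>N h\<close> is an integer.\<close>

lemma empty_Riesz_basis_icc_0: "finitary_Riesz_basis (icc 0) f {}"
proof -
  have "L2_norm (icc 0) g = 0" if "g \<in> borel_measurable borel" for g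
  proof -
    have "AE x in icc 0. g x = 0"
      unfolding AE_icc using AE_lborel_singleton[of "0::real"] by eventually_elim auto
    hence "L2_norm (icc 0) g = L2_norm (icc 0) (\<lambda>x. 0)" using that by (intro L2_norm_cong_AE(1)) auto
    thus ?thesis by simp
  qed
  hence "L2_closed_span (icc 0) f {} = L2_space (icc 0)"
    by (auto simp: L2_closed_span_def L2_space_def)
  thus ?thesis
    by (auto simp: finitary_Riesz_basis_def Riesz_bounds_def intro!: exI[of _ 1])
qed

theorem integer_Riesz_basis_interval:
  assumes h: "0 < h" "h \<le> 1"
  shows "\<exists>\<Gamma>::int set. finitary_Riesz_basis (icc h) int_chi \<Gamma>"
proof (cases "h = 1")
  case True
  thus ?thesis using Fourier_basis[of 1] by auto
next
  case False
  obtain N :: nat where N: "1 \<le> N" "frac (N * h) \<le> 1/4" using small_fractional_part by blast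
  define m where "m = nat \<lfloor>N * h\<rfloor>"
  define h0 where "h0 = frac (N * h) / N"
  have Nh: "real N * h = m + frac (N * h)" using N h by (simp add: m_def frac_def)
  have h_eq: "h = h0 + m / N" using Nh N by (simp add: h0_def field_simps)
  have h0: "0 \<le> h0" by (simp add: h0_def)
  have "real N * h < N" using N h False by simp
  hence m: "m < N" using Nh frac_ge_0[of "N * h"] by linarith
  have "\<exists>\<Gamma>::int set. (\<forall>\<gamma>\<in>\<Gamma>. int N dvd \<gamma>) \<and> finitary_Riesz_basis (icc h0) int_chi \<Gamma>"
  proof (cases "h0 = 0")
    case True
    thus ?thesis using empty_Riesz_basis_icc_0 by (intro exI[of _ "{}"]) auto
  next
    case False
    have "pi * N * h0 = pi * frac (N * h)" using N by (simp add: h0_def)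
    also have "\<dots> \<le> pi * (1/4)" using N(2) by (intro mult_left_mono) auto
    also have "\<dots> < 1" using pi_less_4 by simp
    finally show ?thesis using short_interval_Riesz_basis[OF N(1), of h0] False h0 by simp
  qed
  then obtain \<Gamma> :: "int set" where "\<forall>\<gamma>\<in>\<Gamma>. int N dvd \<gamma>" "finitary_Riesz_basis (icc h0) int_chi \<Gamma>"
    by blast
  from Riesz_basis_lengthen_iterate[OF N(1) h0 this m] h(2) show ?thesis unfolding h_eq by auto
qed

section \<open>Skew products of Riesz bases\<close>

lemma L2_tensor:
  assumes MN: "finite_measure N" "finite_measure M"
    and u: "u \<in> L2_space N" and v: "v \<in> L2_space M"
  shows "(\<lambda>z. u (fst z) * v (snd z)) \<in> L2_space (N \<Otimes>\<^sub>M M)"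
    "L2_norm (N \<Otimes>\<^sub>M M) (\<lambda>z. u (fst z) * v (snd z)) = L2_norm N u * L2_norm M v"
proof -
  interpret N: finite_measure N by fact
  interpret M: finite_measure M by fact
  interpret P: pair_sigma_finite N M ..
  note [measurable] = L2_spaceD(1)[OF u] L2_spaceD(1)[OF v]
  have m: "(\<lambda>z. u (fst z) * v (snd z)) \<in> borel_measurable (N \<Otimes>\<^sub>M M)" by measurable
  have "(\<integral>\<^sup>+z. ennreal ((cmod (u (fst z) * v (snd z)))\<^sup>2) \<partial>(N \<Otimes>\<^sub>M M))
      = (\<integral>\<^sup>+x. \<integral>\<^sup>+y. ennreal ((cmod (u x))\<^sup>2) * ennreal ((cmod (v y))\<^sup>2) \<partial>M \<partial>N)"
    by (subst M.nn_integral_fst[symmetric])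
       (auto simp: norm_mult power_mult_distrib ennreal_mult)
  also have "\<dots> = ennreal ((L2_norm N u * L2_norm M v)\<^sup>2)"
    by (simp add: nn_integral_cmult nn_integral_multc nn_integral_L2_norm u v power_mult_distrib ennreal_mult)
  finally have *: "(\<integral>\<^sup>+z. ennreal ((cmod (u (fst z) * v (snd z)))\<^sup>2) \<partial>(N \<Otimes>\<^sub>M M)) = ennreal ((L2_norm N u * L2_norm M v)\<^sup>2)" .
  show "(\<lambda>z. u (fst z) * v (snd z)) \<in> L2_space (N \<Otimes>\<^sub>M M)"
    "L2_norm (N \<Otimes>\<^sub>M M) (\<lambda>z. u (fst z) * v (snd z)) = L2_norm N u * L2_norm M v"
    using L2_normI[OF m *] by auto
qed

text \<open>The factor \<open>w n\<close> twists the product of the two families; it may depend on the index of the first family and on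
the point of the second space.\<close>

definition skew_product ::
  "('j \<Rightarrow> 'b \<Rightarrow> complex) \<Rightarrow> ('j \<Rightarrow> 'a \<Rightarrow> complex) \<Rightarrow> ('i \<Rightarrow> 'a \<Rightarrow> complex) \<Rightarrow> 'j \<times> 'i \<Rightarrow> 'b \<times> 'a \<Rightarrow> complex" where
  "skew_product g w f = (\<lambda>(n, m) (x, y). g n x * (w n y * f m y))"

locale skew_product_bases =
  fixes N :: "'b measure" and M :: "'a measure"
    and g :: "'j \<Rightarrow> 'b \<Rightarrow> complex" and w :: "'j \<Rightarrow> 'a \<Rightarrow> complex" and f :: "'i \<Rightarrow> 'a \<Rightarrow> complex"
    and J :: "'j set" and I :: "'i set"
  assumes fin: "finite_measure N" "finite_measure M"
    and Rg: "finitary_Riesz_basis N g J" and Rf: "finitary_Riesz_basis M f I"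
    and w: "\<And>n. n \<in> J \<Longrightarrow> w n \<in> borel_measurable M" "\<And>n y. cmod (w n y) = 1"
begin

sublocale N: finite_measure N by (rule fin)
sublocale M: finite_measure M by (rule fin)
sublocale P: pair_sigma_finite N M ..

abbreviation "\<phi> \<equiv> skew_product g w f"

lemma g_L2: "n \<in> J \<Longrightarrow> g n \<in> L2_space N" and f_L2: "m \<in> I \<Longrightarrow> f m \<in> L2_space M"
  using Rg Rf by (auto simp: finitary_Riesz_basis_def)

lemma finite_product: "finite_measure (N \<Otimes>\<^sub>M M)"
  by (rule finite_measure_pair_measure) (rule fin)+

lemma w_L2: "n \<in> J \<Longrightarrow> u \<in> L2_space M \<Longrightarrow> (\<lambda>y. w n y * u y) \<in> L2_space M"
  by (rule L2_space_mult_bounded(1)[where B=1]) (auto simp: w)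

lemma cnj_w_L2:
  assumes "n \<in> J" "u \<in> L2_space M"
  shows "(\<lambda>y. cnj (w n y) * u y) \<in> L2_space M"
proof (rule L2_space_mult_bounded(1)[OF assms(2), where B=1])
  show "(\<lambda>y. cnj (w n y)) \<in> borel_measurable M"
    using measurable_compose[OF w(1)[OF assms(1)], of cnj borel] borel_measurable_continuous_onI[of cnj]
    by (simp add: continuous_on_cnj)
qed (simp add: w)

lemma skew_product_L2: "p \<in> J \<times> I \<Longrightarrow> \<phi> p \<in> L2_space (N \<Otimes>\<^sub>M M)"
proof -
  assume "p \<in> J \<times> I"
  then obtain n m where p: "p = (n, m)" "n \<in> J" "m \<in> I" by auto
  have "(\<lambda>z. g n (fst z) * (w n (snd z) * f m (snd z))) \<in> L2_space (N \<Otimes>\<^sub>M M)"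
    using L2_tensor(1)[OF fin g_L2[OF p(2)] w_L2[OF p(2) f_L2[OF p(3)]]] .
  thus ?thesis by (simp add: p skew_product_def case_prod_unfold)
qed

text \<open>For fixed \<open>y\<close> a finite sum is an expansion in \<open>g\<close> whose coefficients are, up to unimodular factors,
  expansions in \<open>f\<close>; so the two pairs of bounds multiply.\<close>

lemma skew_product_bounds:
  assumes ab: "0 < a" "0 < b" "Riesz_bounds N g J a b" and cd: "0 < c" "0 < d" "Riesz_bounds M f I c d"
  shows "Riesz_bounds (N \<Otimes>\<^sub>M M) \<phi> (J \<times> I) (a * c) (b * d)"
  unfolding Riesz_bounds_def
proof (intro allI impI)
  fix F and k :: "'j \<times> 'i \<Rightarrow> complex" assume F: "finite F" "F \<subseteq> J \<times> I"
  define A where "A = fst ` F"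
  define B where "B = snd ` F"
  have AB: "finite A" "finite B" "A \<subseteq> J" "B \<subseteq> I" "F \<subseteq> A \<times> B"
    using F by (auto simp: A_def B_def intro: rev_image_eqI)
  define l where "l p = (if p \<in> F then k p else 0)" for p
  define u where "u n y = (\<Sum>m\<in>B. l (n, m) * f m y)" for n y
  have uL: "u n \<in> L2_space M" for n
    unfolding u_def[abs_def] by (intro L2_space_sum L2_space_cmult) (use AB f_L2 in auto)
  define S where "S z = (\<Sum>p\<in>F. k p * \<phi> p z)" for z
  have SL: "S \<in> L2_space (N \<Otimes>\<^sub>M M)"
    unfolding S_def[abs_def] by (intro L2_space_sum L2_space_cmult) (use F skew_product_L2 in auto)
  note [measurable] = L2_spaceD(1)[OF SL] L2_spaceD(1)[OF uL]
  have S: "S (x, y) = (\<Sum>n\<in>A. (w n y * u n y) * g n x)" for x y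
  proof -
    have "S (x, y) = (\<Sum>p\<in>A\<times>B. l p * \<phi> p (x, y))"
      unfolding S_def using AB by (intro sum.mono_neutral_cong_left) (auto simp: l_def)
    also have "\<dots> = (\<Sum>n\<in>A. \<Sum>m\<in>B. l (n, m) * (g n x * (w n y * f m y)))"
      by (simp add: sum.cartesian_product skew_product_def case_prod_unfold)
    also have "\<dots> = (\<Sum>n\<in>A. (w n y * u n y) * g n x)"
      by (simp add: u_def sum_distrib_left sum_distrib_right mult_ac)
    finally show ?thesis .
  qed
  define Q where "Q = (\<Sum>p\<in>F. (cmod (k p))\<^sup>2)"
  have Q: "(\<Sum>n\<in>A. \<Sum>m\<in>B. (cmod (l (n, m)))\<^sup>2) = Q"
  proof -
    have "(\<Sum>n\<in>A. \<Sum>m\<in>B. (cmod (l (n, m)))\<^sup>2) = (\<Sum>p\<in>A\<times>B. (cmod (l p))\<^sup>2)"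
      by (simp add: sum.cartesian_product case_prod_unfold)
    also have "\<dots> = Q" unfolding Q_def
      using AB by (intro sum.mono_neutral_cong_right) (auto simp: l_def)
    finally show ?thesis .
  qed
  define V where "V y = (\<Sum>n\<in>A. (cmod (u n y))\<^sup>2)" for y
  have [measurable]: "V \<in> borel_measurable M" unfolding V_def by measurable
  have V0: "0 \<le> V y" for y unfolding V_def by (intro sum_nonneg) auto
  have intS: "ennreal ((L2_norm (N \<Otimes>\<^sub>M M) S)\<^sup>2) = (\<integral>\<^sup>+y. ennreal ((L2_norm N (\<lambda>x. S (x, y)))\<^sup>2) \<partial>M)"
  proof -
    have "ennreal ((L2_norm (N \<Otimes>\<^sub>M M) S)\<^sup>2) = (\<integral>\<^sup>+y. \<integral>\<^sup>+x. ennreal ((cmod (S (x, y)))\<^sup>2) \<partial>N \<partial>M)"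
      unfolding nn_integral_L2_norm[OF SL, symmetric] by (rule P.nn_integral_snd[symmetric]) measurable
    also have "\<dots> = (\<integral>\<^sup>+y. ennreal ((L2_norm N (\<lambda>x. S (x, y)))\<^sup>2) \<partial>M)"
    proof (intro nn_integral_cong nn_integral_L2_norm)
      show "(\<lambda>x. S (x, y)) \<in> L2_space N" for y
        unfolding S by (intro L2_space_sum L2_space_cmult) (use AB g_L2 in auto)
    qed
    finally show ?thesis .
  qed
  have lowS: "a * V y \<le> (L2_norm N (\<lambda>x. S (x, y)))\<^sup>2" and upS: "(L2_norm N (\<lambda>x. S (x, y)))\<^sup>2 \<le> b * V y" for y
    using ab(3)[unfolded Riesz_bounds_def, rule_format, OF AB(1,3), of "\<lambda>n. w n y * u n y"]
    unfolding S V_def by (auto simp: norm_mult w)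
  define W where "W = (\<Sum>n\<in>A. (L2_norm M (u n))\<^sup>2)"
  have W0: "0 \<le> W" unfolding W_def by (intro sum_nonneg) auto
  have intV: "(\<integral>\<^sup>+y. ennreal (V y) \<partial>M) = ennreal W"
    unfolding V_def W_def
    by (subst sum_ennreal[symmetric], simp, subst nn_integral_sum)
       (auto simp: nn_integral_L2_norm uL sum_ennreal)
  have "ennreal (a * W) = (\<integral>\<^sup>+y. ennreal (a * V y) \<partial>M)"
    using ab V0 W0 by (simp add: ennreal_mult nn_integral_cmult intV)
  also have "\<dots> \<le> ennreal ((L2_norm (N \<Otimes>\<^sub>M M) S)\<^sup>2)"
    unfolding intS by (intro nn_integral_mono ennreal_leI lowS)
  finally have lo: "a * W \<le> (L2_norm (N \<Otimes>\<^sub>M M) S)\<^sup>2" by simp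
  have "ennreal ((L2_norm (N \<Otimes>\<^sub>M M) S)\<^sup>2) \<le> (\<integral>\<^sup>+y. ennreal (b * V y) \<partial>M)"
    unfolding intS by (intro nn_integral_mono ennreal_leI upS)
  also have "\<dots> = ennreal (b * W)"
    using ab V0 W0 by (simp add: ennreal_mult nn_integral_cmult intV)
  finally have up: "(L2_norm (N \<Otimes>\<^sub>M M) S)\<^sup>2 \<le> b * W" using ab W0 by simp
  have "c * (\<Sum>m\<in>B. (cmod (l (n, m)))\<^sup>2) \<le> (L2_norm M (u n))\<^sup>2"
       "(L2_norm M (u n))\<^sup>2 \<le> d * (\<Sum>m\<in>B. (cmod (l (n, m)))\<^sup>2)" for n
    using cd(3)[unfolded Riesz_bounds_def, rule_format, OF AB(2,4), of "\<lambda>m. l (n, m)"]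
    unfolding u_def[abs_def] by auto
  hence "c * Q \<le> W" "W \<le> d * Q"
    unfolding W_def Q[symmetric] sum_distrib_left[of c] sum_distrib_left[of d] by (auto intro!: sum_mono)
  hence "a * (c * Q) \<le> a * W" "b * W \<le> b * (d * Q)" using ab by auto
  thus "a * c * (\<Sum>n\<in>F. (cmod (k n))\<^sup>2) \<le> (L2_norm (N \<Otimes>\<^sub>M M) (\<lambda>x. \<Sum>n\<in>F. k n * \<phi> n x))\<^sup>2 \<and>
       (L2_norm (N \<Otimes>\<^sub>M M) (\<lambda>x. \<Sum>n\<in>F. k n * \<phi> n x))\<^sup>2 \<le> b * d * (\<Sum>n\<in>F. (cmod (k n))\<^sup>2)"
    using lo up unfolding S_def[abs_def] Q_def by (simp add: mult.assoc)
qed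

abbreviation "V \<equiv> L2_closed_span (N \<Otimes>\<^sub>M M) \<phi> (J \<times> I)"

lemma phi_L2: "\<forall>p\<in>J \<times> I. \<phi> p \<in> L2_space (N \<Otimes>\<^sub>M M)"
  using skew_product_L2 by blast

text \<open>Approximating \<open>u\<close> by sums over \<open>f\<close> suffices, since multiplication by \<open>w n\<close> preserves norms.\<close>

lemma tensor_w_in_span:
  assumes n: "n \<in> J" and u: "u \<in> L2_space M"
  shows "(\<lambda>z. g n (fst z) * (w n (snd z) * u (snd z))) \<in> V"
proof (rule closed_span_limit[OF phi_L2])
  show "(\<lambda>z. g n (fst z) * (w n (snd z) * u (snd z))) \<in> L2_space (N \<Otimes>\<^sub>M M)"
    by (rule L2_tensor(1)[OF fin g_L2[OF n] w_L2[OF n u]])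
  fix e :: real assume e: "0 < e"
  define K where "K = L2_norm N (g n) + 1"
  have K: "0 < K" unfolding K_def by (simp add: add_nonneg_pos)
  have "u \<in> L2_closed_span M f I" using Rf u by (simp add: finitary_Riesz_basis_def)
  moreover have "0 < e / K" using e K by simp
  ultimately obtain F c where F: "finite F" "F \<subseteq> I" "L2_norm M (\<lambda>y. u y - (\<Sum>m\<in>F. c m * f m y)) < e / K"
    unfolding L2_closed_span_def by blast
  let ?v = "\<lambda>y. \<Sum>m\<in>F. c m * f m y"
  have vL: "?v \<in> L2_space M" using F f_L2 by (intro L2_space_sum L2_space_cmult) auto
  let ?h = "\<lambda>z. \<Sum>m\<in>F. c m * \<phi> (n, m) z"
  have "?h \<in> V"
    by (intro closed_span_sum[OF phi_L2] closed_span_lin_span[OF phi_L2] lin_span_base) (use n F in auto)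
  moreover have "L2_norm (N \<Otimes>\<^sub>M M) (\<lambda>z. g n (fst z) * (w n (snd z) * u (snd z)) - ?h z) < e"
  proof -
    have "g n (fst z) * (w n (snd z) * u (snd z)) - ?h z = g n (fst z) * (w n (snd z) * (u (snd z) - ?v (snd z)))" for z
      by (simp add: skew_product_def case_prod_unfold right_diff_distrib sum_distrib_left mult_ac)
    hence "L2_norm (N \<Otimes>\<^sub>M M) (\<lambda>z. g n (fst z) * (w n (snd z) * u (snd z)) - ?h z)
        = L2_norm N (g n) * L2_norm M (\<lambda>y. w n y * (u y - ?v y))"
      using L2_tensor(2)[OF fin g_L2[OF n] w_L2[OF n L2_space_diff[OF u vL]]] by simp
    also have "\<dots> = L2_norm N (g n) * L2_norm M (\<lambda>y. u y - ?v y)"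
      by (simp add: L2_norm_unimodular w)
    also have "\<dots> \<le> L2_norm N (g n) * (e / K)" using F(3) by (intro mult_left_mono) auto
    also have "\<dots> < K * (e / K)" using e K by (intro mult_strict_right_mono) (auto simp: K_def)
    finally show ?thesis using K by simp
  qed
  ultimately show "\<exists>h\<in>V. L2_norm (N \<Otimes>\<^sub>M M) (\<lambda>z. g n (fst z) * (w n (snd z) * u (snd z)) - h z) < e"
    by (intro bexI[of _ ?h])
qed

text \<open>The conjugate of \<open>w n\<close> can be absorbed into the second factor, which removes the twist; then the first
  factor is approximated by sums over \<open>g\<close>.\<close>

lemma tensor_in_span:
  assumes v: "v \<in> L2_space N" and u: "u \<in> L2_space M"
  shows "(\<lambda>z. v (fst z) * u (snd z)) \<in> V"
proof (rule closed_span_limit[OF phi_L2])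
  show "(\<lambda>z. v (fst z) * u (snd z)) \<in> L2_space (N \<Otimes>\<^sub>M M)" by (rule L2_tensor(1)[OF fin v u])
  fix e :: real assume e: "0 < e"
  \<comment> \<open>the summand 1 keeps the quotient \<open>e / K\<close> defined when \<open>u\<close> vanishes\<close>
  define K where "K = L2_norm M u + 1"
  have K: "0 < K" unfolding K_def by (simp add: add_nonneg_pos)
  have "v \<in> L2_closed_span N g J" using Rg v by (simp add: finitary_Riesz_basis_def)
  moreover have "0 < e / K" using e K by simp
  ultimately obtain F c where F: "finite F" "F \<subseteq> J" "L2_norm N (\<lambda>x. v x - (\<Sum>n\<in>F. c n * g n x)) < e / K"
    unfolding L2_closed_span_def by blast
  let ?v = "\<lambda>x. \<Sum>n\<in>F. c n * g n x"
  have vL: "?v \<in> L2_space N" using F g_L2 by (intro L2_space_sum L2_space_cmult) auto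
  have gu: "(\<lambda>z. g n (fst z) * u (snd z)) \<in> V" if n: "n \<in> J" for n
  proof -
    have "w n y * cnj (w n y) = 1" for y
      using w(2)[of n y] by (simp flip: complex_norm_square)
    hence "w n y * (cnj (w n y) * u y) = u y" for y by (simp only: mult.assoc[symmetric] mult_1_left)
    thus ?thesis using tensor_w_in_span[OF n cnj_w_L2[OF n u]] by (simp only:)
  qed
  let ?h = "\<lambda>z. \<Sum>n\<in>F. c n * (g n (fst z) * u (snd z))"
  have "?h \<in> V"
    by (intro closed_span_sum[OF phi_L2] gu) (use F in auto)
  moreover have "L2_norm (N \<Otimes>\<^sub>M M) (\<lambda>z. v (fst z) * u (snd z) - ?h z) < e"
  proof -
    have "v (fst z) * u (snd z) - ?h z = (v (fst z) - ?v (fst z)) * u (snd z)" for z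
      by (simp only: left_diff_distrib sum_distrib_right mult.assoc)
    hence "L2_norm (N \<Otimes>\<^sub>M M) (\<lambda>z. v (fst z) * u (snd z) - ?h z) = L2_norm N (\<lambda>x. v x - ?v x) * L2_norm M u"
      using L2_tensor(2)[OF fin L2_space_diff[OF v vL] u] by simp
    also have "\<dots> \<le> (e / K) * L2_norm M u" using F(3) by (intro mult_right_mono) auto
    also have "\<dots> < (e / K) * K" using e K by (intro mult_strict_left_mono) (auto simp: K_def)
    finally show ?thesis using K by simp
  qed
  ultimately show "\<exists>h\<in>V. L2_norm (N \<Otimes>\<^sub>M M) (\<lambda>z. v (fst z) * u (snd z) - h z) < e"
    by (intro bexI[of _ ?h])
qed

text \<open>The products of a function of \<open>x\<close> and a function of \<open>y\<close> include the indicators of measurable rectangles, which generate the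
product measure.\<close>

theorem skew_product_Riesz_basis: "finitary_Riesz_basis (N \<Otimes>\<^sub>M M) \<phi> (J \<times> I)"
proof -
  obtain a b where ab: "0 < a" "0 < b" "Riesz_bounds N g J a b"
    using Rg by (auto simp: finitary_Riesz_basis_def)
  obtain c d where cd: "0 < c" "0 < d" "Riesz_bounds M f I c d"
    using Rf by (auto simp: finitary_Riesz_basis_def)
  interpret NM: finite_measure "N \<Otimes>\<^sub>M M" by (rule finite_product)
  have ind: "(indicator A :: _ \<Rightarrow> complex) \<in> L2_space N" if "A \<in> sets N" for A
    using that by (intro N.L2_space_bounded[where B=1]) (auto simp: indicator_def)
  have ind': "(indicator A :: _ \<Rightarrow> complex) \<in> L2_space M" if "A \<in> sets M" for A
    using that by (intro M.L2_space_bounded[where B=1]) (auto simp: indicator_def)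
  have "V = L2_space (N \<Otimes>\<^sub>M M)"
  proof (rule NM.closed_span_eq_L2_spaceI[OF phi_L2])
    let ?G = "{A \<times> B | A B. A \<in> sets N \<and> B \<in> sets M}"
    show "Int_stable ?G" by (rule Int_stable_pair_measure_generator)
    show "?G \<subseteq> Pow (space (N \<Otimes>\<^sub>M M))"
      using pair_measure_closed[of N M] by (simp add: space_pair_measure)
    show "sets (N \<Otimes>\<^sub>M M) = sigma_sets (space (N \<Otimes>\<^sub>M M)) ?G"
      by (simp add: sets_pair_measure space_pair_measure)
    have "(\<lambda>x. 1 :: complex) \<in> L2_space N" "(\<lambda>y. 1 :: complex) \<in> L2_space M"
      by (auto intro: N.L2_space_bounded[where B=1] M.L2_space_bounded[where B=1])
    from tensor_in_span[OF this] show "(\<lambda>x. 1) \<in> V" by simp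
    fix C assume "C \<in> ?G"
    then obtain A B where C: "C = A \<times> B" "A \<in> sets N" "B \<in> sets M" by auto
    have "(\<lambda>z. indicator A (fst z) * indicator B (snd z)) = (indicator C :: _ \<Rightarrow> complex)"
      by (auto simp: C indicator_def)
    thus "indicator C \<in> V" using tensor_in_span[OF ind[OF C(2)] ind'[OF C(3)]] by simp
  qed
  thus ?thesis unfolding finitary_Riesz_basis_def
    using phi_L2 skew_product_bounds[OF ab cd] ab cd
    by (intro conjI exI[of _ "a * c"] exI[of _ "b * d"]) auto
qed

end

section \<open>Triangular systems on the unit cube\<close>

lemma prob_space_icc_1: "prob_space (icc 1)"
  by (rule prob_spaceI) (simp add: emeasure_icc)

lemma one_point_Riesz_basis:
  fixes f :: "'b \<Rightarrow> 'a \<Rightarrow> complex"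
  assumes "prob_space M" "space M = {a}" "\<And>x. x \<in> space M \<Longrightarrow> cmod (f u x) = 1"
  shows "finitary_Riesz_basis M f {u}"
proof -
  interpret prob_space M by fact
  have const: "x \<in> space M \<Longrightarrow> g x = g a" for x and g :: "'a \<Rightarrow> complex" using assms(2) by simp
  have m: "g \<in> borel_measurable M" for g :: "'a \<Rightarrow> complex"
    using const[of _ g] measurable_cong[of M g "\<lambda>_. g a" borel] by simp
  have L: "g \<in> L2_space M" for g
    by (rule L2_space_bounded[OF m, where B="cmod (g a)"]) (use assms(2) in auto)
  have norm: "L2_norm M g = cmod (g a)" for g
  proof -
    have "L2_norm M g = L2_norm M (\<lambda>_. g a)" by (rule L2_norm_cong) (rule const)
    also have "\<dots> = cmod (g a)" by (simp add: L2_norm_def prob_space)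
    finally show ?thesis .
  qed
  have fa: "cmod (f u a) = 1" using assms by simp
  hence fa0: "f u a \<noteq> 0" by auto
  have "Riesz_bounds M f {u} 1 1"
    unfolding Riesz_bounds_def norm
  proof (intro allI impI)
    fix F and c :: "'b \<Rightarrow> complex" assume "F \<subseteq> {u}"
    then consider "F = {}" | "F = {u}" by blast
    thus "1 * (\<Sum>n\<in>F. (cmod (c n))\<^sup>2) \<le> (cmod (\<Sum>n\<in>F. c n * f n a))\<^sup>2 \<and>
        (cmod (\<Sum>n\<in>F. c n * f n a))\<^sup>2 \<le> 1 * (\<Sum>n\<in>F. (cmod (c n))\<^sup>2)"
      by cases (simp_all add: norm_mult fa)
  qed
  moreover have "g \<in> L2_closed_span M f {u}" for g
    unfolding L2_closed_span_def norm
  proof (intro CollectI conjI allI impI L)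
    fix e :: real assume "0 < e"
    thus "\<exists>F c. finite F \<and> F \<subseteq> {u} \<and> cmod (g a - (\<Sum>n\<in>F. c n * f n a)) < e"
      using fa0 by (intro exI[of _ "{u}"] exI[of _ "\<lambda>_. g a / f u a"]) simp
  qed
  ultimately show ?thesis
    unfolding finitary_Riesz_basis_def using L by (auto intro!: exI[of _ 1])
qed

text \<open>The function \<open>e(k \<bullet> H y)\<close>, with both indices restricted to the coordinates in \<open>K\<close>.\<close>

definition cube_chi :: "('n \<Rightarrow> 'n \<Rightarrow> real) \<Rightarrow> 'n set \<Rightarrow> ('n \<Rightarrow> int) \<Rightarrow> ('n \<Rightarrow> real) \<Rightarrow> complex" where
  "cube_chi H K k y = chi 1 (\<Sum>a\<in>K. \<Sum>b\<in>K. of_int (k a) * H a b * y b)"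

text \<open>The coordinates are added in increasing order. For a new coordinate \<open>i\<close> above all of \<open>K\<close> the entries \<open>H a i\<close>
with \<open>a \<in> K\<close> vanish, so that \<open>y i\<close> occurs in the diagonal term alone, while the entries \<open>H i b\<close> contribute the
twisting factor.\<close>

lemma triangular_Riesz_basis_cube:
  fixes H :: "'n::linorder \<Rightarrow> 'n \<Rightarrow> real" and \<Gamma> :: "'n \<Rightarrow> int set"
  assumes tri: "\<And>a b. a < b \<Longrightarrow> H a b = 0"
    and R: "\<And>a. finitary_Riesz_basis (icc 1) (\<lambda>\<gamma>. chi (of_int \<gamma> * H a a)) (\<Gamma> a)"
    and K: "finite K"
  shows "finitary_Riesz_basis (PiM K (\<lambda>_. icc 1)) (cube_chi H K) (PiE K \<Gamma>)"
  using K
proof (induction K rule: finite_linorder_max_induct)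
  case empty
  have "finitary_Riesz_basis (PiM {} (\<lambda>_::'n. icc 1)) (cube_chi H {}) {\<lambda>_. undefined}"
    by (rule one_point_Riesz_basis[of _ "\<lambda>_. undefined"])
       (auto intro!: prob_space_PiM prob_space_icc_1 simp: space_PiM cube_chi_def)
  thus ?case by simp
next
  case (insert i K)
  let ?M = "PiM K (\<lambda>_::'n. icc 1)"
  let ?g = "\<lambda>\<gamma>. chi (of_int \<gamma> * H i i)"
  let ?w = "\<lambda>(\<gamma>::int) y. chi (of_int \<gamma>) (\<Sum>b\<in>K. H i b * y b)"
  let ?T = "\<lambda>(x, Y). Y(i := x)"
  have iK: "i \<notin> K" using insert by auto
  interpret M: prob_space ?M by (intro prob_space_PiM prob_space_icc_1)
  have comp: "(\<lambda>y. y b) \<in> borel_measurable (PiM L (\<lambda>_::'n. icc 1))" if "b \<in> L" for b L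
    using measurable_component_singleton[OF that, of "\<lambda>_. icc 1"] by (simp cong: measurable_cong_sets)
  have meas_w: "?w \<gamma> \<in> borel_measurable ?M" for \<gamma>
    by (rule measurable_compose[OF _ chi_measurable])
       (auto intro!: borel_measurable_sum borel_measurable_times comp)
  have meas_chi: "cube_chi H L k \<in> borel_measurable (PiM L (\<lambda>_::'n. icc 1))" for L k
    unfolding cube_chi_def[abs_def]
    by (rule measurable_compose[OF _ chi_measurable])
       (auto intro!: borel_measurable_sum borel_measurable_times comp)
  interpret S: skew_product_bases "icc 1" ?M ?g ?w "cube_chi H K" "\<Gamma> i" "PiE K \<Gamma>"
  proof (rule skew_product_bases.intro)
    show "finite_measure (icc 1)" by (rule finite_measure_icc)
    show "finite_measure ?M" by (rule M.finite_measure_axioms)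
    show "finitary_Riesz_basis (icc 1) ?g (\<Gamma> i)" by (rule R)
    show "finitary_Riesz_basis ?M (cube_chi H K) (PiE K \<Gamma>)" by (rule insert.IH)
    show "?w \<gamma> \<in> borel_measurable ?M" for \<gamma> by (rule meas_w)
    show "cmod (?w \<gamma> y) = 1" for \<gamma> y by simp
  qed
  have "finitary_Riesz_basis (icc 1 \<Otimes>\<^sub>M ?M) (\<lambda>p z. cube_chi H (insert i K) ((\<lambda>(\<gamma>, k). k(i := \<gamma>)) p) (?T z)) (\<Gamma> i \<times> PiE K \<Gamma>)"
  proof (rule finitary_Riesz_basis_cong[OF S.skew_product_Riesz_basis])
    fix p and z :: "real \<times> ('n \<Rightarrow> real)"
    assume "p \<in> \<Gamma> i \<times> PiE K \<Gamma>"
    obtain \<gamma> k where p: "p = (\<gamma>, k)" by force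
    obtain x Y where z: "z = (x, Y)" by force
    let ?k = "k(i := \<gamma>)" and ?Y = "Y(i := x)"
    have e1: "(\<Sum>b\<in>insert i K. of_int (?k a) * H a b * ?Y b) = (\<Sum>b\<in>K. of_int (k a) * H a b * Y b)" if "a \<in> K" for a
    proof -
      have "a < i" "a \<noteq> i" using insert that by auto
      thus ?thesis using iK insert.hyps(1) tri[of a i] by (auto simp: sum.insert intro!: sum.cong)
    qed
    have e2: "(\<Sum>b\<in>insert i K. of_int (?k i) * H i b * ?Y b) = of_int \<gamma> * H i i * x + (\<Sum>b\<in>K. of_int \<gamma> * H i b * Y b)"
      using iK insert.hyps(1) by (auto simp: sum.insert intro!: sum.cong)
    have "(\<Sum>a\<in>insert i K. \<Sum>b\<in>insert i K. of_int (?k a) * H a b * ?Y b)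
       = (of_int \<gamma> * H i i * x + (\<Sum>b\<in>K. of_int \<gamma> * H i b * Y b)) + (\<Sum>a\<in>K. \<Sum>b\<in>K. of_int (k a) * H a b * Y b)"
      using sum.insert[OF insert.hyps(1) iK, of "\<lambda>a. \<Sum>b\<in>insert i K. of_int (?k a) * H a b * ?Y b"] e1 e2
      by simp
    hence "cube_chi H (insert i K) ?k ?Y = chi 1 (of_int \<gamma> * H i i * x) *
        (chi 1 (\<Sum>b\<in>K. of_int \<gamma> * H i b * Y b) * cube_chi H K k Y)"
      by (simp add: cube_chi_def chi_add_arg mult.assoc)
    also have "chi 1 (of_int \<gamma> * H i i * x) = ?g \<gamma> x" by (simp add: chi_def mult.assoc)
    also have "chi 1 (\<Sum>b\<in>K. of_int \<gamma> * H i b * Y b) = ?w \<gamma> Y"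
      by (simp add: chi_def sum_distrib_left mult.assoc)
    finally show "cube_chi H (insert i K) ((\<lambda>(\<gamma>, k). k(i := \<gamma>)) p) (?T z) = skew_product ?g ?w (cube_chi H K) p z"
      by (simp only: p z skew_product_def prod.case)
  qed
  from finitary_Riesz_basis_image[where f = "\<lambda>k z. cube_chi H (insert i K) k (?T z)",
      OF inj_combinator[OF iK, of \<Gamma>] this]
  have "finitary_Riesz_basis (icc 1 \<Otimes>\<^sub>M ?M) (\<lambda>k z. cube_chi H (insert i K) k (?T z)) (PiE (insert i K) \<Gamma>)"
    by (simp add: PiE_insert_eq)
  hence "finitary_Riesz_basis (distr (icc 1 \<Otimes>\<^sub>M ?M) (PiM (insert i K) (\<lambda>_. icc 1)) ?T) (cube_chi H (insert i K)) (PiE (insert i K) \<Gamma>)"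
  proof (rule finitary_Riesz_basis_distr[where f = "cube_chi H (insert i K)" and T = ?T])
    show "?T \<in> measurable (icc 1 \<Otimes>\<^sub>M ?M) (PiM (insert i K) (\<lambda>_. icc 1))"
      unfolding case_prod_unfold by (rule measurable_fun_upd[where J=K]) auto
  qed (rule meas_chi)
  thus ?case
    by (simp add: distr_pair_PiM_eq_PiM[OF prob_space_icc_1 prob_space_icc_1])
qed

section \<open>From the unit cube to a parallelepiped\<close>

lemma nn_integral_lborel_translate:
  fixes u :: "'a::euclidean_space \<Rightarrow> ennreal"
  assumes [measurable]: "u \<in> borel_measurable borel"
  shows "(\<integral>\<^sup>+x. u (c + x) \<partial>lborel) = (\<integral>\<^sup>+x. u x \<partial>lborel)"
proof -
  have "(\<integral>\<^sup>+x. u x \<partial>distr lborel borel ((+) c)) = (\<integral>\<^sup>+x. u (c + x) \<partial>lborel)"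
    by (rule nn_integral_distr) auto
  thus ?thesis by (simp add: lborel_distr_plus)
qed

text \<open>The uniqueness argument for translation-invariant measures: integrate \<open>u (T y) v (x - T y)\<close> over both
variables, once as it stands and once after shifting \<open>y\<close> by the preimage of \<open>x\<close> under \<open>T\<close>.\<close>

lemma nn_integral_lborel_linear_times:
  fixes T S :: "'a::euclidean_space \<Rightarrow> 'a" and u v :: "'a \<Rightarrow> ennreal"
  assumes T: "linear T" and TS: "\<And>x. T (S x) = x" and S: "linear S"
    and u [measurable]: "u \<in> borel_measurable borel" and v [measurable]: "v \<in> borel_measurable borel"
  shows "(\<integral>\<^sup>+y. u (T y) \<partial>lborel) * (\<integral>\<^sup>+x. v x \<partial>lborel)
       = (\<integral>\<^sup>+y. v (- T y) \<partial>lborel) * (\<integral>\<^sup>+x. u x \<partial>lborel)"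
proof -
  have [measurable]: "T \<in> borel_measurable borel" "S \<in> borel_measurable borel"
    using T S by (auto intro!: borel_measurable_continuous_onI linear_continuous_on simp: linear_conv_bounded_linear)
  have "(\<integral>\<^sup>+y. u (T y) \<partial>lborel) * (\<integral>\<^sup>+x. v x \<partial>lborel) = (\<integral>\<^sup>+y. u (T y) * (\<integral>\<^sup>+x. v (- T y + x) \<partial>lborel) \<partial>lborel)"
    by (simp only: nn_integral_lborel_translate[OF v]) (rule nn_integral_multc[symmetric], measurable)
  also have "\<dots> = (\<integral>\<^sup>+y. \<integral>\<^sup>+x. u (T y) * v (- T y + x) \<partial>lborel \<partial>lborel)"
    by (simp add: nn_integral_cmult)
  also have "\<dots> = (\<integral>\<^sup>+x. \<integral>\<^sup>+y. u (T y) * v (- T y + x) \<partial>lborel \<partial>lborel)"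
    by (rule lborel_pair.Fubini') (simp add: case_prod_unfold)
  also have "\<dots> = (\<integral>\<^sup>+x. \<integral>\<^sup>+y. u (T y + x) * v (- T y) \<partial>lborel \<partial>lborel)"
  proof (rule nn_integral_cong)
    fix x
    have "(\<integral>\<^sup>+y. u (T y) * v (- T y + x) \<partial>lborel) = (\<integral>\<^sup>+y. u (T (S x + y)) * v (- T (S x + y) + x) \<partial>lborel)"
      by (rule nn_integral_lborel_translate[symmetric]) measurable
    thus "(\<integral>\<^sup>+y. u (T y) * v (- T y + x) \<partial>lborel) = (\<integral>\<^sup>+y. u (T y + x) * v (- T y) \<partial>lborel)"
      by (simp add: linear_add[OF T] TS add.commute)
  qed
  also have "\<dots> = (\<integral>\<^sup>+y. \<integral>\<^sup>+x. u (T y + x) * v (- T y) \<partial>lborel \<partial>lborel)"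
    by (rule lborel_pair.Fubini'[symmetric]) (simp add: case_prod_unfold)
  also have "\<dots> = (\<integral>\<^sup>+y. v (- T y) * (\<integral>\<^sup>+x. u x \<partial>lborel) \<partial>lborel)"
  proof (rule nn_integral_cong)
    fix y
    have "(\<integral>\<^sup>+x. u (T y + x) * v (- T y) \<partial>lborel) = (\<integral>\<^sup>+x. u (T y + x) \<partial>lborel) * v (- T y)"
      by (rule nn_integral_multc) measurable
    thus "(\<integral>\<^sup>+x. u (T y + x) * v (- T y) \<partial>lborel) = v (- T y) * (\<integral>\<^sup>+x. u x \<partial>lborel)"
      by (simp only: nn_integral_lborel_translate[OF u] mult.commute)
  qed
  also have "\<dots> = (\<integral>\<^sup>+y. v (- T y) \<partial>lborel) * (\<integral>\<^sup>+x. u x \<partial>lborel)"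
    by (rule nn_integral_multc) measurable
  finally show ?thesis .
qed

text \<open>The constant is the reciprocal of the absolute determinant of \<open>T\<close>. It is
finite because the preimage of a cube is bounded, and positive because the image of a cube is compact.\<close>

lemma nn_integral_lborel_linear:
  fixes T S :: "real^'n \<Rightarrow> real^'n"
  assumes T: "linear T" "\<And>x. T (S x) = x" and S: "linear S" "\<And>x. S (T x) = x"
  shows "\<exists>\<kappa>>0. \<forall>u\<in>borel_measurable borel. (\<integral>\<^sup>+y. u (T y) \<partial>lborel) = ennreal \<kappa> * (\<integral>\<^sup>+x. u x \<partial>lborel)"
proof -
  let ?v = "indicator (cbox 0 1) :: real^'n \<Rightarrow> ennreal"
  have "emeasure lborel (cbox 0 1 :: (real^'n) set) = ennreal (measure lborel (cbox 0 1 :: (real^'n) set))"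
    using emeasure_lborel_cbox_finite[of "0 :: real^'n" 1]
    by (intro emeasure_eq_ennreal_measure) (auto simp: infinity_ennreal_def)
  also have "measure lborel (cbox 0 1 :: (real^'n) set) = 1"
    by (subst content_cbox_cart) (auto simp: interval_ne_empty_cart)
  finally have v1: "(\<integral>\<^sup>+x. ?v x \<partial>lborel) = 1" by simp
  define k where "k = (\<integral>\<^sup>+y. ?v (- T y) \<partial>lborel)"
  have scale: "(\<integral>\<^sup>+y. u (T y) \<partial>lborel) = k * (\<integral>\<^sup>+x. u x \<partial>lborel)" if "u \<in> borel_measurable borel" for u
    using nn_integral_lborel_linear_times[OF T S(1) that, of ?v] v1 by (simp add: k_def)
  have bS: "bounded_linear S" and bT: "bounded_linear T"
    using S T by (auto simp: linear_conv_bounded_linear)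
  have "k < \<infinity>"
  proof -
    have c: "compact ((\<lambda>z. S (- z)) ` cbox 0 1)"
      by (intro compact_continuous_image compact_cbox linear_continuous_on
            bounded_linear_compose[OF bS] bounded_linear_minus bounded_linear_ident)
    have "k \<le> (\<integral>\<^sup>+y. indicator ((\<lambda>z. S (- z)) ` cbox 0 1) y \<partial>lborel)"
      unfolding k_def
    proof (rule nn_integral_mono)
      fix y
      have "y \<in> (\<lambda>z. S (- z)) ` cbox 0 1" if "- T y \<in> cbox 0 1"
        by (rule image_eqI[OF _ that]) (simp add: S(2))
      thus "?v (- T y) \<le> indicator ((\<lambda>z. S (- z)) ` cbox 0 1) y" by (auto simp: indicator_def)
    qed
    also have "\<dots> = emeasure lborel ((\<lambda>z. S (- z)) ` cbox 0 1)"
      using c by (intro nn_integral_indicator) (auto intro: borel_compact)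
    also have "\<dots> < \<infinity>" by (rule emeasure_compact_finite[OF c])
    finally show ?thesis .
  qed
  moreover have "k \<noteq> 0"
  proof
    assume k0: "k = 0"
    have c: "compact (T ` cbox 0 1)"
      by (intro compact_continuous_image compact_cbox linear_continuous_on bT)
    have "indicator (T ` cbox 0 1) (T y) = ?v y" for y
      using S(2) by (auto simp: indicator_def) (metis S(2))
    hence "(\<integral>\<^sup>+y. ?v y \<partial>lborel) = 0"
      using scale[OF borel_measurable_indicator[OF borel_compact[OF c]]] k0 by simp
    thus False using v1 by simp
  qed
  ultimately obtain \<kappa> where "0 < \<kappa>" "k = ennreal \<kappa>"
    by (cases k rule: ennreal_cases) (auto simp: less_le)
  thus ?thesis using scale by auto
qed

lemma vec_lambda_measurable:
  "(vec_lambda :: ('n::finite \<Rightarrow> real) \<Rightarrow> real^'n) \<in> measurable (PiM UNIV (\<lambda>_. lborel)) borel"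
proof (rule borel_measurable_euclidean_space[THEN iffD2], rule ballI)
  fix b :: "real^'n" assume "b \<in> Basis"
  then obtain i where b: "b = axis i 1" by (auto simp: Basis_vec_def)
  have "(\<lambda>f. f i) \<in> measurable (PiM UNIV (\<lambda>_::'n. lborel :: real measure)) lborel"
    by (rule measurable_component_singleton) simp
  thus "(\<lambda>x. vec_lambda x \<bullet> b) \<in> borel_measurable (PiM UNIV (\<lambda>_. lborel))"
    by (simp add: b inner_axis)
qed

lemma distr_PiM_lborel_vec_lambda:
  "distr (PiM UNIV (\<lambda>_::'n::finite. lborel)) borel vec_lambda = (lborel :: (real^'n) measure)"
proof (rule lborel_eqI[symmetric])
  interpret product_sigma_finite "\<lambda>_::'n. lborel :: real measure" ..
  fix l u :: "real^'n" assume le: "\<And>b. b \<in> Basis \<Longrightarrow> l \<bullet> b \<le> u \<bullet> b"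
  have le': "l $ i \<le> u $ i" for i
    using le[of "axis i 1"] by (simp add: inner_axis axis_in_Basis_iff)
  have "emeasure (distr (PiM UNIV (\<lambda>_::'n. lborel)) borel vec_lambda) (box l u)
      = emeasure (PiM UNIV (\<lambda>_::'n. lborel)) (PiE UNIV (\<lambda>i. {l $ i<..<u $ i}))"
    by (subst emeasure_distr[OF vec_lambda_measurable])
       (auto intro!: arg_cong[where f="emeasure _"] simp: mem_box_cart space_PiM PiE_iff)
  also have "\<dots> = (\<Prod>i\<in>UNIV. emeasure lborel {l $ i<..<u $ i})" by (rule emeasure_PiM) auto
  also have "\<dots> = ennreal (\<Prod>i\<in>UNIV. (u - l) $ i)"
    using le' by (simp add: prod_ennreal)
  also have "(\<Prod>i\<in>UNIV. (u - l) $ i) = (\<Prod>b\<in>Basis. (u - l) \<bullet> b)"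
    by (simp add: Basis_vec_def cart_eq_inner_axis axis_eq_axis prod.UNION_disjoint)
  finally show "emeasure (distr (PiM UNIV (\<lambda>_::'n. lborel)) borel vec_lambda) (box l u)
      = ennreal (\<Prod>b\<in>Basis. (u - l) \<bullet> b)" .
qed simp

lemma PiM_icc_1:
  "PiM UNIV (\<lambda>_::'n::finite. icc 1) =
     density (PiM UNIV (\<lambda>_. lborel)) (indicator (PiE UNIV (\<lambda>_. {0..1})))"
proof (rule sym, rule product_sigma_finite.PiM_eqI)
  interpret I: prob_space "icc 1" by (rule prob_space_icc_1)
  show "product_sigma_finite (\<lambda>_::'n. icc 1)" by unfold_locales
  interpret product_sigma_finite "\<lambda>_::'n. lborel :: real measure" ..
  have cube: "PiE UNIV (\<lambda>_. {0..1::real}) \<in> sets (PiM UNIV (\<lambda>_::'n. lborel))"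
    by (intro sets_PiM_I_finite) auto
  show "sets (density (PiM UNIV (\<lambda>_. lborel)) (indicator (PiE UNIV (\<lambda>_. {0..1})))) = sets (PiM UNIV (\<lambda>_::'n. icc 1))"
    by (auto intro!: sets_PiM_cong)
  fix A :: "'n \<Rightarrow> real set" assume A: "\<And>i. i \<in> UNIV \<Longrightarrow> A i \<in> sets (icc 1)"
  have A': "A i \<in> sets lborel" for i using A by simp
  have "emeasure (density (PiM UNIV (\<lambda>_. lborel)) (indicator (PiE UNIV (\<lambda>_. {0..1})))) (PiE UNIV A)
      = (\<integral>\<^sup>+y. indicator (PiE UNIV (\<lambda>_. {0..1})) y * indicator (PiE UNIV A) y \<partial>PiM UNIV (\<lambda>_. lborel))"
    by (rule emeasure_density) (use cube A' in \<open>auto intro!: sets_PiM_I_finite\<close>)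
  also have "\<dots> = (\<integral>\<^sup>+y. indicator (PiE UNIV (\<lambda>i. {0..1} \<inter> A i)) y \<partial>PiM UNIV (\<lambda>_. lborel))"
    by (intro nn_integral_cong) (auto simp: indicator_def)
  also have "\<dots> = emeasure (PiM UNIV (\<lambda>_. lborel)) (PiE UNIV (\<lambda>i. {0..1} \<inter> A i))"
    using A' by (intro nn_integral_indicator sets_PiM_I_finite) auto
  also have "\<dots> = (\<Prod>i\<in>UNIV. emeasure lborel ({0..1} \<inter> A i))" using A' by (intro emeasure_PiM) auto
  also have "\<dots> = (\<Prod>i\<in>UNIV. emeasure (icc 1) (A i))"
  proof (rule prod.cong[OF refl])
    fix i
    have "emeasure (icc 1) (A i) = (\<integral>\<^sup>+x. indicator (A i) x \<partial>icc 1)"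
      using A'[of i] by simp
    also have "\<dots> = (\<integral>\<^sup>+x. indicator {0..1} x * indicator (A i) x \<partial>lborel)"
      using A'[of i] by (intro nn_integral_icc) simp
    also have "\<dots> = (\<integral>\<^sup>+x. indicator ({0..1} \<inter> A i) x \<partial>lborel)"
      by (simp only: indicator_inter_arith)
    also have "\<dots> = emeasure lborel ({0..1} \<inter> A i)" using A'[of i] by simp
    finally show "emeasure lborel ({0..1} \<inter> A i) = emeasure (icc 1) (A i)" by simp
  qed
  finally show "emeasure (density (PiM UNIV (\<lambda>_. lborel)) (indicator (PiE UNIV (\<lambda>_. {0..1})))) (PiE UNIV A)
     = (\<Prod>i\<in>UNIV. emeasure (icc 1) (A i))" .
qed simp

lemma nn_integral_PiM_icc_1:
  fixes u :: "real^'n \<Rightarrow> ennreal"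
  assumes [measurable]: "u \<in> borel_measurable borel"
  shows "(\<integral>\<^sup>+y. u (vec_lambda y) \<partial>PiM UNIV (\<lambda>_. icc 1)) = (\<integral>\<^sup>+x. indicator (cbox 0 1) x * u x \<partial>lborel)"
proof -
  note [measurable] = vec_lambda_measurable
  have cube: "PiE UNIV (\<lambda>_. {0..1::real}) \<in> sets (PiM UNIV (\<lambda>_::'n. lborel))"
    by (intro sets_PiM_I_finite) auto
  have "(\<integral>\<^sup>+y. u (vec_lambda y) \<partial>PiM UNIV (\<lambda>_. icc 1))
      = (\<integral>\<^sup>+y. indicator (PiE UNIV (\<lambda>_. {0..1})) y * u (vec_lambda y) \<partial>PiM UNIV (\<lambda>_. lborel))"
    unfolding PiM_icc_1 by (rule nn_integral_density) (use cube in auto)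
  also have "\<dots> = (\<integral>\<^sup>+y. indicator (cbox 0 1) (vec_lambda y :: real^'n) * u (vec_lambda y) \<partial>PiM UNIV (\<lambda>_. lborel))"
    by (intro nn_integral_cong) (auto simp: indicator_def mem_box_cart)
  also have "\<dots> = (\<integral>\<^sup>+x. indicator (cbox 0 1) x * u x \<partial>distr (PiM UNIV (\<lambda>_. lborel)) borel vec_lambda)"
    by (rule nn_integral_distr[symmetric]) auto
  finally show ?thesis by (simp only: distr_PiM_lborel_vec_lambda)
qed

text \<open>Passing to a Borel representative brings functions on the domain into the range of the facts on product
and image measures, which concern Borel functions only.\<close>

lemma lebesgue_on_ex_borel:
  fixes g :: "'a::euclidean_space \<Rightarrow> complex"
  assumes D: "D \<in> sets borel" and g: "g \<in> borel_measurable (lebesgue_on D)"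
  shows "\<exists>g'\<in>borel_measurable borel. AE x in lebesgue_on D. g x = g' x"
proof -
  have D': "D \<in> sets lebesgue" using D by simp
  define G where "G x = (if x \<in> D then g x else 0)" for x
  have G: "G \<in> borel_measurable lebesgue"
    unfolding G_def[abs_def] using borel_measurable_if_I[OF g D'] .
  have "(\<lambda>x. Re (G x)) \<in> borel_measurable lebesgue" "(\<lambda>x. Im (G x)) \<in> borel_measurable lebesgue"
    using G by measurable
  note ri = this[THEN completion_ex_borel_measurable_real]
  obtain r where r: "r \<in> borel_measurable lborel" "AE x in lborel. Re (G x) = r x"
    using ri(1) by blast
  obtain i where i: "i \<in> borel_measurable lborel" "AE x in lborel. Im (G x) = i x"
    using ri(2) by blast
  have "(\<lambda>x. Complex (r x) (i x)) \<in> borel_measurable borel"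
  proof -
    have "(\<lambda>x. complex_of_real (r x) + \<i> * complex_of_real (i x)) \<in> borel_measurable borel"
      using r(1) i(1) by simp
    thus ?thesis by (simp add: Complex_eq)
  qed
  moreover have "AE x in lborel. G x = Complex (r x) (i x)"
    using r(2) i(2) by eventually_elim (simp add: complex_eq_iff)
  hence "AE x in lebesgue. G x = Complex (r x) (i x)" by (rule AE_completion)
  hence "AE x in lebesgue_on D. g x = Complex (r x) (i x)"
    using D' by (subst AE_restrict_space_iff) (auto simp: G_def elim!: eventually_mono)
  ultimately show ?thesis by (intro bexI[of _ "\<lambda>x. Complex (r x) (i x)"])
qed

lemma nn_integral_lebesgue_on:
  fixes u :: "'a::euclidean_space \<Rightarrow> ennreal"
  assumes D: "D \<in> sets borel" and u: "u \<in> borel_measurable borel"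
  shows "(\<integral>\<^sup>+x. u x \<partial>lebesgue_on D) = (\<integral>\<^sup>+x. indicator D x * u x \<partial>lborel)"
proof -
  have "(\<integral>\<^sup>+x. u x \<partial>lebesgue_on D) = (\<integral>\<^sup>+x. u x * indicator D x \<partial>lebesgue)"
    using D by (intro nn_integral_restrict_space) simp
  thus ?thesis by (simp add: nn_integral_completion mult.commute)
qed

text \<open>The substitution \<open>x = T y\<close> multiplies all squared \<open>L^2\<close>-norms by one constant.\<close>

lemma Riesz_basis_linear_image_cube:
  fixes T S :: "real^'n \<Rightarrow> real^'n"
  assumes T: "linear T" "\<And>x. T (S x) = x" and S: "linear S" "\<And>x. S (T x) = x"
    and f: "\<And>n. n \<in> I \<Longrightarrow> f n \<in> borel_measurable borel"
    and R: "finitary_Riesz_basis (PiM UNIV (\<lambda>_. icc 1)) (\<lambda>n y. f n (T (vec_lambda y))) I"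
  shows "finitary_Riesz_basis (lebesgue_on (T ` cbox 0 1)) f I"
proof -
  let ?P = "PiM UNIV (\<lambda>_::'n. icc 1)"
  define D where "D = T ` cbox 0 1"
  have bT: "bounded_linear T" using T by (simp add: linear_conv_bounded_linear)
  have [measurable]: "T \<in> borel_measurable borel"
    by (intro borel_measurable_continuous_onI linear_continuous_on bT)
  have "compact D" unfolding D_def
    by (intro compact_continuous_image compact_cbox linear_continuous_on bT)
  hence D [measurable]: "D \<in> sets borel" by (rule borel_compact)
  have memD: "T x \<in> D \<longleftrightarrow> x \<in> cbox 0 1" for x
    unfolding D_def using S(2) by (metis image_iff)
  obtain \<kappa> where k: "0 < \<kappa>"
    and lin: "\<And>u. u \<in> borel_measurable borel \<Longrightarrow> (\<integral>\<^sup>+y. u (T y) \<partial>lborel) = ennreal \<kappa> * (\<integral>\<^sup>+x. u x \<partial>lborel)"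
    using nn_integral_lborel_linear[OF T S] by blast
  have vec [measurable]: "(vec_lambda :: ('n \<Rightarrow> real) \<Rightarrow> real^'n) \<in> measurable ?P borel"
  proof -
    have "sets ?P = sets (PiM UNIV (\<lambda>_::'n. lborel :: real measure))" by (intro sets_PiM_cong) auto
    hence "measurable ?P (borel :: (real^'n) measure) = measurable (PiM UNIV (\<lambda>_. lborel)) borel"
      by (rule measurable_cong_sets) simp
    thus ?thesis using vec_lambda_measurable by simp
  qed
  have borel_leb: "g \<in> borel_measurable (lebesgue_on D)" if "g \<in> borel_measurable borel" for g :: "real^'n \<Rightarrow> complex"
    using that by (intro measurable_restrict_space1 measurable_completion) simp
  have int: "(\<integral>\<^sup>+y. ennreal ((cmod (g (T (vec_lambda y))))\<^sup>2) \<partial>?P) = ennreal \<kappa> * (\<integral>\<^sup>+x. ennreal ((cmod (g x))\<^sup>2) \<partial>lebesgue_on D)"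
    if [measurable]: "g \<in> borel_measurable borel" for g
  proof -
    have "(\<integral>\<^sup>+y. ennreal ((cmod (g (T (vec_lambda y))))\<^sup>2) \<partial>?P)
        = (\<integral>\<^sup>+x. indicator (cbox 0 1) x * ennreal ((cmod (g (T x)))\<^sup>2) \<partial>lborel)"
      by (rule nn_integral_PiM_icc_1) measurable
    also have "\<dots> = (\<integral>\<^sup>+x. indicator D (T x) * ennreal ((cmod (g (T x)))\<^sup>2) \<partial>lborel)"
      by (intro nn_integral_cong) (simp add: indicator_def memD)
    also have "\<dots> = ennreal \<kappa> * (\<integral>\<^sup>+x. indicator D x * ennreal ((cmod (g x))\<^sup>2) \<partial>lborel)"
      by (rule lin) measurable
    also have "(\<integral>\<^sup>+x. indicator D x * ennreal ((cmod (g x))\<^sup>2) \<partial>lborel) = (\<integral>\<^sup>+x. ennreal ((cmod (g x))\<^sup>2) \<partial>lebesgue_on D)"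
      by (rule nn_integral_lebesgue_on[symmetric, OF D]) measurable
    finally show ?thesis .
  qed
  have L2: "g \<in> L2_space (lebesgue_on D) \<longleftrightarrow> (\<lambda>y. g (T (vec_lambda y))) \<in> L2_space ?P"
    and norm: "L2_norm (lebesgue_on D) g = (1 / sqrt \<kappa>) * L2_norm ?P (\<lambda>y. g (T (vec_lambda y)))"
    if g [measurable]: "g \<in> borel_measurable borel" for g
  proof -
    have m: "(\<lambda>y. g (T (vec_lambda y))) \<in> borel_measurable ?P" by measurable
    show "g \<in> L2_space (lebesgue_on D) \<longleftrightarrow> (\<lambda>y. g (T (vec_lambda y))) \<in> L2_space ?P"
      unfolding L2_space_iff int[OF g] using k m borel_leb[OF g] by (auto simp: ennreal_mult_less_top)
    have "(LINT y|?P. (cmod (g (T (vec_lambda y))))\<^sup>2) = \<kappa> * (LINT x|lebesgue_on D. (cmod (g x))\<^sup>2)"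
      using k m borel_leb[OF g]
      by (subst (1 2) integral_eq_nn_integral) (auto simp: int[OF g] enn2real_mult)
    thus "L2_norm (lebesgue_on D) g = (1 / sqrt \<kappa>) * L2_norm ?P (\<lambda>y. g (T (vec_lambda y)))"
      using k by (simp add: L2_norm_def real_sqrt_mult)
  qed
  have fs: "(\<lambda>x. \<Sum>n\<in>F. c n * f n x) \<in> borel_measurable borel" if "F \<subseteq> I" for F c
    using f that by (auto intro!: borel_measurable_sum borel_measurable_times)
  have "finitary_Riesz_basis (lebesgue_on D) f I"
  proof (rule finitary_Riesz_basis_transfer[OF R, where K="1 / sqrt \<kappa>"])
    show "\<forall>n\<in>I. f n \<in> L2_space (lebesgue_on D)"
      using R f by (auto simp: finitary_Riesz_basis_def L2)
    show "L2_norm (lebesgue_on D) (\<lambda>x. \<Sum>n\<in>F. c n * f n x) =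
        1 / sqrt \<kappa> * L2_norm ?P (\<lambda>y. \<Sum>n\<in>F. c n * f n (T (vec_lambda y)))" if "finite F" "F \<subseteq> I" for F c
      by (rule norm[OF fs[OF that(2)]])
    fix g assume g: "g \<in> L2_space (lebesgue_on D)"
    obtain g' where g': "g' \<in> borel_measurable borel" "AE x in lebesgue_on D. g x = g' x"
      using lebesgue_on_ex_borel[OF D L2_spaceD(1)[OF g]] by blast
    have "g' \<in> L2_space (lebesgue_on D)"
      using L2_norm_cong_AE(2)[OF L2_spaceD(1)[OF g] borel_leb[OF g'(1)] g'(2)] g by simp
    hence "(\<lambda>y. g' (T (vec_lambda y))) \<in> L2_space ?P" by (simp add: L2 g')
    moreover have "L2_norm (lebesgue_on D) (\<lambda>x. g x - (\<Sum>n\<in>F. c n * f n x)) =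
        1 / sqrt \<kappa> * L2_norm ?P (\<lambda>y. g' (T (vec_lambda y)) - (\<Sum>n\<in>F. c n * f n (T (vec_lambda y))))"
      if "F \<subseteq> I" for F c
    proof -
      have "L2_norm (lebesgue_on D) (\<lambda>x. g x - (\<Sum>n\<in>F. c n * f n x)) = L2_norm (lebesgue_on D) (\<lambda>x. g' x - (\<Sum>n\<in>F. c n * f n x))"
        using g'(2) borel_leb[OF fs[OF that, of c]] borel_leb[OF g'(1)] L2_spaceD(1)[OF g]
        by (intro L2_norm_cong_AE(1) borel_measurable_diff) (auto elim!: eventually_mono)
      also have "\<dots> = 1 / sqrt \<kappa> * L2_norm ?P (\<lambda>y. g' (T (vec_lambda y)) - (\<Sum>n\<in>F. c n * f n (T (vec_lambda y))))"
        by (rule norm[OF borel_measurable_diff[OF g'(1) fs[OF that]]])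
      finally show ?thesis .
    qed
    ultimately show "\<exists>h\<in>L2_space ?P. \<forall>F c. finite F \<longrightarrow> F \<subseteq> I \<longrightarrow>
        L2_norm (lebesgue_on D) (\<lambda>x. g x - (\<Sum>n\<in>F. c n * f n x)) =
        1 / sqrt \<kappa> * L2_norm ?P (\<lambda>y. h y - (\<Sum>n\<in>F. c n * f n (T (vec_lambda y))))"
      by (intro bexI[of _ "\<lambda>y. g' (T (vec_lambda y))"]) auto
  qed (use k in auto)
  thus ?thesis by (simp add: D_def)
qed

section \<open>Riesz bases of exponentials for parallelepipeds\<close>

lemma matrix_inv_inverse:
  fixes A :: "real^'n^'n"
  assumes "invertible A"
  shows "A ** matrix_inv A = mat 1" "matrix_inv A ** A = mat 1"
  using someI_ex[OF assms[unfolded invertible_def]] by (auto simp: matrix_inv_def)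

text \<open>The cube contains the standard basis, so the range of \<open>C\<close> contains the columns of \<open>A\<close>.\<close>

lemma invertible_if_contains_cube_image:
  fixes A C :: "real^'n^'n"
  assumes A: "invertible A" and sub: "(\<lambda>x. A *v x) ` cbox 0 1 \<subseteq> range (\<lambda>x. C *v x)"
  shows "invertible C"
proof -
  have "axis i 1 \<in> (cbox 0 1 :: (real^'n) set)" for i
    by (simp add: mem_box_cart axis_def)
  hence col: "A *v axis i 1 \<in> range (\<lambda>x. C *v x)" for i using sub by blast
  have subsp: "subspace (range (\<lambda>x. C *v x))"
    by (intro linear_subspace_image matrix_vector_mul_linear subspace_UNIV)
  have "x \<in> range (\<lambda>x. C *v x)" for x
  proof -
    have "A *v (matrix_inv A *v x) = x"
      by (simp add: matrix_vector_mul_assoc matrix_inv_inverse[OF A])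
    moreover have "A *v z = (\<Sum>i\<in>UNIV. (z $ i) *\<^sub>R (A *v axis i 1))" for z
    proof -
      have "z = (\<Sum>i\<in>UNIV. (z $ i) *\<^sub>R axis i 1)"
        using basis_expansion[of z] by (simp add: scalar_mult_eq_scaleR)
      hence "A *v z = A *v (\<Sum>i\<in>UNIV. (z $ i) *\<^sub>R axis i 1)" by (rule arg_cong)
      also have "\<dots> = (\<Sum>i\<in>UNIV. (z $ i) *\<^sub>R (A *v axis i 1))"
        by (simp add: linear_sum[OF matrix_vector_mul_linear] linear_scale[OF matrix_vector_mul_linear])
      finally show ?thesis .
    qed
    moreover have "(\<Sum>i\<in>UNIV. (z $ i) *\<^sub>R (A *v axis i 1)) \<in> range (\<lambda>x. C *v x)" for z :: "real^'n"
      using subsp col by (intro subspace_sum subspace_scale) auto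
    ultimately show ?thesis by metis
  qed
  hence "surj (\<lambda>x. C *v x)" by blast
  thus ?thesis by (simp add: invertible_right_inverse matrix_right_invertible_surjective)
qed

lemma expfun_eq_chi: "expfun \<gamma> x = chi 1 (\<gamma> \<bullet> x)"
  by (simp add: expfun_def chi_def cis_conv_exp mult_ac)

lemma matrix_vector_inner: "(B *v x) \<bullet> y = x \<bullet> (transpose B *v y)" for B :: "real^'n^'m"
  using dot_lmul_matrix[of x "transpose B" y] by (metis transpose_matrix_vector transpose_transpose)

theorem theorem2:
  fixes A B R H :: "real^'n::{finite,linorder}^'n::{finite,linorder}"
  assumes "invertible A" and "invertible B"
    and "int_matrix R" and "invertible R"
    and "lower_triangular H" and "\<forall>i. 0 < H $ i $ i \<and> H $ i $ i \<le> 1"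
    and "(\<lambda>x. A *v x) ` cbox 0 1 =
         (\<lambda>x. (transpose (matrix_inv B) ** matrix_inv R ** H) *v x) ` cbox 0 1"
  shows "\<exists>\<Gamma>. \<Gamma> \<subseteq> (\<lambda>k. B *v k) ` int_lattice \<and>
           L2_Riesz_basis (lebesgue_on ((\<lambda>x. A *v x) ` cbox 0 1)) expfun \<Gamma>"
proof -
  define C where "C = transpose (matrix_inv B) ** matrix_inv R ** H"
  define T where "T x = C *v x" for x
  define S where "S x = matrix_inv C *v x" for x
  have D: "(\<lambda>x. A *v x) ` cbox 0 1 = T ` cbox 0 1" using assms(7) by (simp add: C_def T_def)
  have C: "invertible C"
    by (rule invertible_if_contains_cube_image[OF assms(1)]) (use D in \<open>auto simp: T_def\<close>)
  have T: "linear T" "T (S x) = x" and S: "linear S" "S (T x) = x" for x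
    unfolding T_def[abs_def] S_def[abs_def]
    by (simp_all add: matrix_vector_mul_assoc matrix_inv_inverse[OF C])
  have "\<exists>\<Gamma>::int set. finitary_Riesz_basis (icc 1) (\<lambda>\<gamma>. chi (of_int \<gamma> * H $ i $ i)) \<Gamma>" for i
  proof -
    define h where "h = H $ i $ i"
    have h: "0 < h" "h \<le> 1" using assms(6) by (auto simp: h_def)
    obtain \<Gamma> :: "int set" where G: "finitary_Riesz_basis (icc h) int_chi \<Gamma>"
      using integer_Riesz_basis_interval[OF h] by blast
    have "(\<lambda>(\<gamma>::int) x. chi (of_int \<gamma> * h) (1 / h * x)) = int_chi"
      using h by (intro ext) (simp only: chi_scale, simp)
    hence "finitary_Riesz_basis (icc (1 / h * h)) (\<lambda>\<gamma>. chi (of_int \<gamma> * h)) \<Gamma>"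
      using G h by (intro finitary_Riesz_basis_icc_scale) auto
    thus ?thesis using h by (auto simp: h_def)
  qed
  then obtain \<Gamma> :: "'n \<Rightarrow> int set" where \<Gamma>: "\<And>i. finitary_Riesz_basis (icc 1) (\<lambda>\<gamma>. chi (of_int \<gamma> * H $ i $ i)) (\<Gamma> i)"
    by metis
  let ?K = "PiE UNIV \<Gamma>"
  have cube: "finitary_Riesz_basis (PiM UNIV (\<lambda>_. icc 1)) (cube_chi (\<lambda>a b. H $ a $ b) UNIV) ?K"
    by (rule triangular_Riesz_basis_cube) (use assms(5) \<Gamma> in \<open>auto simp: lower_triangular_def\<close>)
  \<comment> \<open>\<open>R\<^sup>T\<close> in front of the integer vector cancels \<open>R\<^sup>-\<^sup>1\<close> in \<open>C\<close>\<close>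
  define \<eta> where "\<eta> k = B *v (transpose R *v (\<chi> i. real_of_int (k i)))" for k :: "'n \<Rightarrow> int"
  have "inj \<eta>"
  proof (rule injI)
    fix k l assume "\<eta> k = \<eta> l"
    moreover have "invertible (transpose R)"
      using assms(4) left_invertible_transpose[of R]
      by (simp add: invertible_left_inverse[of "transpose R"] invertible_right_inverse[of R])
    hence "inj ((*v) B)" "inj ((*v) (transpose R))"
      using assms(2) by (auto intro!: inj_matrix_vector_mult)
    ultimately have "(\<chi> i. real_of_int (k i)) = (\<chi> i. real_of_int (l i))"
      unfolding \<eta>_def by (simp only: inj_eq)
    thus "k = l" by (simp add: vec_eq_iff fun_eq_iff)
  qed
  hence inj: "inj_on \<eta> ?K" by (rule inj_on_subset) simp
  have inner: "\<eta> k \<bullet> T x = (\<chi> i. real_of_int (k i)) \<bullet> (H *v x)" for k x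
  proof -
    have "transpose B ** transpose (matrix_inv B) = mat 1"
      by (simp add: matrix_inv_inverse[OF assms(2)] transpose_mat flip: matrix_transpose_mul)
    hence "transpose B ** C = matrix_inv R ** H" unfolding C_def by (simp add: matrix_mul_assoc)
    hence "R ** (transpose B ** C) = H"
      by (simp add: matrix_mul_assoc matrix_inv_inverse[OF assms(4)])
    moreover have "\<eta> k \<bullet> T x = (\<chi> i. real_of_int (k i)) \<bullet> ((R ** (transpose B ** C)) *v x)"
      unfolding \<eta>_def T_def matrix_vector_inner by (simp only: matrix_vector_mul_assoc transpose_transpose)
    ultimately show ?thesis by simp
  qed
  have "expfun (\<eta> k) (T (vec_lambda y)) = cube_chi (\<lambda>a b. H $ a $ b) UNIV k y" for k y
    unfolding expfun_eq_chi inner cube_chi_def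
    by (simp add: inner_vec_def matrix_vector_mult_def sum_distrib_left mult.assoc)
  hence "finitary_Riesz_basis (PiM UNIV (\<lambda>_. icc 1)) (\<lambda>k y. expfun (\<eta> k) (T (vec_lambda y))) ?K"
    using cube by simp
  hence "finitary_Riesz_basis (lebesgue_on (T ` cbox 0 1)) (\<lambda>k. expfun (\<eta> k)) ?K"
    by (rule Riesz_basis_linear_image_cube[OF T S, rotated])
       (auto simp: expfun_eq_chi intro!: measurable_compose[OF _ chi_measurable])
  from finitary_Riesz_basis_image[OF inj this]
  have R: "finitary_Riesz_basis (lebesgue_on (T ` cbox 0 1)) expfun (\<eta> ` ?K)" .
  have "compact (T ` cbox 0 1)"
    using T(1) by (intro compact_continuous_image compact_cbox linear_continuous_on) (simp add: linear_conv_bounded_linear)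
  hence "finite_measure (lebesgue_on (T ` cbox 0 1))"
    by (intro finite_measure_lebesgue_on lmeasurable_compact)
  moreover have "countable (\<eta> ` ?K)" by (intro countable_image countable_PiE) auto
  ultimately have "L2_Riesz_basis (lebesgue_on (T ` cbox 0 1)) expfun (\<eta> ` ?K)"
    by (intro finite_measure.L2_Riesz_basis_if_finitary R)
  moreover have "\<eta> ` ?K \<subseteq> (\<lambda>k. B *v k) ` int_lattice"
  proof -
    have "transpose R *v (\<chi> i. real_of_int (k i)) \<in> int_lattice" for k :: "'n \<Rightarrow> int"
      using assms(3) by (auto simp: int_lattice_def int_matrix_def matrix_vector_mult_def transpose_def
          simp del: transpose_matrix_vector intro!: Ints_sum Ints_mult)
    thus ?thesis unfolding \<eta>_def by blast
  qed
  ultimately show ?thesis unfolding D by blast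
qed

end
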